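(* Let $V$ be a complete discrete valuation ring with fraction field $F$, let $\lambda\in V$ with $|\lambda|=1$, and put $\underline A=V[\mathbb Z^2,c]\otimes F$ and $\underline A^\dagger=V[\mathbb Z^2,c]^\dagger\otimes F$, where $c((m_1,n_1),(m_2,n_2))=\lambda^{n_1m_2}$. The natural map $\underline A\to\underline A^\dagger$ induces isomorphisms of $F$-vector spaces $$\mathrm{HH}_n(\underline A)\cong\mathrm{HH}_n(\underline A^\dagger)=\begin{cases}F & n=0\\ F\oplus F & n=1\\ F& n=2\\ 0& n\ge3.\end{cases}$$
   Context: $\nu$ is the valuation of $V$. $V[\mathbb Z^2,c]$ is the $V$-module $V[\mathbb Z^2]$ with fine bornology (bounded = contained in a finitely generated submodule) and twisted convolution $\delta_{(m,n)}*\delta_{(m',n')}=c((m,n),(m',n'))\,\delta_{(m+m',n+n')}$; it is generated by $U_1^{\pm1}=\delta_{(\pm1,0)}$ and $U_2^{\pm1}=\delta_{(0,\pm1)}$ up to scalars, with $U_2U_1=\lambda U_1U_2$. Its dagger completion $V[\mathbb Z^2,c]^\dagger$ (the nonarchimedean noncommutative torus) consists of the series $\sum_{(m,n)\in\mathbb Z^2}x_{m,n}\delta_{(m,n)}$, $x_{m,n}\in V$, for which there is $C>0$ with $\nu(x_{m,n})+1\ge C(|m|+|n|)$ for all $(m,n)$; a subset is bounded iff a common $C$ works; the multiplication extends the twisted convolution. Hochschild homology $\mathrm{HH}_*$ is taken in the category of complete bornological $F$-vector spaces with the completed projective bornological tensor product, i.e. it is the homology of the Hochschild complex $(\Omega^\bullet(A),b)$,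 $\Omega^n(A)\cong A\,\hat\otimes\,\bar A^{\hat\otimes n}$, $\bar A=A/1$.
   Formalization: Besides |λ|=1 it is assumed that λ is not a root of unity and, if V has characteristic p>0, that |λ^k−1|=1 for all k>0; for every other λ the claim fails, since HH_0 of the dagger algebra is then larger than F (e.g. λ=1). *)

theory Defs
  imports
    "HOL-Computational_Algebra.Polynomial_Factorial"
    "HOL-Library.Extended_Real"
    "HOL-Library.Function_Algebras"
    "HOL-Library.Product_Plus"
begin

section \<open>Complete discrete valuation rings\<close>

text \<open>The fraction field of a discrete valuation ring \<open>'v\<close> is the library type \<open>'v fract\<close>,
  with the embedding \<open>to_fract\<close>.\<close>

definition (in idom) uniformizer :: "'a \<Rightarrow> bool" where
  "uniformizer p \<longleftrightarrow> p \<noteq> 0 \<and> \<not> p dvd 1 \<and> (\<forall>x. x \<noteq> 0 \<longrightarrow> (\<exists>u n. u dvd 1 \<and> x = u * p ^ n))"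

class dvr = idom +
  assumes ex_uniformizer: "\<exists>p. uniformizer p"

class complete_dvr = dvr +
  assumes adically_complete:
    "uniformizer p \<Longrightarrow> (\<And>n. p ^ n dvd X (Suc n) - X n) \<Longrightarrow> \<exists>L. \<forall>n. p ^ n dvd X n - L"

definition unif :: "'v::dvr" where
  "unif = (SOME p. uniformizer p)"

text \<open>The normalised valuation, with \<open>val 0 = \<infinity>\<close>; thus \<open>\<bar>x\<bar> = 1\<close> means \<open>val x = 0\<close>.\<close>

definition val :: "'v::dvr \<Rightarrow> enat" where
  "val x = (SUP n \<in> {n. unif ^ n dvd x}. enat n)"

text \<open>Unconditional summation for the adic topology of the ring. A family with finite support
  sums to its finite sum.\<close>

definition adic_sums :: "('i \<Rightarrow> 'v::dvr) \<Rightarrow> 'v \<Rightarrow> bool" where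
  "adic_sums f s \<longleftrightarrow>
     (\<forall>k. \<exists>I. finite I \<and> (\<forall>J. finite J \<and> I \<subseteq> J \<longrightarrow> unif ^ k dvd s - sum f J))"

definition adic_sum :: "('i \<Rightarrow> 'v::dvr) \<Rightarrow> 'v" where
  "adic_sum f = (THE s. adic_sums f s)"


section \<open>Bornological algebras\<close>

text \<open>Addition on the carrier is that of the ambient type.\<close>

record ('k, 'a) born_alg =
  Carrier :: "'a set"
  Scale :: "'k \<Rightarrow> 'a \<Rightarrow> 'a"
  Mult :: "'a \<Rightarrow> 'a \<Rightarrow> 'a"
  One :: 'a
  Bounded :: "'a set set"

definition pscale :: "'k::times \<Rightarrow> ('i \<Rightarrow> 'k) \<Rightarrow> 'i \<Rightarrow> 'k" where
  "pscale c x = (\<lambda>i. c * x i)"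

definition delta :: "'i \<Rightarrow> 'i \<Rightarrow> 'k::zero_neq_one" where
  "delta i = (\<lambda>j. if j = i then 1 else 0)"


subsection \<open>The twisted group algebra of \<open>\<int>\<^sup>2\<close> and its dagger completion\<close>

definition unit_power :: "'v::idom \<Rightarrow> int \<Rightarrow> 'v" where
  "unit_power l k = (if k \<ge> 0 then l ^ nat k else (THE u. u * l ^ nat (- k) = 1))"

definition cocycle :: "'v::idom \<Rightarrow> int \<times> int \<Rightarrow> int \<times> int \<Rightarrow> 'v" where
  "cocycle l g h = unit_power l (snd g * fst h)"

definition twisted_conv ::
  "'v::dvr \<Rightarrow> (int \<times> int \<Rightarrow> 'v) \<Rightarrow> (int \<times> int \<Rightarrow> 'v) \<Rightarrow> int \<times> int \<Rightarrow> 'v" where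
  "twisted_conv l x y = (\<lambda>g. adic_sum (\<lambda>h. cocycle l h (g - h) * x h * y (g - h)))"

definition torus :: "'v::dvr \<Rightarrow> ('v, int \<times> int \<Rightarrow> 'v) born_alg" where
  "torus l =
    \<lparr> Carrier = {x. finite {g. x g \<noteq> 0}},
      Scale = pscale,
      Mult = twisted_conv l,
      One = delta 0,
      Bounded = {S. \<exists>T. finite T \<and> T \<subseteq> {x. finite {g. x g \<noteq> 0}} \<and> S \<subseteq> module.span pscale T} \<rparr>"

definition dagger_growth :: "real \<Rightarrow> (int \<times> int \<Rightarrow> 'v::dvr) \<Rightarrow> bool" where
  "dagger_growth C x \<longleftrightarrow>
     (\<forall>m n. ereal_of_enat (val (x (m, n))) + 1 \<ge> ereal (C * real_of_int (\<bar>m\<bar> + \<bar>n\<bar>)))"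

definition torus_dagger :: "'v::dvr \<Rightarrow> ('v, int \<times> int \<Rightarrow> 'v) born_alg" where
  "torus_dagger l =
    \<lparr> Carrier = {x. \<exists>C>0. dagger_growth C x},
      Scale = pscale,
      Mult = twisted_conv l,
      One = delta 0,
      Bounded = {S. \<exists>C>0. \<forall>x\<in>S. dagger_growth C x} \<rparr>"


subsection \<open>Base change to the fraction field\<close>

text \<open>For a submodule \<open>M\<close> of a module of functions \<open>'i \<Rightarrow> 'v\<close>, the base change to the fraction
  field consists of the fractions \<open>x / c\<close> with \<open>x \<in> M\<close> and \<open>c \<noteq> 0\<close>, inside \<open>'i \<Rightarrow> 'v fract\<close>.\<close>

definition fraction :: "'v::idom \<Rightarrow> ('i \<Rightarrow> 'v) \<Rightarrow> 'i \<Rightarrow> 'v fract" where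
  "fraction c x = (\<lambda>i. Fract (x i) c)"

definition base_change ::
  "('v::idom, 'i \<Rightarrow> 'v) born_alg \<Rightarrow> ('v fract, 'i \<Rightarrow> 'v fract) born_alg" where
  "base_change M =
    \<lparr> Carrier = {fraction c x | c x. c \<noteq> 0 \<and> x \<in> Carrier M},
      Scale = pscale,
      Mult = (\<lambda>y y'. THE z. \<exists>c x d x'. c \<noteq> 0 \<and> d \<noteq> 0 \<and> x \<in> Carrier M \<and> x' \<in> Carrier M \<and>
                y = fraction c x \<and> y' = fraction d x' \<and> z = fraction (c * d) (Mult M x x')),
      One = fraction 1 (One M),
      Bounded = {Y. \<exists>c S. c \<noteq> 0 \<and> S \<in> Bounded M \<and> Y \<subseteq> fraction c ` S} \<rparr>"


section \<open>Completion of bornological vector spaces\<close>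

text \<open>A quotient \<open>numer / denom\<close> of two subspaces of an ambient vector space.\<close>

record 'm subquot =
  numer :: "'m set"
  denom :: "'m set"

definition pi_mult :: "nat \<Rightarrow> ('i \<Rightarrow> 'v::dvr fract) set \<Rightarrow> ('i \<Rightarrow> 'v fract) set" where
  "pi_mult k L = pscale (to_fract (unif ^ k)) ` L"

definition cauchy_in :: "('i \<Rightarrow> 'v::dvr fract) set \<Rightarrow> (nat \<Rightarrow> 'i \<Rightarrow> 'v fract) \<Rightarrow> bool" where
  "cauchy_in L x \<longleftrightarrow> (\<forall>k. \<exists>N. \<forall>i\<ge>N. \<forall>j\<ge>N. x i - x j \<in> pi_mult k L)"

abbreviation seq_scale :: "'k::times \<Rightarrow> (nat \<Rightarrow> 'i \<Rightarrow> 'k) \<Rightarrow> nat \<Rightarrow> 'i \<Rightarrow> 'k" where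
  "seq_scale c x \<equiv> (\<lambda>i. pscale c (x i))"

text \<open>Let \<open>\<L>\<close> be a directed, cofinal family of bounded submodules (over the valuation ring) of the
  bornological vector space \<open>M\<close>. A Cauchy sequence for the adic topology of some \<open>L \<in> \<L>\<close>
  represents a point of the inductive limit of the adic completions of the \<open>L \<in> \<L>\<close>, and
  \<open>born_lim \<L> X x\<close> says that the points represented by \<open>X 0, X 1, \<dots>\<close> converge bornologically to
  the point represented by \<open>x\<close>: for one \<open>L \<in> \<L>\<close> and all \<open>k\<close>, almost all differences lie in the
  image of \<open>\<pi>\<^sup>k\<close> times the completion of \<open>L\<close>. The completion of \<open>M\<close> is the separated quotient of
  this limit, that is, its quotient by the bornological closure of \<open>0\<close>. This closure contains the
  null sequences, which are limits of the constant sequence \<open>0\<close>. The space \<open>M\<close> itself need not be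
  separated.\<close>

definition born_lim ::
  "('i \<Rightarrow> 'v::dvr fract) set set \<Rightarrow> (nat \<Rightarrow> nat \<Rightarrow> 'i \<Rightarrow> 'v fract) \<Rightarrow> (nat \<Rightarrow> 'i \<Rightarrow> 'v fract) \<Rightarrow> bool" where
  "born_lim \<L> X x \<longleftrightarrow> (\<exists>L\<in>\<L>. \<forall>k. \<exists>J. \<forall>j\<ge>J.
      cauchy_in L (x - X j) \<and> (\<exists>N. \<forall>i\<ge>N. (x - X j) i \<in> pi_mult k L))"

definition cauchy_seqs ::
  "('i \<Rightarrow> 'v::dvr fract) set \<Rightarrow> ('i \<Rightarrow> 'v fract) set set \<Rightarrow> (nat \<Rightarrow> 'i \<Rightarrow> 'v fract) set" where
  "cauchy_seqs M \<L> = {x. range x \<subseteq> M \<and> (\<exists>L\<in>\<L>. cauchy_in L x)}"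

definition completion ::
  "('i \<Rightarrow> 'v::dvr fract) set \<Rightarrow> ('i \<Rightarrow> 'v fract) set set \<Rightarrow> (nat \<Rightarrow> 'i \<Rightarrow> 'v fract) subquot" where
  "completion M \<L> =
    \<lparr> numer = cauchy_seqs M \<L>,
      denom = \<Inter>{N. N \<subseteq> cauchy_seqs M \<L> \<and> module.subspace seq_scale N \<and>
                    (\<forall>X. \<forall>x\<in>cauchy_seqs M \<L>. range X \<subseteq> N \<and> born_lim \<L> X x \<longrightarrow> x \<in> N)} \<rparr>"


section \<open>The Hochschild complex\<close>

text \<open>The space \<open>A \<otimes> (A/1)\<^sup>\<otimes>\<^sup>n\<close> is the quotient of the vector space \<open>form_free A n\<close>, freely spanned
  by the words \<open>[a\<^sub>0, \<dots>, a\<^sub>n]\<close> in \<open>A\<close>, by the subspace \<open>form_rel A n\<close>. The word stands for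
  \<open>a\<^sub>0 \<otimes> \<dots> \<otimes> a\<^sub>n = a\<^sub>0 da\<^sub>1 \<dots> da\<^sub>n\<close>; the relations are multilinearity and \<open>d1 = 0\<close>.\<close>

definition words :: "'a set \<Rightarrow> nat \<Rightarrow> 'a list set" where
  "words S n = {xs. length xs = Suc n \<and> set xs \<subseteq> S}"

definition form_free :: "('k::field, 'a) born_alg \<Rightarrow> nat \<Rightarrow> ('a list \<Rightarrow> 'k) set" where
  "form_free A n = {f. finite {xs. f xs \<noteq> 0} \<and> {xs. f xs \<noteq> 0} \<subseteq> words (Carrier A) n}"

definition form_rel :: "('k::field, 'a::ab_group_add) born_alg \<Rightarrow> nat \<Rightarrow> ('a list \<Rightarrow> 'k) set" where
  "form_rel A n = module.span pscale
    ({delta (xs[i := a + a']) - delta (xs[i := a]) - delta (xs[i := a']) | xs i a a'.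
        xs \<in> words (Carrier A) n \<and> i \<le> n \<and> a \<in> Carrier A \<and> a' \<in> Carrier A} \<union>
     {delta (xs[i := Scale A c a]) - pscale c (delta (xs[i := a])) | xs i c a.
        xs \<in> words (Carrier A) n \<and> i \<le> n \<and> a \<in> Carrier A} \<union>
     {delta (xs[i := One A]) | xs i. xs \<in> words (Carrier A) n \<and> 1 \<le> i \<and> i \<le> n})"

text \<open>The projective tensor bornology is generated by the images of \<open>S\<^sub>0 \<otimes> \<dots> \<otimes> S\<^sub>n\<close> for bounded
  \<open>S\<^sub>i\<close>; taking all \<open>S\<^sub>i\<close> equal gives a cofinal family. The submodules below are the preimages
  in \<open>form_free A n\<close> of the submodules of \<open>A \<otimes> (A/1)\<^sup>\<otimes>\<^sup>n\<close> generated by these sets. Completing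
  \<open>form_free A n\<close> with respect to them amounts to completing the quotient by \<open>form_rel A n\<close>, because
  this subspace lies in each of them, hence in the closure of \<open>0\<close>.\<close>

definition form_lattice ::
  "('v::dvr fract, 'a::ab_group_add) born_alg \<Rightarrow> nat \<Rightarrow> 'a set \<Rightarrow> ('a list \<Rightarrow> 'v fract) set" where
  "form_lattice A n S =
     {x + r | x r. x \<in> module.span (\<lambda>v. pscale (to_fract v)) (delta ` words S n) \<and> r \<in> form_rel A n}"

text \<open>\<open>\<Omega>\<^sup>n(A)\<close>, the completed projective bornological tensor product of \<open>A\<close> and \<open>n\<close> copies of
  \<open>A/1\<close>.\<close>

definition Omega ::
  "('v::dvr fract, 'a::ab_group_add) born_alg \<Rightarrow> nat \<Rightarrow> (nat \<Rightarrow> 'a list \<Rightarrow> 'v fract) subquot" where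
  "Omega A n = completion (form_free A n) (form_lattice A n ` Bounded A)"

definition lin_ext :: "('i \<Rightarrow> 'j \<Rightarrow> 'k::field) \<Rightarrow> ('i \<Rightarrow> 'k) \<Rightarrow> 'j \<Rightarrow> 'k" where
  "lin_ext \<phi> f = (\<Sum>i | f i \<noteq> 0. pscale (f i) (\<phi> i))"

definition b_word :: "('k::field, 'a) born_alg \<Rightarrow> 'a list \<Rightarrow> 'a list \<Rightarrow> 'k" where
  "b_word A xs = (let n = length xs - 1 in
     if n = 0 then 0 else
       (\<Sum>i<n. pscale ((- 1) ^ i)
          (delta (take i xs @ [Mult A (xs ! i) (xs ! Suc i)] @ drop (i + 2) xs))) +
       pscale ((- 1) ^ n) (delta (Mult A (last xs) (hd xs) # butlast (tl xs))))"

definition hochschild_b ::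
  "('k::field, 'a) born_alg \<Rightarrow> (nat \<Rightarrow> 'a list \<Rightarrow> 'k) \<Rightarrow> nat \<Rightarrow> 'a list \<Rightarrow> 'k" where
  "hochschild_b A x = (\<lambda>i. lin_ext (b_word A) (x i))"


section \<open>Hochschild homology\<close>

record ('k, 'q) vect =
  vcarrier :: "'q set"
  vadd :: "'q \<Rightarrow> 'q \<Rightarrow> 'q"
  vscale :: "'k \<Rightarrow> 'q \<Rightarrow> 'q"

definition quotient_space ::
  "(nat \<Rightarrow> 'i \<Rightarrow> 'k::field) set \<Rightarrow> (nat \<Rightarrow> 'i \<Rightarrow> 'k) set \<Rightarrow> ('k, (nat \<Rightarrow> 'i \<Rightarrow> 'k) set) vect" where
  "quotient_space Z B =
    \<lparr> vcarrier = {{z + b | b. b \<in> B} | z. z \<in> Z},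
      vadd = (\<lambda>X Y. {x + y | x y. x \<in> X \<and> y \<in> Y}),
      vscale = (\<lambda>c X. {seq_scale c x + b | x b. x \<in> X \<and> b \<in> B}) \<rparr>"

text \<open>The preimages, among the representatives of elements of \<open>\<Omega>\<^sup>n(A)\<close>, of the kernel of
  \<open>b : \<Omega>\<^sup>n(A) \<rightarrow> \<Omega>\<^sup>n\<^sup>-\<^sup>1(A)\<close> and of the image of \<open>b : \<Omega>\<^sup>n\<^sup>+\<^sup>1(A) \<rightarrow> \<Omega>\<^sup>n(A)\<close>.\<close>

definition hochschild_cycles ::
  "('v::dvr fract, 'a::ab_group_add) born_alg \<Rightarrow> nat \<Rightarrow> (nat \<Rightarrow> 'a list \<Rightarrow> 'v fract) set" where
  "hochschild_cycles A n =
     {x \<in> numer (Omega A n). n = 0 \<or> hochschild_b A x \<in> denom (Omega A (n - 1))}"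

definition hochschild_boundaries ::
  "('v::dvr fract, 'a::ab_group_add) born_alg \<Rightarrow> nat \<Rightarrow> (nat \<Rightarrow> 'a list \<Rightarrow> 'v fract) set" where
  "hochschild_boundaries A n =
     {x \<in> numer (Omega A n). \<exists>y \<in> numer (Omega A (Suc n)). x - hochschild_b A y \<in> denom (Omega A n)}"

definition HH ::
  "nat \<Rightarrow> ('v::dvr fract, 'a::ab_group_add) born_alg \<Rightarrow>
   ('v fract, (nat \<Rightarrow> 'a list \<Rightarrow> 'v fract) set) vect" where
  "HH n A = quotient_space (hochschild_cycles A n) (hochschild_boundaries A n)"

text \<open>The map induced by a bounded unital algebra homomorphism \<open>\<phi>\<close> into \<open>A'\<close>, on cosets.\<close>

definition HH_map ::
  "nat \<Rightarrow> ('a \<Rightarrow> 'a') \<Rightarrow> ('v::dvr fract, 'a'::ab_group_add) born_alg \<Rightarrow>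
   (nat \<Rightarrow> 'a list \<Rightarrow> 'v fract) set \<Rightarrow> (nat \<Rightarrow> 'a' list \<Rightarrow> 'v fract) set" where
  "HH_map n \<phi> A' X =
     {(\<lambda>i. lin_ext (\<lambda>xs. delta (map \<phi> xs)) (x i)) + b | x b.
        x \<in> X \<and> b \<in> hochschild_boundaries A' n}"


subsection \<open>Isomorphisms of vector spaces\<close>

definition vect_iso :: "('p \<Rightarrow> 'q) \<Rightarrow> ('k, 'p) vect \<Rightarrow> ('k, 'q) vect \<Rightarrow> bool" where
  "vect_iso f X Y \<longleftrightarrow>
     bij_betw f (vcarrier X) (vcarrier Y) \<and>
     (\<forall>x\<in>vcarrier X. \<forall>y\<in>vcarrier X. f (vadd X x y) = vadd Y (f x) (f y)) \<and>
     (\<forall>c. \<forall>x\<in>vcarrier X. f (vscale X c x) = vscale Y c (f x))"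

definition vect_isomorphic :: "('k, 'p) vect \<Rightarrow> ('k, 'q) vect \<Rightarrow> bool" where
  "vect_isomorphic X Y \<longleftrightarrow> (\<exists>f. vect_iso f X Y)"

definition coord_space :: "nat \<Rightarrow> ('k::field, nat \<Rightarrow> 'k) vect" where
  "coord_space d = \<lparr> vcarrier = {v. \<forall>i\<ge>d. v i = 0}, vadd = (+), vscale = pscale \<rparr>"

end

theory Submission
  imports Defs "HOL-Library.Discrete_Functions"
begin

text \<open>A Cauchy sequence of forms is, up to a null sequence, a sequence of finite linear combinations of
  words \<open>U\<^bsub>h\<^sub>0\<^esub> \<otimes> \<dots> \<otimes> U\<^bsub>h\<^sub>n\<^esub>\<close> in the monomials of the torus, both for the algebra and for its dagger completion; the
  two complexes differ only in the growth condition on the coefficients. On such combinations there is one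
  explicit contraction of the Hochschild complex onto a complex with zero differential and dimensions 1, 2, 1.
  In total degree \<open>g \<noteq> 0\<close>, inserting a letter \<open>z\<close> in all positions contracts the complex up to the factor
  \<open>1 - \<chi>\<^sub>g(z)\<close>, where \<open>\<chi>\<^sub>g(z)\<close> is a power \<open>\<lambda>\<^sup>k\<close> with \<open>k \<noteq> 0\<close>. In degree \<open>0\<close> the complex is the bar complex of
  \<open>\<int>\<^sup>2\<close>, which lattice paths and rectangles contract. The contraction increases the length of words by at most
  2, and the denominators \<open>\<lambda>\<^sup>k - 1\<close> have valuation \<open>O(log k)\<close>, so it preserves both growth conditions.\<close>

section \<open>Valuations and fractional ideals\<close>

text \<open>Two obstacles shape the proof. One is the division by
  \<open>1 - \<chi>\<^sub>g(z)\<close> in the dagger algebra: series may have arbitrarily small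
  slope, so the valuation of the divisor must grow sublinearly in the length of the word. In
  characteristic 0, once \<open>\<lambda>\<^sup>k\<close> is close to 1, passing to its power with
  exponent the residue characteristic \<open>p\<close> multiplies
  \<open>\<lambda>\<^sup>k - 1\<close> by \<open>p\<close> up to a unit and adds a constant to the
  valuation; hence the logarithm. In characteristic \<open>p\<close> it would raise
  \<open>\<lambda>\<^sup>k - 1\<close> to the power \<open>p\<close>, a linear loss; there these
  elements are assumed to be units. That no positive power of \<open>\<lambda>\<close> is 1 keeps
  the divisors nonzero. The other obstacle is that the completion is a quotient by an abstractly
  defined closure of 0. The coefficient functionals are bounded and kill the relations, so they
  bound this closure from above; as the growth conditions are closed, null forms then come from null
  chains. For both algebras the homology is parametrized by the same constant cycles, so the induced
  map is an isomorphism without a further comparison of the complexes.\<close>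

lemma uniformizer_unif: "uniformizer (unif::'v::dvr)"
  unfolding unif_def by (rule someI_ex, rule ex_uniformizer)

lemma unif_nonzero [simp]: "(unif::'v::dvr) \<noteq> 0"
  and unif_not_unit: "\<not> (unif::'v) dvd 1"
  and unif_factor: "\<And>x::'v. x \<noteq> 0 \<Longrightarrow> \<exists>u n. u dvd 1 \<and> x = u * unif ^ n"
  using uniformizer_unif[where 'v='v] unfolding uniformizer_def by blast+

lemma unif_power_dvd_iff:
  assumes "(u::'v::dvr) dvd 1"
  shows "unif ^ k dvd u * unif ^ n \<longleftrightarrow> k \<le> n"
proof
  assume d: "unif ^ k dvd u * unif ^ n"
  show "k \<le> n"
  proof (rule ccontr)
    assume "\<not> k \<le> n"
    then obtain m where k: "k = n + Suc m"
      by (metis add_Suc_right less_imp_Suc_add not_le)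
    from d have "unif ^ n * unif ^ Suc m dvd unif ^ n * u"
      by (simp add: k power_add mult.commute)
    then have "unif ^ Suc m dvd u" by (subst (asm) dvd_mult_cancel_left) auto
    then have "unif dvd u" by (metis dvd_mult_left power_Suc)
    with assms unif_not_unit show False by (metis dvd_trans)
  qed
qed (simp add: dvd_mult le_imp_power_dvd)

lemma unif_power_dvd_all: "(\<And>k. unif ^ k dvd (x::'v::dvr)) \<Longrightarrow> x = 0"
  by (metis unif_factor unif_power_dvd_iff not_less_eq_eq order_refl)

lemma unit_iff_not_unif_dvd: "(x::'v::dvr) dvd 1 \<longleftrightarrow> \<not> unif dvd x"
proof
  assume "\<not> unif dvd x"
  moreover from this obtain u n where "u dvd 1" "x = u * unif ^ n"
    using unif_factor[of x] by (metis dvd_0_right)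
  ultimately show "x dvd 1" by (cases n) auto
qed (metis dvd_trans unif_not_unit)

lemma le_val_iff: "enat k \<le> val x \<longleftrightarrow> unif ^ k dvd (x::'v::dvr)"
proof
  assume k: "enat k \<le> val x"
  show "unif ^ k dvd x"
  proof (rule ccontr)
    assume n: "\<not> unif ^ k dvd x"
    then have k0: "k > 0" by (cases k) auto
    have "n < k" if "unif ^ n dvd x" for n
      using n that by (meson dvd_trans le_imp_power_dvd not_le)
    then have "val x \<le> enat (k - 1)" unfolding val_def
      by (intro SUP_least) (use k0 in \<open>fastforce\<close>)
    with k k0 show False by (metis diff_less enat_ord_simps(1) less_numeral_extra(1) not_le order_trans)
  qed
next
  assume "unif ^ k dvd x"
  then show "enat k \<le> val x" unfolding val_def by (intro SUP_upper) auto
qed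

lemma val_eq_0_iff: "val x = 0 \<longleftrightarrow> (x::'v::dvr) dvd 1"
proof -
  have "val x = 0 \<longleftrightarrow> \<not> enat 1 \<le> val x"
    by (metis iless_eSuc0 linorder_not_le one_eSuc one_enat_def)
  then show ?thesis by (simp add: le_val_iff unit_iff_not_unif_dvd)
qed

section \<open>Fractional ideals\<close>

abbreviation unif_fract :: "'v::dvr fract" where "unif_fract \<equiv> to_fract unif"

text \<open>Membership means valuation at least \<open>k\<close>. Since \<open>val\<close> lives on
  the ring only, all estimates in the fraction field are phrased through these sets.\<close>

definition frac_ideal :: "int \<Rightarrow> 'v::dvr fract set" where
  "frac_ideal k = range (\<lambda>v. to_fract v * unif_fract powi k)"

lemma to_fract_power: "to_fract (x ^ n) = to_fract x ^ n"
  by (induction n) simp_all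

lemma frac_ideal_0 [simp]: "0 \<in> frac_ideal k"
  unfolding frac_ideal_def by (rule range_eqI[of _ _ 0]) simp

lemma frac_ideal_add: "x \<in> frac_ideal k \<Longrightarrow> y \<in> frac_ideal k \<Longrightarrow> x + y \<in> frac_ideal k"
  unfolding frac_ideal_def by (auto simp: distrib_right[symmetric] simp flip: to_fract_add)

lemma frac_ideal_mult: "x \<in> frac_ideal j \<Longrightarrow> y \<in> frac_ideal k \<Longrightarrow> x * y \<in> frac_ideal (j + k)"
proof -
  assume "x \<in> frac_ideal j" "y \<in> frac_ideal k"
  then obtain v w where "x = to_fract v * unif_fract powi j" "y = to_fract w * unif_fract powi k"
    unfolding frac_ideal_def by auto
  then have "x * y = to_fract (v * w) * unif_fract powi (j + k)"
    by (simp add: power_int_add)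
  then show ?thesis unfolding frac_ideal_def by blast
qed

lemma to_fract_in_frac_ideal: "to_fract v \<in> frac_ideal 0"
  unfolding frac_ideal_def by (rule range_eqI[of _ _ v]) simp

lemma frac_ideal_0E: "x \<in> frac_ideal 0 \<Longrightarrow> \<exists>v. x = to_fract v"
  unfolding frac_ideal_def by auto

lemma unif_fract_powi_in [simp]: "unif_fract powi k \<in> frac_ideal k"
  unfolding frac_ideal_def by (rule range_eqI[of _ _ 1]) simp

lemma frac_ideal_scale: "a \<in> frac_ideal 0 \<Longrightarrow> x \<in> frac_ideal k \<Longrightarrow> a * x \<in> frac_ideal k"
  using frac_ideal_mult[of a 0 x k] by simp

lemma frac_ideal_of_int: "of_int n \<in> (frac_ideal 0 :: 'a::dvr fract set)"
proof -
  have "(of_int n :: 'a fract) = to_fract (of_int n :: 'a)"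
  proof (induction n rule: int_induct[of _ 0])
    case (step1 i) then show ?case by simp
  next
    case (step2 i) then show ?case by simp
  qed simp
  then show ?thesis by (metis to_fract_in_frac_ideal)
qed

lemma frac_ideal_1 [simp]: "1 \<in> frac_ideal 0"
  using to_fract_in_frac_ideal[of 1] by simp

lemma frac_ideal_uminus [simp]: "- x \<in> frac_ideal k \<longleftrightarrow> x \<in> frac_ideal k"
  using frac_ideal_scale[of "-1" x k] frac_ideal_scale[of "-1" "- x" k] frac_ideal_of_int[of "-1"]
  by auto

lemma frac_ideal_diff: "x \<in> frac_ideal k \<Longrightarrow> y \<in> frac_ideal k \<Longrightarrow> x - y \<in> frac_ideal k"
  using frac_ideal_add[of x k "- y"] by simp

lemma frac_ideal_sum: "(\<And>i. i \<in> I \<Longrightarrow> f i \<in> frac_ideal k) \<Longrightarrow> sum f I \<in> frac_ideal k"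
  by (induction I rule: infinite_finite_induct) (auto intro: frac_ideal_add)

lemma frac_ideal_mono: "j \<le> k \<Longrightarrow> x \<in> frac_ideal k \<Longrightarrow> x \<in> frac_ideal j"
proof -
  assume "j \<le> k" "x \<in> frac_ideal k"
  moreover have "unif_fract powi (k - j) \<in> frac_ideal 0"
    using \<open>j \<le> k\<close> to_fract_in_frac_ideal[of "unif ^ nat (k - j)"]
    by (simp add: power_int_def to_fract_power)
  moreover have "x = unif_fract powi (k - j) * (x * unif_fract powi (j - k))"
    by (simp add: power_int_diff)
  moreover have "x * unif_fract powi (j - k) \<in> frac_ideal j"
    using frac_ideal_mult[OF \<open>x \<in> frac_ideal k\<close> unif_fract_powi_in[of "j - k"]] by simp
  ultimately show ?thesis by (metis frac_ideal_scale)
qed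

lemma frac_ideal_shift: "x * unif_fract powi j \<in> frac_ideal (k + j) \<longleftrightarrow> x \<in> frac_ideal k"
proof
  assume "x * unif_fract powi j \<in> frac_ideal (k + j)"
  from frac_ideal_mult[OF this unif_fract_powi_in[of "-j"]] show "x \<in> frac_ideal k"
    by (simp add: mult.assoc power_int_minus)
qed (simp add: frac_ideal_mult)

lemma to_fract_in_frac_ideal_iff: "to_fract x \<in> frac_ideal (int k) \<longleftrightarrow> unif ^ k dvd x"
proof
  assume "to_fract x \<in> frac_ideal (int k)"
  then obtain v where "to_fract x = to_fract v * unif_fract powi int k"
    unfolding frac_ideal_def by auto
  then have "to_fract x = to_fract (v * unif ^ k)" by (simp add: to_fract_power)
  then have "x = v * unif ^ k" by (simp only: to_fract_eq_iff)
  then show "unif ^ k dvd x" by simp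
next
  assume "unif ^ k dvd x"
  then obtain v where "x = unif ^ k * v" by (auto elim: dvdE)
  then have "to_fract x = to_fract v * unif_fract powi int k" by (simp add: to_fract_power)
  then show "to_fract x \<in> frac_ideal (int k)" unfolding frac_ideal_def by blast
qed

lemma fract_cases_to_fract: obtains a b where "b \<noteq> 0" "x = to_fract a / to_fract b"
  by (cases x) (auto simp: Fract_conv_to_fract)

lemma unit_inverse_to_fract: "u dvd 1 \<Longrightarrow> \<exists>w. inverse (to_fract u) = to_fract w"
proof -
  assume "u dvd 1"
  then obtain w where "1 = u * w" by (auto elim: dvdE)
  then have "1 = to_fract u * to_fract w" by (metis to_fract_1 to_fract_mult)
  then show ?thesis by (metis inverse_unique)
qed

lemma ex_frac_ideal: "\<exists>k. x \<in> frac_ideal (- int k)"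
proof -
  obtain a b where b: "b \<noteq> 0" and x: "x = to_fract a / to_fract b"
    by (rule fract_cases_to_fract)
  from unif_factor[OF b] obtain u n where u: "u dvd 1" "b = u * unif ^ n" by blast
  from unit_inverse_to_fract[OF u(1)] obtain w where "inverse (to_fract u) = to_fract w" ..
  then have "x = to_fract (a * w) * unif_fract powi (- int n)"
    by (simp add: x u(2) to_fract_power power_int_minus divide_inverse)
  then show ?thesis unfolding frac_ideal_def by blast
qed

lemma frac_ideal_all: "(\<And>k. x \<in> frac_ideal (int k)) \<Longrightarrow> x = 0"
proof -
  assume *: "\<And>k. x \<in> frac_ideal (int k)"
  then obtain v where v: "x = to_fract v" using frac_ideal_0E[of x] by (metis of_nat_0)
  with * have "unif ^ k dvd v" for k by (simp add: to_fract_in_frac_ideal_iff)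
  then have "v = 0" by (rule unif_power_dvd_all)
  with v show ?thesis by simp
qed

section \<open>Null sequences and completeness of the fraction field\<close>

definition null_seq :: "(nat \<Rightarrow> 'v::dvr fract) \<Rightarrow> bool" where
  "null_seq z \<longleftrightarrow> (\<forall>k. \<exists>N. \<forall>i\<ge>N. z i \<in> frac_ideal (int k))"

lemma null_seq_zero [simp]: "null_seq (\<lambda>i. 0)"
  by (simp add: null_seq_def)

lemma null_seq_add: "null_seq x \<Longrightarrow> null_seq y \<Longrightarrow> null_seq (\<lambda>i. x i + y i)"
  unfolding null_seq_def by (metis frac_ideal_add le_trans nat_le_linear)

lemma null_seq_scale: "null_seq x \<Longrightarrow> null_seq (\<lambda>i. a * x i)"
  unfolding null_seq_def
proof
  fix k
  assume *: "\<forall>k. \<exists>N. \<forall>i\<ge>N. x i \<in> frac_ideal (int k)"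
  obtain r where r: "a \<in> frac_ideal (- int r)" using ex_frac_ideal by blast
  from * obtain N where N: "\<And>i. i \<ge> N \<Longrightarrow> x i \<in> frac_ideal (int (k + r))" by blast
  then have "a * x i \<in> frac_ideal (int k)" if "i \<ge> N" for i
    using frac_ideal_mult[OF r N[OF that]] by simp
  then show "\<exists>N. \<forall>i\<ge>N. a * x i \<in> frac_ideal (int k)" by blast
qed

lemma null_seq_const: "null_seq (\<lambda>i. c) \<longleftrightarrow> c = 0"
  by (auto simp: null_seq_def intro: frac_ideal_all)

text \<open>\<open>adically_complete\<close> speaks of sequences in the ring whose consecutive
  differences are divisible by \<open>unif ^ k\<close>. A subsequence with such differences is
  shifted by its initial term, which moves it into the ring.\<close>

lemma frac_complete:
  fixes z :: "nat \<Rightarrow> 'v::complete_dvr fract"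
  assumes "\<And>k. \<exists>N. \<forall>i\<ge>N. \<forall>j\<ge>N. z i - z j \<in> frac_ideal (int k)"
  shows "\<exists>L. null_seq (\<lambda>i. z i - L)"
proof -
  from assms obtain N where N: "\<And>k i j. i \<ge> N k \<Longrightarrow> j \<ge> N k \<Longrightarrow> z i - z j \<in> frac_ideal (int k)"
    by metis
  \<comment> \<open>Partial sums make the indices increasing while they still dominate
    \<open>N k\<close>.\<close>
  define M where "M k = (\<Sum>i\<le>k. N i)" for k
  have M: "N k \<le> M k" "M k \<le> M (Suc k)" for k
    unfolding M_def by (auto intro: member_le_sum)
  define w where "w k = z (M k) - z (M 0)" for k
  have mono: "M 0 \<le> M k" for k by (induction k) (auto intro: le_trans M(2))
  have "\<exists>v. w k = to_fract v" for k
    unfolding w_def using N[of 0 "M k" "M 0"] M(1)[of 0] mono[of k]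
    by (metis frac_ideal_0E le_trans of_nat_0)
  then obtain v where v: "\<And>k. w k = to_fract (v k)" by metis
  have "unif ^ k dvd v (Suc k) - v k" for k
  proof -
    have "to_fract (v (Suc k) - v k) = z (M (Suc k)) - z (M k)"
      by (simp add: v[symmetric]) (simp add: w_def)
    also have "\<dots> \<in> frac_ideal (int k)" using N[of k "M (Suc k)" "M k"] M by (meson le_trans)
    finally show ?thesis by (simp only: to_fract_in_frac_ideal_iff)
  qed
  from adically_complete[OF uniformizer_unif this] obtain L where L: "\<And>n. unif ^ n dvd v n - L" by blast
  have "z i - (z (M 0) + to_fract L) \<in> frac_ideal (int k)" if "i \<ge> M k" for i k
  proof -
    have "z (M k) - (z (M 0) + to_fract L) = to_fract (v k - L)"
      using v[of k] by (simp add: w_def)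
    also have "\<dots> \<in> frac_ideal (int k)" using L by (simp only: to_fract_in_frac_ideal_iff)
    finally have "z (M k) - (z (M 0) + to_fract L) \<in> frac_ideal (int k)" .
    moreover have "z i - z (M k) \<in> frac_ideal (int k)"
      using N[of k i "M k"] M(1)[of k] that by simp
    ultimately have "z i - z (M k) + (z (M k) - (z (M 0) + to_fract L)) \<in> frac_ideal (int k)"
      by (intro frac_ideal_add)
    then show ?thesis by (simp add: algebra_simps)
  qed
  then have "null_seq (\<lambda>i. z i - (z (M 0) + to_fract L))"
    unfolding null_seq_def by blast
  then show ?thesis by blast
qed

section \<open>Growth conditions\<close>

text \<open>The growth conditions of the torus (\<open>d = False\<close>) and of its dagger completion (\<open>d = True\<close>) on
  a coefficient at distance \<open>m\<close> from the origin. The constant \<open>C\<close> of the dagger growth corresponds to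
  \<open>1 / Suc N\<close>.\<close>

definition growth :: "bool \<Rightarrow> nat \<Rightarrow> nat \<Rightarrow> 'v::dvr fract set" where
  "growth d N m =
     (if d then frac_ideal (int (m div Suc N) - int N)
      else if m \<le> N then frac_ideal (- int N) else {0})"

lemma growth_0 [simp]: "0 \<in> growth d N m"
  by (simp add: growth_def)

lemma growth_add: "x \<in> growth d N m \<Longrightarrow> y \<in> growth d N m \<Longrightarrow> x + y \<in> growth d N m"
  by (auto simp: growth_def intro: frac_ideal_add split: if_splits)

lemma growth_scale: "a \<in> frac_ideal 0 \<Longrightarrow> x \<in> growth d N m \<Longrightarrow> a * x \<in> growth d N m"
  by (auto simp: growth_def intro: frac_ideal_scale split: if_splits)

lemma growth_sum: "(\<And>i. i \<in> I \<Longrightarrow> f i \<in> growth d N m) \<Longrightarrow> sum f I \<in> growth d N m"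
  by (induction I rule: infinite_finite_induct) (auto intro: growth_add)

lemma growth_frac_ideal: "x \<in> growth d N m \<Longrightarrow> x \<in> frac_ideal (- int N)"
  by (cases d) (auto simp: growth_def intro: frac_ideal_mono[rotated] split: if_splits)

lemma growth_mono: "N \<le> N' \<Longrightarrow> x \<in> growth d N m \<Longrightarrow> x \<in> growth d N' m"
proof -
  assume le: "N \<le> N'" and x: "x \<in> growth d N m"
  have "m div Suc N' \<le> m div Suc N" using le by (intro div_le_mono2) auto
  with le x show ?thesis
    by (auto simp: growth_def intro: frac_ideal_mono[rotated] split: if_splits)
qed

text \<open>Absorbs an affine change of length: the slope shrinks by about the factor
  \<open>K + 1\<close>, the additive constant costs at most one more power of \<open>unif\<close>,
  and \<open>N' = (K + 1) * (N + 1)\<close> pays for both.\<close>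

lemma growth_control:
  "\<exists>N'. \<forall>m m' x. m \<le> K * m' + K \<longrightarrow> x \<in> growth d N m' \<longrightarrow> x \<in> growth d N' m"
proof -
  define N' where "N' = (K + 1) * (N + 1)"
  have "x \<in> growth d N' m" if m: "m \<le> K * m' + K" and x: "x \<in> growth d N m'" for m m' x
  proof -
    have 1: "m div Suc N' \<le> m' div Suc N + 1"
    proof -
      have "m div Suc N' \<le> ((K + 1) * (m' + 1)) div ((K + 1) * (N + 1))"
        by (rule order_trans[OF div_le_mono2 div_le_mono]) (use m in \<open>auto simp: N'_def\<close>)
      also have "\<dots> = (m' + 1) div (N + 1)" by (metis add_gr_0 div_mult_mult1 less_one less_numeral_extra(3))
      also have "\<dots> \<le> (m' + (N + 1)) div (N + 1)" by (intro div_le_mono) auto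
      also have "\<dots> = m' div Suc N + 1" by (metis Suc_eq_plus1 div_add_self2 nat.simps(3))
      finally show ?thesis .
    qed
    have 2: "N + 1 \<le> N'" by (simp add: N'_def)
    have 3: "m \<le> N'" if "m' \<le> N"
      proof -
      have "K * m' \<le> K * N" using that by simp
      then have "m \<le> K * N + K" using m by linarith
      also have "\<dots> \<le> N'" unfolding N'_def by (simp add: algebra_simps)
      finally show ?thesis .
    qed
    show ?thesis using 1 2 3 x
      by (auto simp: growth_def intro: frac_ideal_mono[rotated] split: if_splits)
  qed
  then show ?thesis by blast
qed

text \<open>The hypothesis makes \<open>loss\<close> sublinear. Taken with slope
  \<open>1 / (2 * Suc N)\<close> it consumes half of the dagger growth of \<open>x\<close> and
  leaves the other half.\<close>

lemma growth_loss:
  assumes "\<And>M. \<exists>c. \<forall>m. loss m \<le> m div Suc M + (c::nat)"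
  shows "\<exists>N'. \<forall>m x u. x \<in> growth d N m \<longrightarrow> u \<in> frac_ideal (- int (loss m)) \<longrightarrow> u * x \<in> growth d N' m"
proof -
  obtain c where c: "\<And>m. loss m \<le> m div Suc (2 * N + 1) + c" using assms by blast
  define N' where "N' = 2 * N + 1 + c"
  have "u * x \<in> growth d N' m" if x: "x \<in> growth d N m" and u: "u \<in> frac_ideal (- int (loss m))"
    for m x u
  proof -
    have "m div Suc N' \<le> m div (2 * Suc N)" by (intro div_le_mono2) (auto simp: N'_def)
    moreover have "2 * (m div (2 * Suc N)) \<le> m div Suc N"
      by (metis div_mult2_eq div_times_less_eq_dividend mult.commute)
    ultimately have "int (m div Suc N') - int N' \<le> - int (loss m) + (int (m div Suc N) - int N)"
      using c[of m] by (simp add: N'_def)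
    moreover have "m \<le> N \<Longrightarrow> - int N' \<le> - int (loss m) + (- int N)"
      using c[of m] by (simp add: N'_def)
    moreover have "N \<le> N'" by (simp add: N'_def)
    ultimately show ?thesis
      using x u frac_ideal_mult[OF u, of x] by (auto simp: growth_def intro: frac_ideal_mono split: if_splits)
  qed
  then show ?thesis by blast
qed

lemma growth_scale_any: "\<exists>N'. \<forall>m x. x \<in> growth d N m \<longrightarrow> a * x \<in> growth d N' m"
proof -
  obtain k where k: "a \<in> frac_ideal (- int k)" using ex_frac_ideal by blast
  have "\<exists>N'. \<forall>m x u. x \<in> growth d N m \<longrightarrow> u \<in> frac_ideal (- int k) \<longrightarrow> u * x \<in> growth d N' m"
    by (rule growth_loss) (metis le_add2)
  with k show ?thesis by blast
qed

text \<open>The constants \<open>- N\<close> add up, and the carry in the integer division costs one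
  more; hence \<open>2 * N + 1\<close>.\<close>

lemma growth_mult:
  assumes "x \<in> growth d N m" "y \<in> growth d N m'"
  shows "x * y \<in> growth d (2 * N + 1) (m + m')"
proof -
  have "(m + m') div Suc (2 * N + 1) \<le> (m div Suc N + m' div Suc N) + 1"
  proof -
    have "(m + m') div Suc (2 * N + 1) \<le> (m + m') div Suc N" by (intro div_le_mono2) auto
    also have "\<dots> \<le> (m div Suc N + m' div Suc N) + 1"
    proof -
      have "m mod Suc N + m' mod Suc N < 2 * Suc N"
        unfolding mult_2 by (intro add_strict_mono mod_less_divisor) auto
      then have "(m mod Suc N + m' mod Suc N) div Suc N < 2" by (rule less_mult_imp_div_less)
      then show ?thesis by (subst div_add1_eq) linarith
    qed
    finally show ?thesis .
  qed
  then show ?thesis using assms frac_ideal_mult[of x _ y]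
    by (fastforce simp: growth_def intro: frac_ideal_mono[rotated] split: if_splits)
qed

text \<open>Far from the origin half of the dagger growth pays for a division by
  \<open>unif ^ k\<close>, with \<open>N'\<close> independent of \<open>k\<close>. This is what
  makes truncations converge bornologically.\<close>

lemma growth_tail:
  "\<exists>N'. \<forall>k::nat. \<exists>J. \<forall>m>J. \<forall>x. x \<in> growth d N m \<longrightarrow> x * unif_fract powi (- int k) \<in> growth d N' m"
proof -
  define N' where "N' = 2 * N + 1"
  \<comment> \<open>The summand \<open>2 * Suc N * k\<close> yields the \<open>k\<close> powers of
    \<open>unif\<close>; the summand \<open>N\<close> puts the point outside the support in the case
    of the torus.\<close>
  have "x * unif_fract powi (- int k) \<in> growth d N' m"
    if m: "m > 2 * Suc N * k + N" and x: "x \<in> growth d N m" for m x k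
  proof -
    have "2 * Suc N * k div (2 * Suc N) \<le> m div (2 * Suc N)" using m by (intro div_le_mono) linarith
    then have "k \<le> m div (2 * Suc N)" by (metis nonzero_mult_div_cancel_left mult_eq_0_iff nat.simps(3) zero_neq_numeral)
    moreover have "m div Suc N' = m div (2 * Suc N)" by (simp add: N'_def)
    moreover have "2 * (m div (2 * Suc N)) \<le> m div Suc N"
      by (metis div_mult2_eq div_times_less_eq_dividend mult.commute)
    ultimately have "int (m div Suc N') - int N' \<le> int (m div Suc N) - int N + (- int k)"
      by (simp add: N'_def)
    then show ?thesis using x m frac_ideal_mult[OF _ unif_fract_powi_in[of "- int k"], of x]
      by (cases d) (auto simp: growth_def intro: frac_ideal_mono)
  qed
  then show ?thesis by blast
qed

text \<open>A fractional ideal is open, hence closed, and \<open>{0}\<close> is closed because the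
  adic topology is separated.\<close>

lemma growth_closed:
  assumes "\<And>k. \<exists>z\<in>growth d N m. x - z \<in> frac_ideal (int k)"
  shows "x \<in> growth d N m"
proof (cases "\<not> d \<and> \<not> m \<le> N")
  case True
  then have "x \<in> frac_ideal (int k)" for k using assms[of k] by (auto simp: growth_def)
  then have "x = 0" by (rule frac_ideal_all)
  then show ?thesis by simp
next
  case False
  then obtain j where j: "growth d N m = (frac_ideal j :: 'a fract set)" by (auto simp: growth_def)
  obtain z where z: "z \<in> frac_ideal j" "x - z \<in> frac_ideal (int (nat j))" using assms j by blast
  then have "x - z \<in> frac_ideal j" by (auto intro: frac_ideal_mono[rotated])
  from frac_ideal_add[OF this z(1)] show ?thesis by (simp add: j)
qed

text \<open>Distributes the coefficient of a cell over the letters of its word, so that each letter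
  with its share is bounded. Integer division is superadditive, so the shares do not exceed what is
  available; the factor 2 is the distortion between the length of a cell and that of its
  word.\<close>

lemma growth_split:
  assumes "sum_list ms \<le> 2 * m" "ms \<noteq> []" "(x::'v::dvr fract) \<in> growth d N m"
  shows "\<exists>v xs. length xs = length ms \<and> (\<forall>j<length ms. xs ! j \<in> growth d (2 * N + 1) (ms ! j)) \<and>
           x = to_fract v * prod_list xs"
proof (cases "d \<or> m \<le> N")
  case False
  with assms have "x = to_fract 0 * prod_list (map (\<lambda>_. 0) ms)" by (simp add: growth_def)
  then show ?thesis by (intro exI[of _ 0] exI[of _ "map (\<lambda>_. 0) ms"]) simp
next
  case True
  obtain a bs where ms: "ms = a # bs" using assms(2) by (cases ms) auto
  define e where "e i = (if d then i div Suc (2 * N + 1) else 0)" for i :: nat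
  \<comment> \<open>The first letter carries all of the denominator \<open>unif ^ N\<close>, the
    other letters only integral factors.\<close>
  define xs :: "'v fract list" where
    "xs = unif_fract powi (int (e a) - int N) # map (\<lambda>i. unif_fract powi int (e i)) bs"
  have prod: "prod_list (map (\<lambda>i. (unif_fract::'v fract) powi int (e i)) bs) = unif_fract powi int (sum_list (map e bs))"
    for bs by (induction bs) (simp_all add: power_int_add power_add)
  have pl: "prod_list xs = unif_fract powi (int (sum_list (map e ms)) - int N)"
    by (simp add: xs_def ms prod power_int_add[symmetric] algebra_simps del: power_int_of_nat)
  have le2: "i \<le> 2 * m" if "i \<in> set ms" for i
    using member_le_sum_list[OF that] assms(1) by linarith
  have sd: "sum_list (map (\<lambda>i. i div q) ms) \<le> sum_list ms div q" if "q > 0" for q :: nat and ms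
  proof (induction ms)
    case (Cons a ms)
    moreover have "a div q + sum_list ms div q \<le> (a + sum_list ms) div q"
      using div_add1_eq[of a "sum_list ms" q] by simp
    ultimately show ?case by simp
  qed simp
  have es: "sum_list (map e ms) \<le> (if d then m div Suc N else 0)"
  proof (cases d)
    case True
    have "sum_list (map e ms) \<le> sum_list ms div Suc (2 * N + 1)"
      unfolding e_def using True sd[of "Suc (2 * N + 1)" ms] by simp
    also have "\<dots> \<le> (2 * m) div (2 * Suc N)" using div_le_mono[OF assms(1), of "2 * Suc N"] by simp
    also have "\<dots> = m div Suc N" by (rule div_mult_mult1) simp
    finally show ?thesis using True by simp
  qed (simp add: e_def)
  have "x \<in> frac_ideal (int (sum_list (map e ms)) - int N)"
    using assms(3) es True by (auto simp: growth_def intro: frac_ideal_mono[rotated] split: if_splits)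
  then obtain v where v: "x = to_fract v * prod_list xs"
    unfolding pl frac_ideal_def by auto
  moreover have "xs ! j \<in> growth d (2 * N + 1) (ms ! j)" if j: "j < length ms" for j
  proof (cases j)
    case 0
    have "(unif_fract::'v fract) powi (int (e a) - int N) \<in> growth d (2 * N + 1) a"
      using True le2[of a] by (auto simp: growth_def e_def ms intro: frac_ideal_mono[OF _ unif_fract_powi_in])
    then show ?thesis by (simp add: 0 xs_def ms)
  next
    case (Suc i)
    have "(unif_fract::'v fract) powi int (e b) \<in> growth d (2 * N + 1) b" if "b \<in> set bs" for b
      using True le2[of b] that
      by (auto simp: growth_def e_def ms simp del: power_int_of_nat
          intro!: frac_ideal_mono[OF _ unif_fract_powi_in] frac_ideal_mono[OF _ frac_ideal_1])
    then have "(unif_fract::'v fract) powi int (e (bs ! i)) \<in> growth d (2 * N + 1) (bs ! i)"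
      using j by (simp add: Suc ms del: power_int_of_nat)
    then show ?thesis using j by (simp add: Suc xs_def ms)
  qed
  moreover have "length xs = length ms" by (simp add: xs_def ms)
  ultimately show ?thesis by blast
qed

section \<open>Finitely supported functions\<close>

lemma pscale_apply: "pscale c f i = c * f i"
  by (simp add: pscale_def)

text \<open>As simplification rules, the pointwise laws would rewrite unapplied sums to
  abstractions.\<close>

declare plus_fun_apply [simp del] zero_fun_apply [simp del] minus_apply [simp del] uminus_apply [simp del]

lemmas fun_apply = plus_fun_apply zero_fun_apply minus_apply uminus_apply pscale_apply

lemma sum_fun_apply: "(\<Sum>i\<in>A. f i) x = (\<Sum>i\<in>A. f i x)"
  by (induction A rule: infinite_finite_induct) (auto simp: fun_apply)

interpretation pscale: vector_space "pscale :: 'k::field \<Rightarrow> ('i \<Rightarrow> 'k) \<Rightarrow> 'i \<Rightarrow> 'k"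
  by unfold_locales (auto simp: fun_eq_iff fun_apply algebra_simps)

interpretation seq_scale: vector_space "seq_scale :: 'k::field \<Rightarrow> (nat \<Rightarrow> 'i \<Rightarrow> 'k) \<Rightarrow> nat \<Rightarrow> 'i \<Rightarrow> 'k"
  by unfold_locales (auto simp: fun_eq_iff fun_apply algebra_simps)

interpretation fract_scale: module
  "\<lambda>v. pscale (to_fract v) :: ('i \<Rightarrow> 'v::idom fract) \<Rightarrow> 'i \<Rightarrow> 'v fract"
  by unfold_locales (auto simp: fun_eq_iff fun_apply algebra_simps)

abbreviation fin_supp :: "('i \<Rightarrow> 'k::zero) \<Rightarrow> bool" where
  "fin_supp f \<equiv> finite {i. f i \<noteq> 0}"

lemma fin_supp_0 [simp]: "fin_supp 0" and fin_supp_delta [simp]: "fin_supp (delta i)"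
  by (auto simp: delta_def fun_apply)

lemma fin_supp_add [simp]: "fin_supp f \<Longrightarrow> fin_supp g \<Longrightarrow> fin_supp (f + g :: 'i \<Rightarrow> 'k::monoid_add)"
  by (rule finite_subset[of _ "{i. f i \<noteq> 0} \<union> {i. g i \<noteq> 0}"]) (auto simp: fun_apply)

lemma fin_supp_diff [simp]: "fin_supp f \<Longrightarrow> fin_supp g \<Longrightarrow> fin_supp (f - g :: 'i \<Rightarrow> 'k::group_add)"
  by (rule finite_subset[of _ "{i. f i \<noteq> 0} \<union> {i. g i \<noteq> 0}"]) (auto simp: fun_apply)

lemma fin_supp_uminus [simp]: "fin_supp (- f :: 'i \<Rightarrow> 'k::group_add) \<longleftrightarrow> fin_supp f"
  by (simp add: fun_apply)

lemma fin_supp_pscale [simp]: "fin_supp f \<Longrightarrow> fin_supp (pscale c f :: 'i \<Rightarrow> 'k::mult_zero)"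
  by (rule finite_subset[of _ "{i. f i \<noteq> 0}"]) (auto simp: pscale_def)

lemma fin_supp_sum [simp]:
  "(\<And>i. i \<in> I \<Longrightarrow> fin_supp (f i)) \<Longrightarrow> fin_supp (sum f I :: 'i \<Rightarrow> 'k::comm_monoid_add)"
  by (induction I rule: infinite_finite_induct) simp_all

section \<open>Linear extension from basis elements\<close>

lemma lin_ext_superset:
  "finite S \<Longrightarrow> {i. f i \<noteq> 0} \<subseteq> S \<Longrightarrow> lin_ext \<phi> f = (\<Sum>i\<in>S. pscale (f i) (\<phi> i))"
  unfolding lin_ext_def by (rule sum.mono_neutral_left) auto

lemma lin_ext_0 [simp]: "lin_ext \<phi> 0 = 0"
  by (simp add: lin_ext_def fun_apply)

lemma lin_ext_delta [simp]: "lin_ext \<phi> (delta i) = \<phi> i"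
  by (subst lin_ext_superset[of "{i}"]) (auto simp: delta_def)

lemma lin_ext_add: "fin_supp f \<Longrightarrow> fin_supp g \<Longrightarrow> lin_ext \<phi> (f + g) = lin_ext \<phi> f + lin_ext \<phi> g"
  by (subst (1 2 3) lin_ext_superset[of "{i. f i \<noteq> 0} \<union> {i. g i \<noteq> 0}"])
    (auto simp: sum.distrib pscale.scale_left_distrib fun_apply)

lemma lin_ext_pscale: "fin_supp f \<Longrightarrow> lin_ext \<phi> (pscale c f) = pscale c (lin_ext \<phi> f)"
  by (subst (1 2) lin_ext_superset[of "{i. f i \<noteq> 0}"]) (auto simp: pscale.scale_sum_right fun_apply)

lemma lin_ext_uminus: "fin_supp f \<Longrightarrow> lin_ext \<phi> (- f) = - lin_ext \<phi> f"
  using lin_ext_pscale[of f \<phi> "-1"] by simp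

lemma lin_ext_diff: "fin_supp f \<Longrightarrow> fin_supp g \<Longrightarrow> lin_ext \<phi> (f - g) = lin_ext \<phi> f - lin_ext \<phi> g"
  using lin_ext_add[of f "- g" \<phi>] by (simp add: lin_ext_uminus)

lemma lin_ext_sum: "(\<And>i. i \<in> I \<Longrightarrow> fin_supp (f i)) \<Longrightarrow> lin_ext \<phi> (sum f I) = (\<Sum>i\<in>I. lin_ext \<phi> (f i))"
  by (induction I rule: infinite_finite_induct) (simp_all add: lin_ext_add)

lemma lin_ext_apply: "lin_ext \<phi> f j = (\<Sum>i | f i \<noteq> 0. f i * \<phi> i j)"
  by (simp add: lin_ext_def sum_fun_apply fun_apply)

lemma lin_ext_of_delta: "fin_supp f \<Longrightarrow> lin_ext delta f = f"
  by (rule ext, cases) (auto simp: lin_ext_apply delta_def if_distrib cong: if_cong)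

lemma fin_supp_lin_ext [simp]: "(\<And>i. fin_supp (\<phi> i)) \<Longrightarrow> fin_supp (lin_ext \<phi> f)"
  unfolding lin_ext_def by (rule fin_supp_sum) simp

lemma fin_supp_induct [consumes 1, case_names zero add]:
  assumes "fin_supp (f :: 'i \<Rightarrow> 'k::field)"
    and "P 0"
    and "\<And>c i f. fin_supp f \<Longrightarrow> f i = 0 \<Longrightarrow> c \<noteq> 0 \<Longrightarrow> P f \<Longrightarrow> P (pscale c (delta i) + f)"
  shows "P f"
proof -
  have "finite I \<Longrightarrow> {i. f i \<noteq> 0} = I \<Longrightarrow> P f" for I f
  proof (induction I arbitrary: f rule: finite_induct)
    case empty
    then have "f = 0" by (auto simp: fun_eq_iff fun_apply)
    then show ?case using assms(2) by simp
  next
    case (insert i I)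
    define f' where "f' = f(i := 0)"
    have f': "{i. f' i \<noteq> 0} = I" using insert unfolding f'_def by auto
    have f: "f = pscale (f i) (delta i) + f'" by (auto simp: fun_eq_iff f'_def delta_def fun_apply)
    have "P (pscale (f i) (delta i) + f')"
      by (rule assms(3)) (use insert f' in \<open>auto simp: f'_def\<close>)
    then show ?case using f by simp
  qed
  then show ?thesis using assms(1) by blast
qed

section \<open>Signed sums over integer intervals\<close>

text \<open>An oriented discrete integral. Telescoping and additivity in the upper limit hold for
  all signs, so lattice paths and rectangles need no case distinction by direction.\<close>

definition isum :: "(int \<Rightarrow> 'a::ab_group_add) \<Rightarrow> int \<Rightarrow> 'a" where
  "isum f a = (if a \<ge> 0 then sum f {0..<a} else - sum f {a..<0})"

lemma isum_0 [simp]: "isum f 0 = 0"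
  by (simp add: isum_def)

lemma isum_Suc: "isum f (a + 1) = isum f a + f a"
proof (cases "a \<ge> 0")
  case True
  then have "{0..<a + 1} = insert a {0..<a}" by auto
  with True show ?thesis by (simp add: isum_def add.commute)
next
  case False
  then have "{a..<0} = insert a {a + 1..<0}" by auto
  with False show ?thesis by (auto simp: isum_def)
qed

lemma isum_pred: "isum f (a - 1) = isum f a - f (a - 1)"
  using isum_Suc[of f "a - 1"] by simp

text \<open>A discrete fundamental theorem of calculus, from which the algebraic rules for
  \<open>isum\<close> follow.\<close>

lemma isum_unique:
  assumes "F 0 = 0" "\<And>a. F (a + 1) = F a + f a"
  shows "isum f a = F a"
proof (induction a rule: int_induct[of _ 0])
  case (step2 i)
  then show ?case using assms(2)[of "i - 1"] by (simp add: isum_pred)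
qed (simp_all add: assms isum_Suc)

lemma isum_telescope: "isum (\<lambda>j. F (j + 1) - F j) a = F a - F 0"
  by (rule isum_unique) auto

lemma isum_add: "isum (\<lambda>j. f j + g j) a = isum f a + isum g a"
  by (rule isum_unique) (auto simp: isum_Suc)

lemma isum_diff: "isum (\<lambda>j. f j - g j) a = isum f a - isum g a"
  by (rule isum_unique) (auto simp: isum_Suc)

lemma isum_uminus: "isum (\<lambda>j. - f j) a = - isum f a"
  by (rule isum_unique) (auto simp: isum_Suc)

lemma isum_zero [simp]: "isum (\<lambda>j. 0) a = 0"
  by (rule isum_unique) auto

lemma isum_shift: "isum f (a + b) = isum f a + isum (\<lambda>j. f (a + j)) b"
proof -
  have "isum (\<lambda>j. f (a + j)) b = isum f (a + b) - isum f a"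
    by (rule isum_unique[where F = "\<lambda>b. isum f (a + b) - isum f a"])
      (simp_all add: isum_Suc flip: add.assoc)
  then show ?thesis by simp
qed

lemma isum_const_pscale: "isum (\<lambda>j. f) a = pscale (of_int a) f"
  by (rule isum_unique[where F = "\<lambda>a. pscale (of_int a) f"]) (auto simp: fun_eq_iff distrib_right fun_apply)

lemma isum_induct:
  assumes "P 0" "\<And>x y. P x \<Longrightarrow> P y \<Longrightarrow> P (x + y)" "\<And>x. P x \<Longrightarrow> P (- x)"
    and f: "\<And>j. \<bar>j\<bar> \<le> \<bar>a\<bar> \<Longrightarrow> P (f j)"
  shows "P (isum f a)"
proof -
  have "finite I \<Longrightarrow> (\<And>j. j \<in> I \<Longrightarrow> P (f j)) \<Longrightarrow> P (sum f I)" for I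
    by (induction I rule: finite_induct) (auto intro: assms)
  from this[of "{0..<a}"] this[of "{a..<0}"] show ?thesis
    using f by (auto simp: isum_def intro!: assms(3))
qed

lemma fin_supp_isum [simp]: "(\<And>j. fin_supp (f j)) \<Longrightarrow> fin_supp (isum f a :: 'i \<Rightarrow> 'k::ab_group_add)"
  by (auto simp: isum_def)

lemma lin_ext_isum: "(\<And>j. fin_supp (f j)) \<Longrightarrow> lin_ext \<phi> (isum f a) = isum (\<lambda>j. lin_ext \<phi> (f j)) a"
  by (auto simp: isum_def lin_ext_sum lin_ext_uminus)

section \<open>Normalized chains\<close>

text \<open>The pair \<open>(g, [h\<^sub>1, \<dots>, h\<^sub>n])\<close> stands for the word \<open>h\<^sub>0 \<otimes> h\<^sub>1 \<otimes> \<dots> \<otimes> h\<^sub>n\<close> of group elements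
  with \<open>h\<^sub>0 + \<dots> + h\<^sub>n = g\<close>, scaled so that the product of its letters in the twisted group algebra
  is exactly \<open>\<delta>\<^sub>g\<close>. In this basis the part of degree \<open>g\<close> of the Hochschild complex is the normalized
  bar complex of \<open>\<int>\<^sup>2\<close> with coefficients in the character \<open>chi t g\<close>.\<close>

type_synonym cell_index = "(int \<times> int) \<times> (int \<times> int) list"

text \<open>Words with the unit letter vanish by definition, so a merge \<open>a + b\<close> that
  happens to be 0 needs no case distinction.\<close>

definition cell :: "int \<times> int \<Rightarrow> (int \<times> int) list \<Rightarrow> cell_index \<Rightarrow> 'k::field" where
  "cell g ws = (if 0 \<in> set ws then 0 else delta (g, ws))"

definition prepend :: "int \<times> int \<Rightarrow> (cell_index \<Rightarrow> 'k::field) \<Rightarrow> cell_index \<Rightarrow> 'k" where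
  "prepend a f = (\<lambda>(g, ws). if a \<noteq> 0 \<and> ws \<noteq> [] \<and> hd ws = a then f (g, tl ws) else 0)"

text \<open>The scalar by which conjugation with \<open>\<delta>\<^sub>h\<close> acts on
  \<open>\<delta>\<^sub>g\<close>; it arises when the last letter of a word is moved to the
  front.\<close>

definition chi :: "'k::field \<Rightarrow> int \<times> int \<Rightarrow> int \<times> int \<Rightarrow> 'k" where
  "chi t g h = t powi (snd h * fst g - fst h * snd g)"

text \<open>All faces except the zeroth. Without the zeroth face the boundary of a word is
  determined recursively by that of its tail, which is what the inductive proofs use.\<close>

fun bdt :: "'k::field \<Rightarrow> int \<times> int \<Rightarrow> (int \<times> int) list \<Rightarrow> cell_index \<Rightarrow> 'k" where
  "bdt t g [] = 0"
| "bdt t g [a] = - pscale (chi t g a) (cell g [])"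
| "bdt t g (a # b # w) = - cell g ((a + b) # w) - prepend a (bdt t g (b # w))"

definition bd :: "'k::field \<Rightarrow> int \<times> int \<Rightarrow> (int \<times> int) list \<Rightarrow> cell_index \<Rightarrow> 'k" where
  "bd t g ws = (if ws = [] then 0 else cell g (tl ws) + bdt t g ws)"

definition linop :: "(int \<times> int \<Rightarrow> (int \<times> int) list \<Rightarrow> 'j \<Rightarrow> 'k::field) \<Rightarrow> (cell_index \<Rightarrow> 'k) \<Rightarrow> 'j \<Rightarrow> 'k" where
  "linop \<phi> = lin_ext (\<lambda>(g, ws). \<phi> g ws)"

definition nchains :: "nat \<Rightarrow> (cell_index \<Rightarrow> 'k::field) set" where
  "nchains n = {f. fin_supp f \<and> (\<forall>g ws. f (g, ws) \<noteq> 0 \<longrightarrow> length ws = n \<and> 0 \<notin> set ws)}"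

lemma cell_degenerate: "0 \<in> set ws \<Longrightarrow> cell g ws = 0"
  by (simp add: cell_def)

lemma fin_supp_cell [simp]: "fin_supp (cell g ws)"
  by (simp add: cell_def)

lemma prepend_0 [simp]: "prepend a 0 = 0"
  and prepend_zero [simp]: "prepend 0 f = 0"
  and prepend_add: "prepend a (f + h) = prepend a f + prepend a h"
  and prepend_diff: "prepend a (f - h) = prepend a f - prepend a h"
  and prepend_uminus: "prepend a (- f) = - prepend a f"
  and prepend_pscale: "prepend a (pscale c f) = pscale c (prepend a f)"
  by (auto simp: prepend_def fun_eq_iff fun_apply)

lemmas prepend_linear = prepend_add prepend_diff prepend_uminus prepend_pscale

lemma prepend_cell [simp]: "prepend a (cell g ws) = cell g (a # ws)"
  by (auto simp: prepend_def cell_def fun_eq_iff delta_def neq_Nil_conv fun_apply)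

lemma fin_supp_prepend [simp]: "fin_supp f \<Longrightarrow> fin_supp (prepend a f)"
  by (rule finite_subset[of _ "(\<lambda>(g, ws). (g, a # ws)) ` {i. f i \<noteq> 0}"])
    (auto simp: prepend_def image_iff neq_Nil_conv split: if_splits)

lemma fin_supp_bdt [simp]: "fin_supp (bdt t g ws)"
  by (induction t g ws rule: bdt.induct) simp_all

lemma fin_supp_bd [simp]: "fin_supp (bd t g ws)"
  by (simp add: bd_def)

lemma chi_zero [simp]: "chi t g 0 = 1" "chi t 0 h = 1"
  by (simp_all add: chi_def)

text \<open>After a leading unit letter the zeroth face may survive; the next face cancels it, so
  \<open>bdt\<close> has to produce its negative.\<close>

lemma bdt_degenerate: "0 \<in> set ws \<Longrightarrow> bdt t g ws = - cell g (tl ws)"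
  by (induction t g ws rule: bdt.induct) (auto simp: cell_degenerate prepend_linear)

lemma bd_degenerate: "0 \<in> set ws \<Longrightarrow> bd t g ws = 0"
  by (auto simp: bd_def bdt_degenerate)

lemma linop_add: "fin_supp f \<Longrightarrow> fin_supp g \<Longrightarrow> linop \<phi> (f + g) = linop \<phi> f + linop \<phi> g"
  and linop_diff: "fin_supp f \<Longrightarrow> fin_supp g \<Longrightarrow> linop \<phi> (f - g) = linop \<phi> f - linop \<phi> g"
  and linop_uminus: "fin_supp f \<Longrightarrow> linop \<phi> (- f) = - linop \<phi> f"
  and linop_pscale: "fin_supp f \<Longrightarrow> linop \<phi> (pscale c f) = pscale c (linop \<phi> f)"
  and linop_isum: "(\<And>j. fin_supp (F j)) \<Longrightarrow> linop \<phi> (isum F a) = isum (\<lambda>j. linop \<phi> (F j)) a"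
  and linop_0 [simp]: "linop \<phi> 0 = 0"
  unfolding linop_def
  by (simp_all add: lin_ext_add lin_ext_diff lin_ext_uminus lin_ext_pscale lin_ext_isum)

lemmas linop_linear = linop_add linop_diff linop_uminus linop_pscale linop_isum

lemma linop_cell: "(0 \<in> set ws \<Longrightarrow> \<phi> g ws = 0) \<Longrightarrow> linop \<phi> (cell g ws) = \<phi> g ws"
  by (simp add: linop_def cell_def)

lemma linop_bd_cell [simp]: "linop (bd t) (cell g ws) = bd t g ws"
  by (simp add: linop_cell bd_degenerate)

lemma nchains_fin_supp: "f \<in> nchains n \<Longrightarrow> fin_supp f"
  by (simp add: nchains_def)

lemma nchainsI:
  assumes "fin_supp f" "\<And>g ws. f (g, ws) \<noteq> 0 \<Longrightarrow> length ws = n \<and> 0 \<notin> set ws"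
  shows "f \<in> nchains n"
  using assms by (simp add: nchains_def)

lemma nchains_add:
  assumes "f \<in> nchains n" "h \<in> nchains n"
  shows "f + h \<in> nchains n"
proof (rule nchainsI)
  fix g ws
  assume "(f + h) (g, ws) \<noteq> 0"
  then have "f (g, ws) \<noteq> 0 \<or> h (g, ws) \<noteq> 0" by (auto simp: fun_apply)
  with assms show "length ws = n \<and> 0 \<notin> set ws" unfolding nchains_def by blast
qed (use assms in \<open>simp add: nchains_fin_supp\<close>)

lemma nchains_pscale:
  assumes "f \<in> nchains n"
  shows "pscale c f \<in> nchains n"
proof (rule nchainsI)
  fix g ws
  assume "pscale c f (g, ws) \<noteq> 0"
  then have "f (g, ws) \<noteq> 0" by (auto simp: fun_apply)
  with assms show "length ws = n \<and> 0 \<notin> set ws" unfolding nchains_def by blast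
qed (use assms in \<open>simp add: nchains_fin_supp\<close>)

lemma nchains_0 [simp]: "0 \<in> nchains n"
  by (rule nchainsI) (simp_all add: fun_apply)

lemma nchains_uminus: "f \<in> nchains n \<Longrightarrow> - f \<in> nchains n"
  using nchains_pscale[of f n "-1"] by simp

lemma nchains_diff: "f \<in> nchains n \<Longrightarrow> h \<in> nchains n \<Longrightarrow> f - h \<in> nchains n"
  using nchains_add[of f n "- h"] by (simp add: nchains_uminus)

lemma nchains_sum: "(\<And>i. i \<in> I \<Longrightarrow> f i \<in> nchains n) \<Longrightarrow> sum f I \<in> nchains n"
  by (induction I rule: infinite_finite_induct) (auto intro: nchains_add)

lemma nchains_isum: "(\<And>j. f j \<in> nchains n) \<Longrightarrow> isum f a \<in> nchains n"
  by (auto simp: isum_def intro: nchains_sum nchains_uminus)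

lemma nchains_cell: "length ws = n \<Longrightarrow> cell g ws \<in> nchains n"
  by (auto simp: nchains_def cell_def delta_def fun_apply)

lemma nchains_prepend: "f \<in> nchains n \<Longrightarrow> prepend a f \<in> nchains (Suc n)"
  unfolding nchains_def using fin_supp_prepend[of f a]
  by (auto simp: prepend_def neq_Nil_conv split: if_splits)

lemma nchains_bdt: "length ws = Suc n \<Longrightarrow> bdt t g ws \<in> nchains n"
proof (induction t g ws arbitrary: n rule: bdt.induct)
  case (3 t g a b w)
  then obtain m where m: "n = Suc m" by (cases n) auto
  with 3 show ?case by (auto intro!: nchains_diff nchains_uminus nchains_cell nchains_prepend)
qed (auto intro!: nchains_uminus nchains_pscale nchains_cell)

lemma nchains_bd: "length ws = Suc n \<Longrightarrow> bd t g ws \<in> nchains n"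
  by (auto simp: bd_def intro!: nchains_add nchains_cell nchains_bdt)

lemma nchains_induct [consumes 1, case_names zero add]:
  assumes "f \<in> nchains n"
    and "P 0"
    and "\<And>c g ws f. length ws = n \<Longrightarrow> f \<in> nchains n \<Longrightarrow> 0 \<notin> set ws \<Longrightarrow> P f \<Longrightarrow> P (pscale c (cell g ws) + f)"
  shows "P f"
proof -
  have "fin_supp f" using assms(1) by (rule nchains_fin_supp)
  then show ?thesis using assms(1)
  proof (induction f rule: fin_supp_induct)
    case (add c i f)
    obtain g ws where i: "i = (g, ws)" by (cases i)
    have *: "pscale c (delta i) + f \<in> nchains n" by fact
    have "(pscale c (delta i) + f) (g, ws) \<noteq> 0" using add by (simp add: i delta_def fun_apply)
    with * have ws: "length ws = n" "0 \<notin> set ws" unfolding nchains_def by blast+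
    then have d: "delta i = cell g ws" by (simp add: i cell_def)
    have "f \<in> nchains n" using nchains_diff[OF * nchains_pscale[OF nchains_cell[OF ws(1)], of c g]]
      by (simp add: d)
    from assms(3)[OF ws(1) this ws(2) add.IH[OF this]] show ?case by (simp only: d)
  qed (use assms in simp)
qed

lemma linop_nchains:
  assumes "f \<in> nchains n" "\<And>g ws. length ws = n \<Longrightarrow> \<phi> g ws \<in> nchains m"
  shows "linop \<phi> f \<in> nchains m"
  unfolding linop_def lin_ext_def
  by (rule nchains_sum)
    (use assms in \<open>force simp: nchains_def[of n] split: prod.splits intro!: nchains_pscale\<close>)

subsection \<open>Nontrivial coefficients\<close>

text \<open>Inserting a fixed letter \<open>z\<close> in all positions is a homotopy between \<open>1\<close> and the action of
  \<open>z\<close> on the coefficients, because \<open>\<int>\<^sup>2\<close> is commutative.\<close>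

fun hz :: "int \<times> int \<Rightarrow> int \<times> int \<Rightarrow> (int \<times> int) list \<Rightarrow> cell_index \<Rightarrow> 'k::field" where
  "hz z g [] = cell g [z]"
| "hz z g (a # w) = cell g (z # a # w) - prepend a (hz z g w)"

lemma fin_supp_hz [simp]: "fin_supp (hz z g ws)"
  by (induction z g ws rule: hz.induct) simp_all

lemma nchains_hz: "hz z g ws \<in> nchains (Suc (length ws))"
  by (induction z g ws rule: hz.induct) (auto intro!: nchains_cell nchains_diff nchains_prepend)

lemma hz_degenerate: "0 \<in> set ws \<Longrightarrow> hz z g ws = 0"
  by (induction z g ws rule: hz.induct) (auto simp: cell_degenerate)

lemma linop_hz_cell [simp]: "linop (hz z) (cell g ws) = hz z g ws"
  by (simp add: linop_cell hz_degenerate)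

lemma linop_prepend:
  assumes "f \<in> nchains n"
    and "\<And>g ws. length ws = n \<Longrightarrow> 0 \<notin> set ws \<Longrightarrow> linop \<phi> (cell g (a # ws)) = \<Psi> (cell g ws)"
    and "\<Psi> 0 = 0" "\<And>f h. f \<in> nchains n \<Longrightarrow> h \<in> nchains n \<Longrightarrow> \<Psi> (f + h) = \<Psi> f + \<Psi> h"
      "\<And>c f. f \<in> nchains n \<Longrightarrow> \<Psi> (pscale c f) = pscale c (\<Psi> f)"
  shows "linop \<phi> (prepend a f) = \<Psi> f"
  using assms(1)
proof (induction f rule: nchains_induct)
  case (add c g ws f)
  have c: "cell g ws \<in> nchains n" using add by (simp add: nchains_cell)
  have "linop \<phi> (prepend a (pscale c (cell g ws) + f)) = pscale c (\<Psi> (cell g ws)) + \<Psi> f"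
    using add assms(2)[of ws g] by (simp add: prepend_linear linop_linear nchains_fin_supp)
  also have "\<dots> = \<Psi> (pscale c (cell g ws) + f)"
    using assms(4)[OF nchains_pscale[OF c] add.hyps(2)] assms(5)[OF c] by simp
  finally show ?case .
qed (simp add: assms)

lemma linop_hz_prepend:
  "f \<in> nchains n \<Longrightarrow> linop (hz z) (prepend a f) = prepend z (prepend a f) - prepend a (linop (hz z) f)"
  by (rule linop_prepend) (auto simp: prepend_linear linop_linear nchains_fin_supp pscale.scale_right_diff_distrib)

lemma linop_bdt_cell: "0 \<notin> set ws \<Longrightarrow> linop (bdt t) (cell g ws) = bdt t g ws"
  by (simp add: linop_def cell_def)

text \<open>The recursion of \<open>bdt\<close> lifted from words to chains. Two leading letters are
  fixed because the first merge involves both.\<close>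

lemma linop_bdt_prepend2:
  assumes f: "f \<in> nchains n" and "a \<noteq> 0" "b \<noteq> 0"
  shows "linop (bdt t) (prepend a (prepend b f)) =
           - prepend (a + b) f - prepend a (linop (bdt t) (prepend b f))"
proof -
  have "linop (bdt t) (prepend a h) =
      - linop (\<lambda>g ws. cell g ((a + hd ws) # tl ws)) h - prepend a (linop (bdt t) h)"
    if "h \<in> nchains (Suc n)" for h
    using that
  proof (rule linop_prepend)
    fix g and ws :: "(int \<times> int) list"
    assume "length ws = Suc n" "0 \<notin> set ws"
    moreover then obtain c w where "ws = c # w" by (cases ws) auto
    ultimately show "linop (bdt t) (cell g (a # ws)) =
        - linop (\<lambda>g ws. cell g ((a + hd ws) # tl ws)) (cell g ws) - prepend a (linop (bdt t) (cell g ws))"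
      using \<open>a \<noteq> 0\<close> by (simp add: linop_def cell_def[of _ "_ # _"])
  qed (auto simp: linop_linear nchains_fin_supp prepend_linear pscale.scale_right_diff_distrib)
  moreover have "linop (\<lambda>g ws. cell g ((a + hd ws) # tl ws)) (prepend b f) = prepend (a + b) f"
    using f
  proof (rule linop_prepend)
    fix g and ws :: "(int \<times> int) list"
    assume "length ws = n" "0 \<notin> set ws"
    then show "linop (\<lambda>g ws. cell g ((a + hd ws) # tl ws)) (cell g (b # ws)) = prepend (a + b) (cell g ws)"
      using \<open>b \<noteq> 0\<close> by (simp add: linop_def cell_def[of _ "b # _"])
  qed (auto simp: prepend_linear)
  ultimately show ?thesis using nchains_prepend[OF f] by simp
qed

text \<open>Induction peels off the first letter \<open>a\<close>. The cells with
  \<open>z + a\<close> and \<open>a + z\<close> cancel, and the rest is the shorter identity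
  prefixed by \<open>a\<close>. At the end only the last face of the word \<open>[z]\<close>
  remains, which contributes the character.\<close>

lemma hz_bdt:
  assumes "0 \<notin> set ws" "z \<noteq> 0"
  shows "linop (bdt t) (hz z g ws) + linop (hz z) (bdt t g ws) = - pscale (chi t g z) (cell g ws)"
  using assms
proof (induction t g ws rule: bdt.induct)
  case (1 t g)
  then show ?case by (simp add: linop_bdt_cell)
next
  case (2 t g a)
  then show ?case by (simp add: linop_bdt_cell linop_linear prepend_linear add.commute)
next
  case (3 t g a b w)
  let ?B = "bdt t g (b # w)"
  have nz: "a \<noteq> 0" "b \<noteq> 0" "0 \<notin> set w" using 3 by auto
  have IH: "linop (bdt t) (hz z g (b # w)) + linop (hz z) ?B = - pscale (chi t g z) (cell g (b # w))"
    using 3 by simp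
  have B: "?B \<in> nchains (length w)" by (rule nchains_bdt) simp
  have 1: "linop (bdt t) (hz z g (b # w)) = bdt t g (z # b # w) - linop (bdt t) (prepend b (hz z g w))"
    using nz \<open>z \<noteq> 0\<close> by (simp add: linop_linear linop_bdt_cell)
  have "linop (bdt t) (hz z g (a # b # w)) =
      bdt t g (z # a # b # w) - bdt t g (a # z # b # w)
      - prepend (a + b) (hz z g w) - prepend a (linop (bdt t) (prepend b (hz z g w)))"
    using nz \<open>z \<noteq> 0\<close>
    by (simp add: linop_linear linop_bdt_cell prepend_linear linop_bdt_prepend2[OF nchains_hz] del: bdt.simps)
  moreover have "linop (hz z) (bdt t g (a # b # w)) =
      - hz z g ((a + b) # w) - prepend z (prepend a ?B) + prepend a (linop (hz z) ?B)"
    by (simp add: linop_linear linop_hz_prepend[OF B] del: hz.simps)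
  ultimately have "linop (bdt t) (hz z g (a # b # w)) + linop (hz z) (bdt t g (a # b # w)) =
      prepend a (linop (bdt t) (hz z g (b # w)) + linop (hz z) ?B)"
    unfolding 1 by (simp add: prepend_linear add.commute)
  then show ?case by (simp only: IH prepend_linear prepend_cell)
qed

lemma linop_bd_split:
  assumes "f \<in> nchains (Suc n)"
  shows "linop (bd t) f = linop (\<lambda>g ws. cell g (tl ws)) f + linop (bdt t) f"
  using assms
proof (induction f rule: nchains_induct)
  case (add c g ws f)
  have "linop (bd t) (cell g ws) = linop (\<lambda>g ws. cell g (tl ws)) (cell g ws) + linop (bdt t) (cell g ws)"
    using add by (auto simp: linop_def cell_def[of g ws] bd_def)
  then show ?case
    using add by (simp add: linop_linear nchains_fin_supp pscale.scale_right_distrib del: linop_bd_cell)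
qed simp

text \<open>The zeroth face of \<open>z # ws\<close> contributes the cell itself, and
  \<open>hz_bdt\<close> the cell twisted by \<open>chi\<close>; the zeroth faces of the other
  summands cancel against the homotopy applied to the zeroth face.\<close>

lemma hz_homotopy:
  fixes t :: "'k::field"
  assumes "0 \<notin> set ws" "z \<noteq> 0"
  shows "linop (bd t) (hz z g ws) + linop (hz z) (bd t g ws) = pscale (1 - chi t g z) (cell g ws)"
proof (cases ws)
  case Nil
  then show ?thesis by (simp add: bd_def pscale.scale_left_diff_distrib)
next
  case (Cons a w)
  have "linop (\<lambda>g ws. cell g (tl ws)) (prepend a (hz z g w)) = (hz z g w :: cell_index \<Rightarrow> 'k)"
    using nchains_hz
  proof (rule linop_prepend)
    fix g and v :: "(int \<times> int) list"
    assume "0 \<notin> set v"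
    then show "linop (\<lambda>g ws. cell g (tl ws)) (cell g (a # v)) = cell g v"
      using assms Cons by (auto simp: linop_def cell_def)
  qed auto
  moreover have "linop (\<lambda>g ws. cell g (tl ws)) (cell g (z # a # w)) = (cell g (a # w) :: cell_index \<Rightarrow> 'k)"
    using assms Cons by (auto simp: linop_def cell_def)
  ultimately have "linop (\<lambda>g ws. cell g (tl ws)) (hz z g ws) = (cell g ws - hz z g w :: cell_index \<Rightarrow> 'k)"
    by (simp add: Cons linop_linear)
  moreover have "linop (hz z) (bd t g ws) = hz z g w + linop (hz z) (bdt t g ws)"
    by (simp add: Cons bd_def linop_linear)
  ultimately show ?thesis
    using hz_bdt[OF assms, of t g, symmetric] linop_bd_split[OF nchains_hz, of t z g ws]
    by (simp add: pscale.scale_left_diff_distrib)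
qed

subsection \<open>Trivial coefficients\<close>

text \<open>In degree \<open>g = 0\<close> the homotopy replaces the first letter \<open>a\<close> by the edges of the lattice path
  from \<open>0\<close> to \<open>a\<close> that is first horizontal and then vertical; the path for \<open>a + b\<close> and the
  concatenation of the paths for \<open>b\<close> and \<open>a\<close> bound a rectangle, and filling it with unit squares
  gives the second part of the homotopy.\<close>

abbreviation "e\<^sub>1 \<equiv> (1 :: int, 0 :: int)"
abbreviation "e\<^sub>2 \<equiv> (0 :: int, 1 :: int)"

definition edge :: "int \<times> int \<Rightarrow> int \<times> int \<Rightarrow> (cell_index \<Rightarrow> 'k::field) \<Rightarrow> cell_index \<Rightarrow> 'k" where
  "edge e p f = prepend e (prepend p f)"

definition path :: "int \<times> int \<Rightarrow> int \<times> int \<Rightarrow> (cell_index \<Rightarrow> 'k::field) \<Rightarrow> cell_index \<Rightarrow> 'k" where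
  "path c a f = isum (\<lambda>j. edge e\<^sub>1 ((j, 0) + c) f) (fst a) + isum (\<lambda>j. edge e\<^sub>2 ((fst a, j) + c) f) (snd a)"

definition square_bd :: "int \<times> int \<Rightarrow> (cell_index \<Rightarrow> 'k::field) \<Rightarrow> cell_index \<Rightarrow> 'k" where
  "square_bd p f = edge e\<^sub>1 p f + edge e\<^sub>2 (p + e\<^sub>1) f - edge e\<^sub>1 (p + e\<^sub>2) f - edge e\<^sub>2 p f"

text \<open>The two triangles into which a diagonal cuts the unit square at \<open>p\<close>, with
  opposite orientations.\<close>

definition square :: "int \<times> int \<Rightarrow> (cell_index \<Rightarrow> 'k::field) \<Rightarrow> cell_index \<Rightarrow> 'k" where
  "square p f = prepend e\<^sub>1 (edge e\<^sub>2 p f) - prepend e\<^sub>2 (edge e\<^sub>1 p f)"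

text \<open>The rectangle has corner \<open>(fst b, 0)\<close>, width \<open>fst a\<close> and
  height \<open>snd b\<close>: it lies between the path to \<open>a + b\<close> and the path to
  \<open>b\<close> followed by the translated path for \<open>a\<close>.\<close>

definition rect :: "int \<times> int \<Rightarrow> int \<times> int \<Rightarrow> (int \<times> int \<Rightarrow> 'a::ab_group_add) \<Rightarrow> 'a" where
  "rect a b F = isum (\<lambda>j. isum (\<lambda>i. F (fst b + j, i)) (snd b)) (fst a)"

fun path_htp :: "int \<times> int \<Rightarrow> (int \<times> int) list \<Rightarrow> cell_index \<Rightarrow> 'k::field" where
  "path_htp g [] = 0"
| "path_htp g (a # w) = path 0 a (cell g w)"

fun rect_htp :: "int \<times> int \<Rightarrow> (int \<times> int) list \<Rightarrow> cell_index \<Rightarrow> 'k::field" where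
  "rect_htp g (a # b # w) = - rect a b (\<lambda>p. square p (cell g w))"
| "rect_htp g _ = 0"

lemma edge_linear:
  "edge e p (f + h) = edge e p f + edge e p h" "edge e p (f - h) = edge e p f - edge e p h"
  "edge e p (- f) = - edge e p f" "edge e p (pscale c f) = pscale c (edge e p f)" "edge e p 0 = 0"
  by (simp_all add: edge_def prepend_linear)

lemma isum_pscale: "isum (\<lambda>j. pscale c (f j)) a = pscale (c :: 'k::field) (isum f a)"
  by (rule isum_unique) (auto simp: isum_Suc pscale.scale_right_distrib)

lemma path_linear:
  "path c a (f + h) = path c a f + path c a h" "path c a (f - h) = path c a f - path c a h"
  "path c a (- f) = - path c a f" "path c a (pscale k f) = pscale k (path c a f)" "path c a 0 = 0"
  unfolding path_def
  by (simp_all add: edge_linear isum_add isum_diff isum_uminus isum_pscale pscale.scale_right_distrib)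

lemma square_linear:
  "square p (f + h) = square p f + square p h" "square p (f - h) = square p f - square p h"
  "square p (- f) = - square p f" "square p (pscale k f) = pscale k (square p f)" "square p 0 = 0"
  unfolding square_def
  by (simp_all add: edge_linear prepend_linear pscale.scale_right_diff_distrib)

lemma rect_linear:
  "rect a b (\<lambda>p. F p + H p) = rect a b F + rect a b H"
  "rect a b (\<lambda>p. F p - H p) = rect a b F - rect a b H"
  "rect a b (\<lambda>p. - F p) = - rect a b F" "rect a b (\<lambda>p. 0) = 0"
  unfolding rect_def by (simp_all add: isum_add isum_diff isum_uminus)

lemma rect_pscale: "rect a b (\<lambda>p. pscale c (F p)) = pscale (c :: 'k::field) (rect a b F)"
  unfolding rect_def by (simp add: isum_pscale)

lemma fin_supp_edge [simp]: "fin_supp f \<Longrightarrow> fin_supp (edge e p f)"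
  by (simp add: edge_def)

lemma fin_supp_path [simp]: "fin_supp f \<Longrightarrow> fin_supp (path c a f)"
  by (simp add: path_def)

lemma fin_supp_square [simp]: "fin_supp f \<Longrightarrow> fin_supp (square p f)"
  by (simp add: square_def)

lemma fin_supp_rect [simp]: "(\<And>p. fin_supp (F p)) \<Longrightarrow> fin_supp (rect a b F)"
  by (simp add: rect_def)

lemma nchains_edge: "f \<in> nchains n \<Longrightarrow> edge e p f \<in> nchains (Suc (Suc n))"
  by (simp add: edge_def nchains_prepend)

lemma nchains_path: "f \<in> nchains n \<Longrightarrow> path c a f \<in> nchains (Suc (Suc n))"
  unfolding path_def by (intro nchains_add nchains_isum nchains_edge)

lemma nchains_square: "f \<in> nchains n \<Longrightarrow> square p f \<in> nchains (Suc (Suc (Suc n)))"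
  by (simp add: square_def edge_def nchains_prepend nchains_diff)

lemma nchains_rect: "(\<And>p. F p \<in> nchains n) \<Longrightarrow> rect a b F \<in> nchains n"
  unfolding rect_def by (intro nchains_isum)

lemma linop_rect: "(\<And>p. fin_supp (F p)) \<Longrightarrow> linop \<phi> (rect a b F) = rect a b (\<lambda>p. linop \<phi> (F p))"
  by (simp add: rect_def linop_isum)

lemma path_htp_degenerate: "0 \<in> set ws \<Longrightarrow> path_htp g ws = 0"
  by (cases ws) (auto simp: path_def cell_degenerate edge_linear)

lemma rect_htp_degenerate: "0 \<in> set ws \<Longrightarrow> rect_htp g ws = 0"
  by (induction g ws rule: rect_htp.induct) (auto simp: rect_def cell_degenerate square_linear)

lemma linop_path_htp_cell [simp]: "linop path_htp (cell g ws) = path_htp g ws"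
  and linop_rect_htp_cell [simp]: "linop rect_htp (cell g ws) = rect_htp g ws"
  by (simp_all add: linop_cell path_htp_degenerate rect_htp_degenerate)

lemma linop_path_htp_prepend: "f \<in> nchains n \<Longrightarrow> linop path_htp (prepend a f) = path 0 a f"
  by (rule linop_prepend) (auto simp: path_linear)

lemma linop_rect_htp_prepend:
  assumes "f \<in> nchains n"
  shows "linop rect_htp (prepend a (prepend b f)) = - rect a b (\<lambda>p. square p f)"
  using assms
proof (induction f rule: nchains_induct)
  case (add c g ws f)
  then show ?case
    by (simp add: prepend_linear linop_linear nchains_fin_supp square_linear rect_linear rect_pscale)
qed (simp add: square_linear rect_linear)

text \<open>Discrete Green formula: interior edges cancel in pairs, and the remaining boundary of
  the rectangle is the difference of the two paths, which share their first horizontal and last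
  vertical stretch.\<close>

lemma path_loop:
  "rect a b (\<lambda>p. square_bd p f) = path 0 (a + b) f - path 0 b f - path b a f"
proof -
  obtain x y a1 a2 where b: "b = (x, y)" and a: "a = (a1, a2)" by (cases a, cases b)
  define h v where "h = (\<lambda>i j. edge e\<^sub>1 (i, j) f)" and "v = (\<lambda>i j. edge e\<^sub>2 (i, j) f)"
  \<comment> \<open>Horizontal edges telescope in the vertical direction, vertical edges in the
    horizontal one.\<close>
  have H: "isum (\<lambda>i. h (x + j) (i + 1) - h (x + j) i) y = h (x + j) y - h (x + j) 0" for j
    by (rule isum_telescope)
  have V: "isum (\<lambda>j. isum (v (x + (j + 1))) y - isum (v (x + j)) y) a1 =
        isum (v (x + a1)) y - isum (v x) y"
    using isum_telescope[of "\<lambda>j. isum (v (x + j)) y" a1] by simp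
  have "rect a b (\<lambda>p. square_bd p f) =
      isum (\<lambda>j. (isum (v (x + (j + 1))) y - isum (v (x + j)) y) - (h (x + j) y - h (x + j) 0)) a1"
    unfolding rect_def a b H[symmetric]
    by (simp add: square_bd_def h_def v_def isum_diff[symmetric] algebra_simps)
  also have "\<dots> = isum (v (x + a1)) y - isum (v x) y
      - (isum (\<lambda>j. h (x + j) y) a1 - isum (\<lambda>j. h (x + j) 0) a1)"
    by (simp only: isum_diff V[unfolded isum_diff])
  finally have R: "rect a b (\<lambda>p. square_bd p f) = isum (v (x + a1)) y - isum (v x) y
      - (isum (\<lambda>j. h (x + j) y) a1 - isum (\<lambda>j. h (x + j) 0) a1)" .
  have P1: "path 0 b f = isum (\<lambda>j. h j 0) x + isum (v x) y"
    by (simp add: path_def b h_def v_def)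
  have P2: "path b a f = isum (\<lambda>j. h (x + j) y) a1 + isum (\<lambda>j. v (x + a1) (y + j)) a2"
    by (simp add: path_def a b h_def v_def add.commute)
  have P3: "path 0 (a + b) f = isum (\<lambda>j. h j 0) (x + a1) + isum (v (x + a1)) (y + a2)"
    by (simp add: path_def a b h_def v_def add.commute)
  show ?thesis unfolding R P1 P2 P3 isum_shift by simp
qed

lemma bd_edge:
  "linop (bd t) (edge e p (cell g (b # w))) =
     cell g (p # b # w) - cell g ((e + p) # b # w) + edge e (p + b) (cell g w) + edge e p (bdt t g (b # w))"
  by (simp add: edge_def bd_def prepend_linear algebra_simps)

text \<open>Endpoints of consecutive edges cancel along the path; the starting point drops out
  because the letter 0 is degenerate.\<close>

lemma path_boundary:
  "isum (\<lambda>j. cell g ((j, 0) # w) - cell g ((e\<^sub>1 + (j, 0)) # w)) (fst a)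
   + isum (\<lambda>j. cell g ((fst a, j) # w) - cell g ((e\<^sub>2 + (fst a, j)) # w)) (snd a) = - (cell g (a # w) :: cell_index \<Rightarrow> 'k::field)"
proof -
  define c where "c = (cell g :: _ \<Rightarrow> cell_index \<Rightarrow> 'k)"
  have "isum (\<lambda>j. c ((j, 0) # w) - c ((e\<^sub>1 + (j, 0)) # w)) (fst a) =
      c ((0, 0) # w) - c ((fst a, 0) # w)"
    using isum_telescope[of "\<lambda>j. - c ((j, 0) # w)" "fst a"]
    by (simp add: add.commute)
  moreover have "isum (\<lambda>j. c ((fst a, j) # w) - c ((e\<^sub>2 + (fst a, j)) # w)) (snd a) =
      c ((fst a, 0) # w) - c (a # w)"
    using isum_telescope[of "\<lambda>j. - c ((fst a, j) # w)" "snd a"]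
    by (simp add: add.commute)
  moreover have "c ((0, 0) # w) = 0" by (simp add: c_def cell_def zero_prod_def)
  ultimately show ?thesis unfolding c_def[symmetric] by simp
qed

text \<open>The path of \<open>a + b\<close> differs from the concatenation of the paths of
  \<open>b\<close> and \<open>a\<close> by a closed loop; \<open>path_loop\<close> expresses this
  defect by a rectangle.\<close>

lemma path_homotopy:
  "linop (bd t) (path_htp g (a # b # w)) + linop path_htp (bd t g (a # b # w)) =
     - cell g (a # b # w) - rect a b (\<lambda>p. square_bd p (cell g w))"
proof -
  have 1: "linop (bd t) (path_htp g (a # b # w)) =
      - cell g (a # b # w) + path b a (cell g w) + path 0 a (bdt t g (b # w))"
    unfolding path_htp.simps path_def
    by (simp add: linop_linear bd_edge isum_add isum_diff path_boundary[unfolded isum_diff, symmetric] algebra_simps)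
  have 2: "linop path_htp (bd t g (a # b # w)) =
      path 0 b (cell g w) - path 0 (a + b) (cell g w) - path 0 a (bdt t g (b # w))"
    by (simp add: bd_def linop_linear linop_path_htp_prepend[OF nchains_bdt])
  show ?thesis unfolding 1 2 path_loop by simp
qed

lemma bd_square:
  "linop (bd t) (square p (cell g (c # w))) =
     - square_bd p (cell g (c # w)) - square (p + c) (cell g w) - square p (bdt t g (c # w))"
  by (simp add: square_def edge_def square_bd_def bd_def prepend_linear linop_linear algebra_simps)

text \<open>With no letter after \<open>p\<close> the last face drops \<open>p\<close> and leaves
  the fundamental 2-cycle, the source of the homology in degree 2.\<close>

lemma bd_square_Nil:
  "linop (bd t) (square p (cell 0 [])) = - square_bd p (cell 0 []) - (cell 0 [e\<^sub>1, e\<^sub>2] - cell 0 [e\<^sub>2, e\<^sub>1])"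
  by (simp add: square_def edge_def square_bd_def bd_def prepend_linear linop_linear algebra_simps)

text \<open>The rectangle of \<open>a + b\<close> and \<open>c\<close> splits into that of
  \<open>b\<close> and \<open>c\<close> and the lower part of the rectangle of \<open>a\<close> and
  \<open>b + c\<close>, whose upper part is the rectangle of \<open>a\<close> and \<open>b\<close>
  translated by \<open>c\<close>.\<close>

lemma rect_cocycle:
  "rect b c F - rect (a + b) c F + rect a (b + c) F = rect a b (\<lambda>p. F (p + c))"
proof -
  obtain a1 a2 b1 b2 c1 c2 where *: "a = (a1, a2)" "b = (b1, b2)" "c = (c1, c2)"
    by (cases a, cases b, cases c)
  define G where "G j n = isum (\<lambda>i. F (c1 + j, i)) n" for j n
  have 1: "rect (a + b) c F = isum (\<lambda>j. G j c2) b1 + isum (\<lambda>j. G (b1 + j) c2) a1"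
    by (simp add: rect_def * G_def add.commute[of a1] isum_shift)
  have 2: "rect a (b + c) F = isum (\<lambda>j. G (b1 + j) (c2 + b2)) a1"
    by (simp add: rect_def * G_def algebra_simps)
  have 3: "G (b1 + j) (c2 + b2) = G (b1 + j) c2 + isum (\<lambda>i. F (c1 + (b1 + j), c2 + i)) b2" for j
    by (simp add: G_def isum_shift)
  have 4: "rect a b (\<lambda>p. F (p + c)) = isum (\<lambda>j. isum (\<lambda>i. F (c1 + (b1 + j), c2 + i)) b2) a1"
    by (simp add: rect_def * algebra_simps)
  show ?thesis unfolding 1 2 3 4 isum_add by (simp add: rect_def * G_def)
qed

text \<open>The faces that merge letters behind the squares cancel by \<open>rect_cocycle\<close>.
  What is left are the boundaries of the unit squares, the negative of the defect in
  \<open>path_homotopy\<close>.\<close>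

lemma rect_homotopy:
  "linop (bd t) (rect_htp g (a # b # c # w)) + linop rect_htp (bd t g (a # b # c # w)) =
     rect a b (\<lambda>p. square_bd p (cell g (c # w)))"
proof -
  let ?R = "\<lambda>a b f. rect a b (\<lambda>p. square p f)"
  have 1: "linop (bd t) (rect_htp g (a # b # c # w)) =
      rect a b (\<lambda>p. square_bd p (cell g (c # w))) + rect a b (\<lambda>p. square (p + c) (cell g w))
      + ?R a b (bdt t g (c # w))"
    by (simp add: linop_linear linop_rect bd_square rect_linear)
  have 2: "linop rect_htp (bd t g (a # b # c # w)) =
      - ?R b c (cell g w) + ?R (a + b) c (cell g w) - ?R a (b + c) (cell g w) - ?R a b (bdt t g (c # w))"
    by (simp add: bd_def linop_linear prepend_linear linop_rect_htp_prepend[OF nchains_bdt])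
  show ?thesis unfolding 1 2 rect_cocycle[of b c "\<lambda>p. square p (cell g w)" a, symmetric]
    by (simp add: algebra_simps)
qed

subsection \<open>The contraction onto a finite-dimensional complex\<close>

definition betti :: "nat \<Rightarrow> nat" where
  "betti n = (if n = 0 then 1 else if n = 1 then 2 else if n = 2 then 1 else 0)"

definition repr_cycle :: "nat \<Rightarrow> nat \<Rightarrow> cell_index \<Rightarrow> 'k::field" where
  "repr_cycle n k =
     (if n = 0 then cell 0 []
      else if n = 1 then (if k = 0 then cell 0 [e\<^sub>1] else cell 0 [e\<^sub>2])
      else if n = 2 then cell 0 [e\<^sub>1, e\<^sub>2] - cell 0 [e\<^sub>2, e\<^sub>1] else 0)"

definition from_coords :: "nat \<Rightarrow> (nat \<Rightarrow> 'k::field) \<Rightarrow> cell_index \<Rightarrow> 'k" where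
  "from_coords n v = (\<Sum>k<betti n. pscale (v k) (repr_cycle n k))"

text \<open>Cocycles dual to \<open>repr_cycle\<close>: the two coordinate homomorphisms for one
  letter, and for two letters the signed number of unit squares in the rectangle of \<open>a\<close>
  and \<open>b\<close>.\<close>

fun to_coords :: "int \<times> int \<Rightarrow> (int \<times> int) list \<Rightarrow> nat \<Rightarrow> 'k::field" where
  "to_coords g [] = (if g = 0 then delta 0 else 0)"
| "to_coords g [a] =
     (if g = 0 then pscale (of_int (fst a)) (delta 0) + pscale (of_int (snd a)) (delta 1) else 0)"
| "to_coords g [a, b] = (if g = 0 then pscale (of_int (fst a * snd b)) (delta 0) else 0)"
| "to_coords g (a # b # c # w) = 0"

text \<open>Chosen so that \<open>chi t g (htp_letter g)\<close> is a power of \<open>t\<close> with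
  exponent \<open>- snd g\<close> or \<open>fst g\<close>, whichever is known to be nonzero when
  \<open>g\<close> is nonzero.\<close>

definition htp_letter :: "int \<times> int \<Rightarrow> int \<times> int" where
  "htp_letter g = (if snd g \<noteq> 0 then e\<^sub>1 else e\<^sub>2)"

definition htp :: "'k::field \<Rightarrow> int \<times> int \<Rightarrow> (int \<times> int) list \<Rightarrow> cell_index \<Rightarrow> 'k" where
  "htp t g ws =
     (if g = 0 then - (path_htp g ws + rect_htp g ws)
      else pscale (1 / (1 - chi t g (htp_letter g))) (hz (htp_letter g) g ws))"

lemma betti_simps [simp]: "betti 0 = 1" "betti (Suc 0) = 2" "betti 2 = 1" "betti (Suc (Suc 0)) = 1" "betti (Suc (Suc (Suc n))) = 0"
  by (simp_all add: betti_def)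

lemma from_coords_add: "from_coords n (v + w) = from_coords n v + from_coords n w"
  by (simp add: from_coords_def fun_apply pscale.scale_left_distrib sum.distrib)

lemma from_coords_pscale: "from_coords n (pscale c v) = pscale c (from_coords n v)"
  by (simp add: from_coords_def fun_apply pscale.scale_sum_right)

lemma from_coords_uminus: "from_coords n (- v) = - from_coords n v"
  by (simp add: from_coords_def fun_apply sum_negf)

lemma from_coords_diff: "from_coords n (v - w) = from_coords n v - from_coords n w"
  using from_coords_add[of n v "- w"] by (simp add: from_coords_uminus)

lemma from_coords_0 [simp]: "from_coords n 0 = 0"
  by (simp add: from_coords_def fun_apply)

lemma repr_cycle_nchains: "repr_cycle n k \<in> nchains n"
  by (auto simp: repr_cycle_def intro!: nchains_cell nchains_diff)

lemma from_coords_nchains: "from_coords n v \<in> nchains n"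
  unfolding from_coords_def by (intro nchains_sum nchains_pscale repr_cycle_nchains)

lemma to_coords_degenerate: "0 \<in> set ws \<Longrightarrow> to_coords g ws = 0"
  by (induction g ws rule: to_coords.induct) auto

lemma fin_supp_to_coords [simp]: "fin_supp (to_coords g ws)"
  by (induction g ws rule: to_coords.induct) auto

lemma linop_to_coords_cell [simp]: "linop to_coords (cell g ws) = to_coords g ws"
  by (simp add: linop_cell to_coords_degenerate)

lemma bd_repr_cycle: "linop (bd t) (repr_cycle n k) = 0"
  by (auto simp: repr_cycle_def linop_linear bd_def prepend_linear)

lemma bd_from_coords: "linop (bd t) (from_coords n v) = 0"
  unfolding from_coords_def linop_def
  by (subst lin_ext_sum)
    (auto simp: lin_ext_pscale nchains_fin_supp[OF repr_cycle_nchains] bd_repr_cycle[unfolded linop_def])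

lemma to_coords_from_coords:
  assumes "\<forall>i\<ge>betti n. v i = 0"
  shows "linop to_coords (from_coords n v) = v"
proof -
  consider "n = 0" | "n = 1" | "n = 2" | "n \<ge> 3" by linarith
  then show ?thesis
  proof cases
    case 4
    then have "betti n = 0" by (simp add: betti_def)
    with assms show ?thesis by (simp add: from_coords_def fun_eq_iff fun_apply)
  qed (use assms in \<open>auto simp: from_coords_def repr_cycle_def linop_linear numeral_2_eq_2,
        auto simp: fun_eq_iff fun_apply delta_def\<close>)
qed

text \<open>For \<open>g = 0\<close> these are the cocycle identities of the coordinates and of the
  bilinear form \<open>fst a * snd b\<close>. The boundary preserves \<open>g\<close>, and for
  \<open>g\<close> other than 0 all coordinates vanish.\<close>

lemma to_coords_bd: "linop to_coords (bd (t :: 'k::field) g ws) = 0"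
proof (cases "g = 0")
  case True
  consider "ws = []" | a where "ws = [a]" | a b where "ws = [a, b]" | a b c where "ws = [a, b, c]"
    | a b c d w where "ws = a # b # c # d # w"
    by (metis neq_Nil_conv)
  then show ?thesis
  proof cases
    case 5
    have "linop to_coords f = 0" if "f \<in> nchains (Suc (Suc (Suc n)))" for f n
      using that
    proof (induction f rule: nchains_induct)
      case (add c g ws f)
      then obtain a b c w where "ws = a # b # c # w" by (metis Suc_length_conv)
      with add show ?case by (simp add: linop_linear nchains_fin_supp)
    qed simp
    with 5 nchains_bd[of ws "Suc (Suc (Suc (length w)))" t g] show ?thesis by simp
  next
    case (3 a b)
    show ?thesis unfolding 3 True
      by (simp add: bd_def linop_linear prepend_linear) (simp add: fun_eq_iff fun_apply algebra_simps)
  next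
    case (4 a b c)
    show ?thesis unfolding 4 True
      by (simp add: bd_def linop_linear prepend_linear) (simp add: fun_eq_iff fun_apply algebra_simps)
  qed (use True in \<open>simp_all add: bd_def linop_linear\<close>)
next
  case False
  have "linop to_coords f = 0" if "f \<in> nchains n" "\<And>ws. f (0, ws) = 0" for f :: "cell_index \<Rightarrow> 'k" and n
    unfolding linop_def lin_ext_def
  proof (rule sum.neutral, clarify)
    fix g1 g2 and ws :: "(int \<times> int) list"
    assume "f ((g1, g2), ws) \<noteq> 0"
    with that have "(g1, g2) \<noteq> 0" by metis
    then have "to_coords (g1, g2) ws = (0 :: nat \<Rightarrow> 'k)"
      by (induction "(g1, g2)" ws rule: to_coords.induct) auto
    then show "pscale (f ((g1, g2), ws)) (to_coords (g1, g2) ws) = 0" by simp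
  qed
  moreover have "bdt t g ws (0, v) = 0" for v
    using False
    by (induction t g ws arbitrary: v rule: bdt.induct) (auto simp: fun_apply cell_def delta_def prepend_def)
  then have "bd t g ws (0, v) = 0" for v
    using False by (auto simp: bd_def fun_apply cell_def delta_def)
  moreover have "\<exists>n. bd t g ws \<in> nchains n"
  proof (cases ws)
    case Nil
    then show ?thesis by (simp add: bd_def)
  next
    case (Cons a w)
    then have "bd t g ws \<in> nchains (length w)" by (intro nchains_bd) simp
    then show ?thesis ..
  qed
  ultimately show ?thesis by blast
qed

lemma htp_degenerate: "0 \<in> set ws \<Longrightarrow> htp t g ws = 0"
  by (simp add: htp_def path_htp_degenerate rect_htp_degenerate hz_degenerate)

lemma linop_htp_cell [simp]: "linop (htp t) (cell g ws) = htp t g ws"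
  by (simp add: linop_cell htp_degenerate)

lemma fin_supp_path_htp [simp]: "fin_supp (path_htp g ws)"
  by (cases ws) auto

lemma fin_supp_rect_htp [simp]: "fin_supp (rect_htp g ws)"
  by (induction g ws rule: rect_htp.induct) auto

lemma nchains_htp: "htp (t :: 'k::field) g ws \<in> nchains (Suc (length ws))"
proof -
  have "(path_htp g ws :: cell_index \<Rightarrow> 'k) \<in> nchains (Suc (length ws))" for g
    by (cases ws) (simp_all add: nchains_path nchains_cell)
  moreover have "(rect_htp g ws :: cell_index \<Rightarrow> 'k) \<in> nchains (Suc (length ws))" for g
    by (induction g ws rule: rect_htp.induct)
      (auto intro!: nchains_uminus nchains_rect nchains_square[OF nchains_cell, simplified])
  ultimately show ?thesis
    by (simp add: htp_def nchains_uminus nchains_add nchains_pscale nchains_hz del: minus_add_distrib)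
qed

lemma linop_degree:
  assumes "\<And>ws. \<phi> g ws = \<phi>' g ws" "\<And>h ws. h \<noteq> g \<Longrightarrow> f (h, ws) = 0"
  shows "linop \<phi> f = linop \<phi>' f"
  unfolding linop_def lin_ext_def by (rule sum.cong) (use assms in \<open>auto, metis\<close>)

lemma bd_degree: "h \<noteq> g \<Longrightarrow> bd t g ws (h, v) = 0"
proof -
  assume h: "h \<noteq> g"
  then have "bdt t g ws (h, v) = 0"
    by (induction t g ws arbitrary: v rule: bdt.induct) (auto simp: fun_apply cell_def delta_def prepend_def)
  then show ?thesis using h by (auto simp: bd_def fun_apply cell_def delta_def)
qed

text \<open>The correction by coordinates comes from last faces: for one letter an edge loses
  \<open>p\<close> and leaves its direction \<open>e\<close>, for two letters each square leaves the
  fundamental cycle. From three letters on the defects of the path and rectangle parts cancel and no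
  correction remains.\<close>

lemma htp_homotopy_0:
  "linop (bd t) (path_htp 0 ws + rect_htp 0 ws)
     + (linop path_htp (bd t 0 ws) + linop rect_htp (bd t 0 ws)) =
   from_coords (length ws) (to_coords 0 ws) - cell 0 ws"
proof -
  consider "ws = []" | a where "ws = [a]" | a b where "ws = [a, b]" | a b c w where "ws = a # b # c # w"
    by (metis neq_Nil_conv)
  then show ?thesis
  proof cases
    case 1
    then show ?thesis by (simp add: bd_def from_coords_def repr_cycle_def delta_def)
  next
    case (2 a)
    have e: "linop (bd t) (edge e p (cell 0 [])) = cell 0 [p] - cell 0 [e + p] + cell 0 [e]" for e p
      by (simp add: edge_def bd_def prepend_linear)
    have "linop (bd t) (path_htp 0 ws) =
        - cell 0 [a] + pscale (of_int (fst a)) (cell 0 [e\<^sub>1]) + pscale (of_int (snd a)) (cell 0 [e\<^sub>2])"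
      by (simp add: 2 path_def linop_linear e isum_add isum_diff isum_const_pscale
          path_boundary[unfolded isum_diff, symmetric] algebra_simps)
    moreover have "bd t 0 ws = 0" by (simp add: 2 bd_def)
    ultimately show ?thesis
      by (simp add: 2 from_coords_def repr_cycle_def numeral_2_eq_2 delta_def fun_apply)
  next
    case (3 a b)
    have "linop (bd t) (rect_htp 0 ws) = rect a b (\<lambda>p. square_bd p (cell 0 []))
        + rect a b (\<lambda>p. cell 0 [e\<^sub>1, e\<^sub>2] - cell 0 [e\<^sub>2, e\<^sub>1])"
      by (simp only: 3 rect_htp.simps) (simp add: linop_linear linop_rect bd_square_Nil rect_linear)
    also have "rect a b (\<lambda>p. cell 0 [e\<^sub>1, e\<^sub>2] - cell 0 [e\<^sub>2, e\<^sub>1]) =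
        pscale (of_int (fst a * snd b)) (cell 0 [e\<^sub>1, e\<^sub>2] - cell 0 [e\<^sub>2, e\<^sub>1])"
      by (simp add: rect_def isum_const_pscale)
    finally have r: "linop (bd t) (rect_htp 0 ws) = rect a b (\<lambda>p. square_bd p (cell 0 []))
        + pscale (of_int (fst a * snd b)) (cell 0 [e\<^sub>1, e\<^sub>2] - cell 0 [e\<^sub>2, e\<^sub>1])" .
    have "linop rect_htp (bd t 0 ws) = 0"
      by (simp add: 3 bd_def linop_linear prepend_linear)
    then show ?thesis
      using r path_homotopy[of t 0 a b "[]"]
      by (simp add: 3 linop_linear from_coords_def repr_cycle_def delta_def fun_apply algebra_simps
          del: path_htp.simps rect_htp.simps)
  next
    case (4 a b c w)
    have "from_coords (length ws) (to_coords 0 ws) = 0" by (simp add: 4)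
    then show ?thesis
      using rect_homotopy[of t 0 a b c w] path_homotopy[of t 0 a b "c # w"]
      by (simp add: 4 linop_linear algebra_simps del: path_htp.simps rect_htp.simps)
  qed
qed

text \<open>For \<open>g = 0\<close> the sign in \<open>htp\<close> turns
  \<open>htp_homotopy_0\<close> around; otherwise the coordinates vanish, and division by
  \<open>1 - chi\<close> normalizes the factor in \<open>hz_homotopy\<close>.\<close>

lemma htp_homotopy_cell:
  fixes t :: "'k::field"
  assumes t: "t \<noteq> 0" "\<And>k. k \<noteq> 0 \<Longrightarrow> t powi k \<noteq> 1" and ws: "0 \<notin> set ws"
  shows "linop (bd t) (htp t g ws) + linop (htp t) (bd t g ws) =
     cell g ws - from_coords (length ws) (to_coords g ws)"
proof (cases "g = 0")
  case True
  have add: "linop (\<lambda>g ws. - (path_htp g ws + rect_htp g ws)) f = - (linop path_htp f + linop rect_htp f)" for f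
    by (simp add: linop_def lin_ext_def split_def sum_negf sum_subtractf pscale.scale_right_diff_distrib)
  have 1: "linop (htp t) (bd t 0 ws) = - (linop path_htp (bd t 0 ws) + linop rect_htp (bd t 0 ws))"
    unfolding add[symmetric] by (rule linop_degree[of _ 0]) (auto simp: htp_def bd_degree)
  have "linop (bd t) (htp t 0 ws) = - linop (bd t) (path_htp 0 ws + rect_htp 0 ws)"
    unfolding htp_def if_P[OF refl] by (rule linop_uminus) simp
  then have "linop (bd t) (htp t 0 ws) + linop (htp t) (bd t 0 ws) =
      - (linop (bd t) (path_htp 0 ws + rect_htp 0 ws)
         + (linop path_htp (bd t 0 ws) + linop rect_htp (bd t 0 ws)))"
    by (simp add: 1)
  then show ?thesis unfolding htp_homotopy_0 using True by simp
next
  case False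
  define z where "z = htp_letter g"
  have z: "z \<noteq> 0" by (simp add: z_def htp_letter_def zero_prod_def)
  have chi: "chi t g z \<noteq> 1"
    using t(2)[of "- snd g"] t(2)[of "fst g"] False
    by (auto simp: chi_def z_def htp_letter_def zero_prod_def prod_eq_iff)
  have "linop (\<lambda>g ws. pscale k (hz z g ws)) f = pscale k (linop (hz z) f)" for k :: 'k and f
    by (simp add: linop_def lin_ext_def split_def pscale.scale_sum_right mult.commute)
  moreover have "linop (htp t) (bd t g ws) = linop (\<lambda>g ws. pscale (1 / (1 - chi t g z)) (hz z g ws)) (bd t g ws)"
    for k
    by (rule linop_degree[of _ g]) (auto simp: htp_def bd_degree False z_def)
  moreover have "linop (\<lambda>g ws. pscale (1 / (1 - chi t g z)) (hz z g ws)) (bd t g ws) =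
      linop (\<lambda>h ws. pscale (1 / (1 - chi t g z)) (hz z h ws)) (bd t g ws)"
    by (rule linop_degree[of _ g]) (auto simp: bd_degree)
  ultimately have "linop (bd t) (htp t g ws) + linop (htp t) (bd t g ws) =
      pscale (1 / (1 - chi t g z)) (linop (bd t) (hz z g ws) + linop (hz z) (bd t g ws))"
    using False by (simp add: htp_def z_def linop_linear pscale.scale_right_distrib)
  also have "\<dots> = cell g ws" using chi by (simp add: hz_homotopy[OF ws z])
  also have "to_coords g ws = (0 :: nat \<Rightarrow> 'k)"
    using False by (induction g ws rule: to_coords.induct) auto
  then have "(cell g ws :: cell_index \<Rightarrow> 'k) = cell g ws - from_coords (length ws) (to_coords g ws)" by simp
  finally show ?thesis .
qed

lemma htp_homotopy:
  assumes t: "t \<noteq> 0" "\<And>k. k \<noteq> 0 \<Longrightarrow> t powi k \<noteq> 1" and "f \<in> nchains n"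
  shows "linop (bd t) (linop (htp t) f) + linop (htp t) (linop (bd t) f) =
     f - from_coords n (linop to_coords f)"
  using assms(3)
proof (induction f rule: nchains_induct)
  case (add c g ws f)
  have fs: "fin_supp (linop (bd t) f)" "fin_supp (linop (htp t) f)" "fin_supp (linop to_coords f)"
    "fin_supp (htp t g ws)"
    by (simp_all add: linop_def split_def nchains_fin_supp[OF nchains_htp])
  have "linop (bd t) (linop (htp t) (pscale c (cell g ws) + f)) + linop (htp t) (linop (bd t) (pscale c (cell g ws) + f))
      = pscale c (linop (bd t) (htp t g ws) + linop (htp t) (bd t g ws))
        + (linop (bd t) (linop (htp t) f) + linop (htp t) (linop (bd t) f))"
    using add.hyps(2) fs by (simp add: linop_add linop_pscale nchains_fin_supp pscale.scale_right_distrib)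
  also have "\<dots> = pscale c (cell g ws - from_coords n (to_coords g ws)) + (f - from_coords n (linop to_coords f))"
    using add.IH htp_homotopy_cell[OF t add.hyps(3), of g] add.hyps(1) by simp
  also have "\<dots> = (pscale c (cell g ws) + f) - from_coords n (linop to_coords (pscale c (cell g ws) + f))"
    using add.hyps(2)
    by (simp add: linop_add linop_pscale nchains_fin_supp from_coords_add from_coords_pscale
        pscale.scale_right_diff_distrib)
  finally show ?case .
qed simp

section \<open>The valuation of \<open>\<lambda>\<^sup>k - 1\<close>\<close>

text \<open>Modulo \<open>x - 1\<close> each of the \<open>k\<close> powers is 1.\<close>

lemma geometric_sum_mod: "\<exists>z. (\<Sum>i<k. x ^ i) = of_nat k + (x - 1) * (z :: 'a::comm_ring_1)"
proof (induction k)
  case (Suc k)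
  then obtain z where "(\<Sum>i<k. x ^ i) = of_nat k + (x - 1) * z" ..
  moreover have "x ^ k = 1 + (x - 1) * (\<Sum>i<k. x ^ i)"
    using power_diff_1_eq[of x k] by (simp add: algebra_simps)
  ultimately have "(\<Sum>i<Suc k. x ^ i) = (of_nat k + (x - 1) * z) + (1 + (x - 1) * (\<Sum>i<k. x ^ i))"
    unfolding sum.lessThan_Suc by simp
  also have "\<dots> = of_nat (Suc k) + (x - 1) * (z + (\<Sum>i<k. x ^ i))"
    by (simp add: algebra_simps)
  finally have "(\<Sum>i<Suc k. x ^ i) = of_nat (Suc k) + (x - 1) * (z + (\<Sum>i<k. x ^ i))" .
  then show ?case ..
qed (auto intro: exI[of _ 0])

lemma unit_add_unif:
  assumes "(u::'v::dvr) dvd 1" "unif dvd y"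
  shows "u + y dvd 1"
  using assms unfolding unit_iff_not_unif_dvd by (metis dvd_add_left_iff)

text \<open>If all positive integers are units, \<open>p = 2\<close> and \<open>e = 0\<close> serve.
  Otherwise \<open>p\<close> is the least positive nonunit, the residue characteristic, and
  \<open>e\<close> is its valuation, which is finite because the ring has characteristic 0.\<close>

lemma ex_residue_exponent:
  assumes "CHAR('v::dvr) = 0"
  shows "\<exists>p e u. p \<ge> 2 \<and> (u::'v) dvd 1 \<and> of_nat p = u * unif ^ e \<and>
           (\<forall>k. \<not> p dvd k \<longrightarrow> (of_nat k :: 'v) dvd 1)"
proof (cases "\<forall>k>0. (of_nat k :: 'v) dvd 1")
  case True
  then have "(2::nat) \<ge> 2 \<and> (of_nat 2 :: 'v) dvd 1 \<and> of_nat 2 = of_nat 2 * (unif :: 'v) ^ 0 \<and>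
      (\<forall>k. \<not> 2 dvd k \<longrightarrow> (of_nat k :: 'v) dvd 1)"
    by (simp del: of_nat_numeral) (metis dvd_0_right gr0I)
  then show ?thesis by blast
next
  case False
  define p where "p = (LEAST k. k > 0 \<and> \<not> (of_nat k :: 'v) dvd 1)"
  have p: "p > 0" "\<not> (of_nat p :: 'v) dvd 1"
    using LeastI_ex[of "\<lambda>k. k > 0 \<and> \<not> (of_nat k :: 'v) dvd 1"] False unfolding p_def by blast+
  have least: "(of_nat k :: 'v) dvd 1" if "0 < k" "k < p" for k
    using not_less_Least[of k "\<lambda>k. k > 0 \<and> \<not> (of_nat k :: 'v) dvd 1"] that unfolding p_def by blast
  have "p \<noteq> 1" using p by auto
  then have "p \<ge> 2" using p by linarith
  moreover have "(of_nat p :: 'v) \<noteq> 0"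
    using p(1) assms by (simp add: of_nat_eq_0_iff_char_dvd)
  then obtain u e where "(u :: 'v) dvd 1" "of_nat p = u * unif ^ e" using unif_factor by blast
  moreover have "(of_nat k :: 'v) dvd 1" if "\<not> p dvd k" for k
  proof -
    have "0 < k mod p" "k mod p < p" using that p(1) by (auto simp: dvd_eq_mod_eq_0)
    then have "(of_nat (k mod p) :: 'v) dvd 1" by (rule least)
    moreover have "unif dvd (of_nat (p * (k div p)) :: 'v)"
      using p(2) by (simp add: unit_iff_not_unif_dvd)
    ultimately have "(of_nat (k mod p) + of_nat (p * (k div p)) :: 'v) dvd 1" by (rule unit_add_unif)
    then show ?thesis by (metis mod_mult_div_eq of_nat_add)
  qed
  ultimately show ?thesis by blast
qed

lemma unit_mult_dvd_iff: "(u::'a::comm_monoid_mult) dvd 1 \<Longrightarrow> a * u dvd b \<longleftrightarrow> a dvd b"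
  using mult_dvd_mono[OF dvd_refl, of u 1 a] by (auto intro: dvd_trans dvd_mult_left)

text \<open>Lifting the exponent. For \<open>k\<close> not divisible by \<open>p\<close> the
  quotient of \<open>x ^ k - 1\<close> by \<open>x - 1\<close> is a unit; passing from
  \<open>x\<close> to \<open>x ^ p\<close> costs the factor \<open>unif ^ e\<close> and happens
  \<open>s\<close> times, with \<open>2 ^ s \<le> p ^ s \<le> k\<close>.\<close>

lemma power_minus_1_dvd:
  fixes x u :: "'v::dvr"
  assumes p: "p \<ge> 2" "u dvd 1" "of_nat p = u * unif ^ e" "\<And>k. \<not> p dvd k \<Longrightarrow> (of_nat k :: 'v) dvd 1"
    and "unif ^ Suc e dvd x - 1" "k > 0"
  shows "\<exists>s. 2 ^ s \<le> k \<and> x ^ k - 1 dvd (x - 1) * unif ^ (e * s)"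
  using assms(5,6)
proof (induction k arbitrary: x rule: less_induct)
  case (less k)
  have unif: "unif dvd (x - 1) * z" for z
    using less.prems(1) by (metis dvd_mult2 dvd_mult_left power_Suc)
  show ?case
  proof (cases "p dvd k")
    case False
    obtain z where z: "(\<Sum>i<k. x ^ i) = of_nat k + (x - 1) * z" using geometric_sum_mod by blast
    have "(\<Sum>i<k. x ^ i) dvd 1" unfolding z using p(4)[OF False] unif by (rule unit_add_unif)
    then have "x ^ k - 1 dvd x - 1" unfolding power_diff_1_eq by (simp add: unit_mult_dvd_iff)
    then show ?thesis using less.prems(2) by (intro exI[of _ 0]) auto
  next
    case True
    then obtain j where k: "k = p * j" by (auto elim: dvdE)
    obtain z where z: "(\<Sum>i<p. x ^ i) = of_nat p + (x - 1) * z" using geometric_sum_mod by blast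
    obtain w where w: "x - 1 = unif ^ Suc e * w" using less.prems(1) by (auto elim: dvdE)
    \<comment> \<open>As \<open>x - 1\<close> is divisible by \<open>unif ^ Suc e\<close>, the term
      \<open>of_nat p\<close> dominates and the sum has valuation exactly \<open>e\<close>.\<close>
    have "(\<Sum>i<p. x ^ i) = (u + unif * (w * z)) * unif ^ e"
      unfolding z p(3) w by (simp add: algebra_simps)
    moreover have unit: "u + unif * (w * z) dvd 1" using p(2) by (rule unit_add_unif) simp
    ultimately have x: "x ^ p - 1 = (x - 1) * unif ^ e * (u + unif * (w * z))"
      unfolding power_diff_1_eq by (simp add: mult_ac)
    have "unif ^ Suc e dvd x ^ p - 1" unfolding x
      by (intro dvd_mult2 less.prems(1))
    moreover have "j > 0" using less.prems(2) k by (cases j) auto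
    moreover from this have "j < k" using mult_le_mono1[OF p(1), of j] unfolding k by linarith
    ultimately obtain s where s: "2 ^ s \<le> j" "(x ^ p) ^ j - 1 dvd (x ^ p - 1) * unif ^ (e * s)"
      using less.IH by blast
    have "(x ^ p - 1) * unif ^ (e * s) dvd (x - 1) * unif ^ e * unif ^ (e * s)"
      unfolding x by (rule mult_dvd_mono) (simp_all only: unit_mult_dvd_iff[OF unit] dvd_refl)
    with s(2) have "x ^ k - 1 dvd (x - 1) * unif ^ (e * Suc s)"
      unfolding k power_mult by (auto simp: power_add mult_ac intro: dvd_trans)
    moreover have "2 * 2 ^ s \<le> p * j" using p(1) s(1) by (intro mult_le_mono)
    ultimately show ?thesis unfolding k by (intro exI[of _ "Suc s"]) auto
  qed
qed

text \<open>If some \<open>l ^ d\<close> is close enough to 1, lifting the exponent applies to its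
  powers; otherwise no \<open>l ^ k - 1\<close> has valuation above \<open>e\<close>. In positive
  characteristic these elements are units by hypothesis.\<close>

lemma power_minus_1_loss:
  fixes l :: "'v::dvr"
  assumes "\<forall>k>0. l ^ k \<noteq> 1"
    and "CHAR('v) \<noteq> 0 \<longrightarrow> (\<forall>k>0. val (l ^ k - 1) = 0)"
  shows "\<exists>c e. \<forall>k>0. l ^ k - 1 dvd unif ^ (c + e * floor_log k)"
proof (cases "CHAR('v) = 0")
  case False
  with assms(2) show ?thesis by (intro exI[of _ 0]) (auto simp: val_eq_0_iff)
next
  case True
  from ex_residue_exponent[OF this] obtain p e and u :: 'v
    where p: "p \<ge> 2" "u dvd 1" "of_nat p = u * unif ^ e" "\<And>k. \<not> p dvd k \<Longrightarrow> (of_nat k :: 'v) dvd 1"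
    by blast
  have factor: "\<exists>w c. w dvd 1 \<and> l ^ k - 1 = w * unif ^ c" if "k > 0" for k
    using assms(1) that by (intro unif_factor) auto
  show ?thesis
  proof (cases "\<exists>d>0. unif ^ Suc e dvd l ^ d - 1")
    case True
    then obtain d where d: "d > 0" "unif ^ Suc e dvd l ^ d - 1" by blast
    then obtain w c where w: "w dvd 1" "l ^ d - 1 = w * unif ^ c" using factor by blast
    have "l ^ k - 1 dvd unif ^ (c + e * floor_log k)" if k: "k > 0" for k
    proof -
      obtain s where s: "2 ^ s \<le> k" "(l ^ d) ^ k - 1 dvd (l ^ d - 1) * unif ^ (e * s)"
        using power_minus_1_dvd[OF p d(2) k] by blast
      have "s \<le> floor_log k" using floor_log_mono[THEN monoD, OF s(1)] by simp
      \<comment> \<open>Enlarging \<open>k\<close> to the multiple \<open>d * k\<close> gives an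
        estimate for every \<open>k\<close>, also when \<open>d\<close> does not divide it.\<close>
      have "l ^ k - 1 dvd (l ^ d) ^ k - 1"
        using power_diff_1_eq[of "l ^ k" d] by (metis dvd_triv_left mult.commute power_mult)
      also have "\<dots> dvd (l ^ d - 1) * unif ^ (e * s)" by (rule s(2))
      also have "\<dots> dvd unif ^ c * unif ^ (e * floor_log k)"
        unfolding w(2) using w(1) \<open>s \<le> floor_log k\<close>
        by (intro mult_dvd_mono) (simp_all add: le_imp_power_dvd mult.commute[of w] unit_mult_dvd_iff)
      finally show ?thesis by (simp add: power_add)
    qed
    then show ?thesis by blast
  next
    case False
    have "l ^ k - 1 dvd unif ^ e" if k: "k > 0" for k
    proof -
      from factor[OF k] obtain w c where w: "w dvd 1" "l ^ k - 1 = w * unif ^ c" by blast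
      with False k have "c \<le> e" by (metis dvd_triv_right dvd_trans le_imp_power_dvd not_less_eq_eq)
      then show ?thesis unfolding w(2) using w(1)
        by (simp add: le_imp_power_dvd mult.commute[of w] unit_mult_dvd_iff)
    qed
    then show ?thesis by (intro exI[of _ e] exI[of _ 0]) auto
  qed
qed

text \<open>The summand 1 covers \<open>s = 3\<close>.\<close>

lemma square_le_power2: "s * s \<le> 2 ^ s + (1::nat)"
proof -
  have "s * s \<le> 2 ^ s" if "s \<ge> 4" for s :: nat
    using that
  proof (induction s rule: dec_induct)
    case (step n)
    have "Suc n * Suc n \<le> 2 * (n * n)"
      using step(1) mult_le_mono1[OF step(1), of n] unfolding mult_Suc mult_Suc_right by linarith
    with step show ?case by simp
  qed simp
  moreover have "s * s \<le> 2 ^ s + 1" if "s < 4"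
  proof -
    from that have "s \<in> {0, 1, 2, 3}" by auto
    then show ?thesis by auto
  qed
  ultimately show ?thesis by (meson le_add1 le_trans not_le)
qed

text \<open>For \<open>m > 0\<close>, \<open>q = Suc M\<close> and \<open>s = floor_log m\<close>,
  the product of \<open>s\<close> and \<open>e * q\<close> is at most the larger of their squares,
  and \<open>s * s \<le> 2 ^ s + 1 \<le> m + 1\<close>.\<close>

lemma floor_log_sublinear: "\<exists>c. \<forall>m. c0 + e * floor_log m \<le> m div Suc M + c"
proof -
  define q where "q = Suc M"
  define b where "b = 2 + (e * q) * (e * q)"
  have "e * floor_log m \<le> m div q + b" for m
  proof (cases "m = 0")
    case False
    define s where "s = floor_log m"
    have "s * (e * q) \<le> s * s + (e * q) * (e * q)"
      by (cases "s \<le> e * q") (auto intro: trans_le_add1 trans_le_add2 mult_le_mono)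
    also have "\<dots> \<le> 2 ^ s + 1 + (e * q) * (e * q)" using square_le_power2[of s] by simp
    also have "2 ^ s \<le> m" unfolding s_def using False by (simp add: floor_log_exp2_le)
    finally have "(e * s) * q \<le> m + b" by (simp add: b_def mult_ac)
    then have "((e * s) * q) div q \<le> (m + b * q) div q"
      by (intro div_le_mono) (simp add: q_def order_trans)
    also have "\<dots> = m div q + b" by (subst div_mult_self1) (simp_all add: q_def)
    finally show ?thesis unfolding s_def[symmetric] by (subst (asm) nonzero_mult_div_cancel_right) (auto simp: q_def)
  qed simp
  then have "\<forall>m. c0 + e * floor_log m \<le> m div Suc M + (c0 + b)"
    unfolding q_def by (metis add.left_commute nat_add_left_cancel_le)
  then show ?thesis by blast
qed

section \<open>Lattices of chains\<close>

definition len :: "int \<times> int \<Rightarrow> nat" where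
  "len g = nat (\<bar>fst g\<bar> + \<bar>snd g\<bar>)"

text \<open>Measured by the total degree in place of the zeroth letter; this agrees with the length
  of the full word up to a factor 2.\<close>

definition cell_len :: "cell_index \<Rightarrow> nat" where
  "cell_len i = len (fst i) + sum_list (map len (snd i))"

text \<open>Infinite supports are allowed, because the coefficients of a word in the dagger algebra
  need not be finitely supported.\<close>

definition chain_lat :: "bool \<Rightarrow> nat \<Rightarrow> (cell_index \<Rightarrow> 'v::dvr fract) set" where
  "chain_lat d N = {f. \<forall>i. f i \<in> growth d N (cell_len i)}"

text \<open>Meant for the image of a single cell under an operator: \<open>m\<close> limits the
  length of words in its support, \<open>c\<close> the denominators of its coefficients.\<close>

definition cell_box :: "nat \<Rightarrow> nat \<Rightarrow> (cell_index \<Rightarrow> 'v::dvr fract) set" where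
  "cell_box m c = {f. \<forall>i. f i \<noteq> 0 \<longrightarrow> cell_len i \<le> m \<and> f i \<in> frac_ideal (- int c)}"

lemma len_add: "len (g + h) \<le> len g + len h"
  and len_uminus [simp]: "len (- g) = len g"
  and len_0 [simp]: "len 0 = 0"
  by (auto simp: len_def)

lemma cell_boxI:
  assumes "\<And>i. f i \<noteq> 0 \<Longrightarrow> cell_len i \<le> m" "\<And>i. f i \<in> frac_ideal (- int c)"
  shows "f \<in> cell_box m c"
  using assms by (simp add: cell_box_def)

lemma cell_boxD:
  "f \<in> cell_box m c \<Longrightarrow> f i \<noteq> 0 \<Longrightarrow> cell_len i \<le> m" "f \<in> cell_box m c \<Longrightarrow> f i \<in> frac_ideal (- int c)"
  unfolding cell_box_def by (safe, metis, metis frac_ideal_0)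

lemma cell_box_0 [simp]: "0 \<in> cell_box m c"
  by (simp add: cell_box_def fun_apply)

lemma cell_box_mono: "f \<in> cell_box m c \<Longrightarrow> m \<le> m' \<Longrightarrow> c \<le> c' \<Longrightarrow> f \<in> cell_box m' c'"
  by (rule cell_boxI) (auto dest: cell_boxD(1) intro: frac_ideal_mono[OF _ cell_boxD(2)])

lemma cell_box_add: "f \<in> cell_box m c \<Longrightarrow> h \<in> cell_box m c \<Longrightarrow> f + h \<in> cell_box m c"
  by (rule cell_boxI)
    (auto simp: fun_apply intro: frac_ideal_add cell_boxD(2), metis add_0 cell_boxD(1))

lemma cell_box_pscale: "a \<in> frac_ideal (- int b) \<Longrightarrow> f \<in> cell_box m c \<Longrightarrow> pscale a f \<in> cell_box m (b + c)"
  by (rule cell_boxI)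
    (auto simp: fun_apply dest: cell_boxD(1) intro: frac_ideal_mult[of a "- int b" _ "- int c", simplified] cell_boxD(2))

lemma cell_box_uminus: "f \<in> cell_box m c \<Longrightarrow> - f \<in> cell_box m c"
  using cell_box_pscale[of "-1" 0 f m c] frac_ideal_of_int[of "-1"] by simp

lemma cell_box_diff: "f \<in> cell_box m c \<Longrightarrow> h \<in> cell_box m c \<Longrightarrow> f - h \<in> cell_box m c"
  using cell_box_add[of f m c "- h"] by (simp add: cell_box_uminus)

lemma sum_induct_set:
  "(\<And>i. i \<in> I \<Longrightarrow> f i \<in> S) \<Longrightarrow> 0 \<in> S \<Longrightarrow> (\<And>x y. x \<in> S \<Longrightarrow> y \<in> S \<Longrightarrow> x + y \<in> S) \<Longrightarrow> sum f I \<in> S"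
  by (induction I rule: infinite_finite_induct) auto

lemma cell_box_isum: "(\<And>j. \<bar>j\<bar> \<le> \<bar>a\<bar> \<Longrightarrow> f j \<in> cell_box m c) \<Longrightarrow> isum f a \<in> cell_box m c"
  by (rule isum_induct[where P = "\<lambda>f. f \<in> cell_box m c"]) (auto intro: cell_box_add cell_box_uminus)

lemma cell_box_cell: "cell_len (g, ws) \<le> m \<Longrightarrow> cell g ws \<in> cell_box m c"
  by (rule cell_boxI)
    (auto simp: cell_def delta_def fun_apply intro: frac_ideal_mono[OF _ frac_ideal_1] split: if_splits)

lemma cell_box_prepend: "f \<in> cell_box m c \<Longrightarrow> prepend a f \<in> cell_box (len a + m) c"
proof (rule cell_boxI)
  fix i
  assume f: "f \<in> cell_box m c" and "prepend a f i \<noteq> 0"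
  then obtain g ws where "i = (g, a # ws)" "f (g, ws) \<noteq> 0"
    by (cases i) (auto simp: prepend_def neq_Nil_conv split: if_splits)
  with cell_boxD(1)[OF f, of "(g, ws)"] show "cell_len i \<le> len a + m" by (simp add: cell_len_def)
qed (auto simp: prepend_def split: prod.splits dest: cell_boxD(2))

lemma cell_len_Cons: "cell_len (g, a # ws) = len a + cell_len (g, ws)"
  by (simp add: cell_len_def)

lemma unit_powi_in_frac_ideal:
  assumes "l dvd 1"
  shows "to_fract l powi k \<in> frac_ideal 0"
proof -
  obtain w where w: "inverse (to_fract l) = to_fract w" using unit_inverse_to_fract[OF assms] by blast
  have "to_fract l powi k = to_fract (if k \<ge> 0 then l ^ nat k else w ^ nat (- k))"
    by (simp add: power_int_def to_fract_power w)
  then show ?thesis by (metis to_fract_in_frac_ideal)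
qed

lemma chi_in_frac_ideal: "l dvd 1 \<Longrightarrow> chi (to_fract l) g h \<in> frac_ideal 0"
  by (simp add: chi_def unit_powi_in_frac_ideal)

lemma cell_box_bdt:
  assumes "l dvd 1"
  shows "bdt (to_fract l) g ws \<in> cell_box (cell_len (g, ws)) 0"
proof (induction ws rule: induct_list012)
  case (2 a)
  have "pscale (chi (to_fract l) g a) (cell g []) \<in> cell_box (cell_len (g, [a])) (0 + 0)"
    by (rule cell_box_pscale) (auto simp: chi_in_frac_ideal[OF assms] cell_len_def intro!: cell_box_cell)
  then show ?case by (simp add: cell_box_uminus)
next
  case (3 a b w)
  have "cell g ((a + b) # w) \<in> cell_box (cell_len (g, a # b # w)) 0"
    using len_add[of a b] by (intro cell_box_cell) (simp add: cell_len_Cons)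
  moreover have "prepend a (bdt (to_fract l) g (b # w)) \<in> cell_box (cell_len (g, a # b # w)) 0"
    using cell_box_prepend[OF 3(2), of a] by (simp add: cell_len_Cons)
  ultimately show ?case by (auto intro: cell_box_diff cell_box_uminus)
qed simp

lemma cell_box_bd:
  assumes "l dvd 1"
  shows "bd (to_fract l) g ws \<in> cell_box (cell_len (g, ws)) 0"
  using cell_box_bdt[OF assms, of g ws]
  by (cases ws) (auto simp: bd_def cell_len_Cons intro!: cell_box_add cell_box_cell)

lemma cell_box_hz: "len z \<le> 1 \<Longrightarrow> (hz z g ws :: cell_index \<Rightarrow> 'v::dvr fract) \<in> cell_box (cell_len (g, ws) + 1) 0"
proof (induction ws)
  case Nil
  then show ?case by (auto simp: cell_len_Cons intro!: cell_box_cell)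
next
  case (Cons a w)
  have "(cell g (z # a # w) :: cell_index \<Rightarrow> 'v fract) \<in> cell_box (cell_len (g, a # w) + 1) 0"
    using Cons.prems by (intro cell_box_cell) (simp add: cell_len_Cons)
  moreover have "(prepend a (hz z g w) :: cell_index \<Rightarrow> 'v fract) \<in> cell_box (cell_len (g, a # w) + 1) 0"
    using cell_box_prepend[OF Cons.IH[OF Cons.prems], of a] by (simp add: cell_len_Cons)
  ultimately show ?case by (simp add: cell_box_diff)
qed

lemma cell_box_edge: "f \<in> cell_box m c \<Longrightarrow> len e + len p + m \<le> m' \<Longrightarrow> edge e p f \<in> cell_box m' c"
  unfolding edge_def
  by (rule cell_box_mono[OF cell_box_prepend[OF cell_box_prepend]]) auto

lemma cell_box_path_htp: "path_htp g ws \<in> cell_box (cell_len (g, ws) + 1) 0"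
proof (cases ws)
  case (Cons a w)
  have "path 0 a (cell g w) \<in> cell_box (cell_len (g, ws) + 1) 0"
    unfolding path_def Cons cell_len_Cons
    by (intro cell_box_add cell_box_isum cell_box_edge[OF cell_box_cell[OF order_refl]])
      (auto simp: len_def)
  then show ?thesis by (simp add: Cons)
qed simp

text \<open>The corner of each unit square has length at most \<open>len a + len b\<close>, so it
  replaces \<open>a\<close> and \<open>b\<close> at no cost; the two unit letters of the square
  account for the 2.\<close>

lemma cell_box_rect_htp: "rect_htp g ws \<in> cell_box (cell_len (g, ws) + 2) 0"
proof (induction g ws rule: rect_htp.induct)
  case (1 g a b w)
  have "square (fst b + j, i) (cell g w) \<in> cell_box (cell_len (g, a # b # w) + 2) 0"
    if "\<bar>i\<bar> \<le> \<bar>snd b\<bar>" "\<bar>j\<bar> \<le> \<bar>fst a\<bar>" for i j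
  proof -
    have "\<bar>fst b + j\<bar> \<le> \<bar>fst b\<bar> + \<bar>fst a\<bar>" using that by linarith
    then have "len (fst b + j, i) \<le> len a + len b"
      using that unfolding len_def by (subst nat_add_distrib[symmetric]) (simp, simp, rule nat_mono, simp, linarith)
    then have *: "edge e (fst b + j, i) (cell g w) \<in> cell_box (cell_len (g, a # b # w) + 1) 0" if "len e = 1" for e
      using that by (intro cell_box_edge[OF cell_box_cell[OF order_refl]]) (simp add: cell_len_Cons)
    have e: "len e\<^sub>1 = 1" "len e\<^sub>2 = 1" by (simp_all add: len_def)
    show ?thesis unfolding square_def
      using cell_box_prepend[OF *[OF e(2)], of e\<^sub>1] cell_box_prepend[OF *[OF e(1)], of e\<^sub>2] e
      by (intro cell_box_diff) simp_all
  qed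
  then show ?case unfolding rect_htp.simps rect_def
    by (intro cell_box_uminus cell_box_isum) auto
qed simp_all

text \<open>A negative exponent is reduced to a positive one by multiplying numerator and
  denominator with a power of \<open>l\<close>, which is a unit.\<close>

lemma inverse_power_minus_1:
  fixes l :: "'v::dvr"
  assumes l: "l dvd 1" and loss: "\<And>k. k > 0 \<Longrightarrow> l ^ k - 1 dvd unif ^ (c + e * floor_log k)"
    and "k \<noteq> 0" "nat \<bar>k\<bar> \<le> m"
  shows "1 / (1 - to_fract l powi k) \<in> frac_ideal (- int (c + e * floor_log m))"
proof -
  have *: "inverse (to_fract (l ^ j - 1)) \<in> frac_ideal (- int (c + e * floor_log m))" if "j > 0" "j \<le> m" for j
  proof -
    have "floor_log j \<le> floor_log m" using floor_log_mono that(2) by (rule monoD)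
    then have "l ^ j - 1 dvd unif ^ (c + e * floor_log m)"
      by (intro dvd_trans[OF loss[OF that(1)]] le_imp_power_dvd) simp
    then obtain w where w: "unif ^ (c + e * floor_log m) = (l ^ j - 1) * w" by (auto elim: dvdE)
    then have nz: "l ^ j - 1 \<noteq> 0" by (metis mult_zero_left power_not_zero unif_nonzero)
    have "inverse (to_fract (l ^ j - 1)) = to_fract w * unif_fract powi (- int (c + e * floor_log m))"
    proof -
      define n where "n = c + e * floor_log m"
      have "to_fract (unif ^ (c + e * floor_log m)) = to_fract (l ^ j - 1) * to_fract w"
        unfolding w by (rule to_fract_mult)
      moreover have "w \<noteq> 0" using w by auto
      moreover have "to_fract (l ^ j - 1) \<noteq> 0" using nz by (simp only: to_fract_eq_0_iff not_False_eq_True)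
      ultimately show ?thesis unfolding n_def[symmetric]
        by (simp add: power_int_minus to_fract_power field_simps del: to_fract_diff)
    qed
    then show ?thesis unfolding frac_ideal_def by blast
  qed
  have l0: "to_fract l \<noteq> 0" using l by auto
  show ?thesis
  proof (cases "k > 0")
    case True
    have "1 / (1 - to_fract l powi k) = - inverse (to_fract (l ^ nat k - 1))"
      using True by (simp add: power_int_def to_fract_power divide_inverse flip: inverse_minus_eq)
    then show ?thesis using *[of "nat k"] True assms(4) by simp
  next
    case False
    define j where "j = nat (- k)"
    have j: "k = - int j" "j > 0" "j \<le> m" using False assms(3,4) by (auto simp: j_def)
    have "1 / (1 - to_fract l powi k) = to_fract (l ^ j) * inverse (to_fract (l ^ j - 1))"
    proof -
      have "1 - to_fract l powi k = (to_fract l ^ j - 1) / to_fract l ^ j"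
        using l0 by (simp add: j(1) power_int_minus field_simps)
      then show ?thesis by (simp add: to_fract_power divide_inverse)
    qed
    then show ?thesis using frac_ideal_scale[OF to_fract_in_frac_ideal *[OF j(2,3)]] by simp
  qed
qed

text \<open>The exponent of the character is a coordinate of \<open>g\<close> up to sign, hence
  bounded by the length of the cell; this converts a loss in terms of the exponent into one in terms
  of the length.\<close>

lemma cell_box_htp:
  assumes l: "l dvd 1" and loss: "\<And>k. k > 0 \<Longrightarrow> l ^ k - 1 dvd unif ^ (c + e * floor_log k)"
  shows "htp (to_fract l) g ws \<in> cell_box (cell_len (g, ws) + 2) (c + e * floor_log (cell_len (g, ws)))"
proof (cases "g = 0")
  case True
  have "path_htp g ws + rect_htp g ws \<in> cell_box (cell_len (g, ws) + 2) 0"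
    by (intro cell_box_add cell_box_mono[OF cell_box_path_htp] cell_box_rect_htp) auto
  then show ?thesis using True
    by (simp add: htp_def del: minus_add_distrib) (intro cell_box_uminus, erule cell_box_mono, auto)
next
  case False
  have z: "len (htp_letter g) \<le> 1" by (simp add: htp_letter_def len_def)
  define k where "k = (if snd g \<noteq> 0 then - snd g else fst g)"
  have "chi (to_fract l) g (htp_letter g) = to_fract l powi k"
    by (simp add: chi_def htp_letter_def k_def)
  moreover have "k \<noteq> 0" "nat \<bar>k\<bar> \<le> cell_len (g, ws)"
    using False by (auto simp: k_def cell_len_def len_def prod_eq_iff)
  ultimately have "1 / (1 - chi (to_fract l) g (htp_letter g))
      \<in> frac_ideal (- int (c + e * floor_log (cell_len (g, ws))))"
    using inverse_power_minus_1[OF l loss] by simp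
  from cell_box_pscale[OF this cell_box_hz[OF z]]
  have "htp (to_fract l) g ws \<in> cell_box (cell_len (g, ws) + 1) (c + e * floor_log (cell_len (g, ws)) + 0)"
    using False by (simp add: htp_def)
  then show ?thesis by (rule cell_box_mono) auto
qed

text \<open>The loss is absorbed first, at the length of the source cell, and then the shift of the
  length by 2.\<close>

lemma linop_chain_lat:
  fixes \<phi> :: "int \<times> int \<Rightarrow> (int \<times> int) list \<Rightarrow> cell_index \<Rightarrow> 'v::dvr fract"
  assumes box: "\<And>g ws. \<phi> g ws \<in> cell_box (cell_len (g, ws) + 2) (loss (cell_len (g, ws)))"
    and loss: "\<And>M. \<exists>c. \<forall>m. loss m \<le> m div Suc M + (c::nat)"
  shows "\<exists>N'. \<forall>f\<in>chain_lat d N. linop \<phi> f \<in> chain_lat d N'"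
proof -
  obtain N1 where N1: "\<And>m (x::'v fract) u. x \<in> growth d N m \<Longrightarrow> u \<in> frac_ideal (- int (loss m)) \<Longrightarrow> u * x \<in> growth d N1 m"
    using growth_loss[of loss d N, OF loss] by blast
  obtain N' where N': "\<And>m m' (x::'v fract). m \<le> 2 * m' + 2 \<Longrightarrow> x \<in> growth d N1 m' \<Longrightarrow> x \<in> growth d N' m"
    using growth_control[of 2 d N1] by blast
  have "linop \<phi> f \<in> chain_lat d N'" if f: "f \<in> chain_lat d N" for f
    unfolding chain_lat_def
  proof safe
    fix i
    have "f (g, ws) * \<phi> g ws i \<in> growth d N' (cell_len i)" for g ws
    proof (cases "\<phi> g ws i = 0")
      case False
      have "\<phi> g ws i * f (g, ws) \<in> growth d N1 (cell_len (g, ws))"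
        by (rule N1[OF _ cell_boxD(2)[OF box]]) (use f in \<open>unfold chain_lat_def, blast\<close>)
      then
      have "\<phi> g ws i * f (g, ws) \<in> growth d N' (cell_len i)"
        using cell_boxD(1)[OF box False] by (intro N'[of _ "cell_len (g, ws)"]) auto
      then show ?thesis by (simp only: mult.commute)
    qed simp
    then show "linop \<phi> f i \<in> growth d N' (cell_len i)"
      unfolding linop_def lin_ext_apply by (intro growth_sum) auto
  qed
  then show ?thesis by blast
qed

lemma linop_bd_chain_lat:
  assumes "l dvd 1"
  shows "\<exists>N'. \<forall>f\<in>chain_lat d N. linop (bd (to_fract l)) f \<in> chain_lat d N'"
  by (rule linop_chain_lat[of _ "\<lambda>_. 0"]) (auto intro!: cell_box_mono[OF cell_box_bd[OF assms]])

lemma linop_htp_chain_lat: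
  fixes l :: "'v::dvr"
  assumes "l dvd 1" "\<forall>k>0. l ^ k \<noteq> 1"
    and "CHAR('v) \<noteq> 0 \<longrightarrow> (\<forall>k>0. val (l ^ k - 1) = 0)"
  shows "\<exists>N'. \<forall>f\<in>chain_lat d N. linop (htp (to_fract l)) f \<in> chain_lat d N'"
proof -
  from power_minus_1_loss[OF assms(2,3)] obtain c e
    where loss: "\<And>k. k > 0 \<Longrightarrow> l ^ k - 1 dvd unif ^ (c + e * floor_log k)" by blast
  show ?thesis
    using cell_box_htp[OF assms(1) loss] floor_log_sublinear by (rule linop_chain_lat)
qed

text \<open>Coordinates of cells are integers, so no denominators beyond those of \<open>f\<close>
  arise.\<close>

lemma linop_to_coords_frac_ideal:
  assumes "f \<in> chain_lat d N"
  shows "linop to_coords f k \<in> frac_ideal (- int N)"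
proof -
  have "to_coords g ws k \<in> frac_ideal 0" for g ws
    by (induction g ws rule: to_coords.induct)
      (auto simp: fun_apply delta_def intro!: frac_ideal_of_int frac_ideal_scale[OF frac_ideal_of_int]
        simp flip: of_int_mult)
  moreover have "f (g, ws) \<in> frac_ideal (- int N)" for g ws
    by (rule growth_frac_ideal[of _ d N "cell_len (g, ws)"]) (use assms in \<open>unfold chain_lat_def, blast\<close>)
  ultimately have "f (g, ws) * to_coords g ws k \<in> frac_ideal (- int N)" for g ws
    by (subst mult.commute) (rule frac_ideal_scale)
  then show ?thesis unfolding linop_def lin_ext_apply by (intro frac_ideal_sum) auto
qed

text \<open>The representative cycles live on cells of length at most 2, where the growth condition
  with constant \<open>N + 2\<close> only bounds the denominator.\<close>

lemma from_coords_chain_lat: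
  assumes "\<And>k. v k \<in> frac_ideal (- int N)"
  shows "from_coords n v \<in> chain_lat d (N + 2)"
proof -
  have cell: "cell 0 ws \<in> cell_box 2 0" if "cell_len (0, ws) \<le> 2" for ws
    using that by (rule cell_box_cell)
  have "repr_cycle n k \<in> cell_box 2 0" for k
    unfolding repr_cycle_def by (auto intro!: cell cell_box_diff simp: cell_len_def len_def)
  then have "pscale (v k) (repr_cycle n k) \<in> cell_box 2 N" for k
    using cell_box_pscale[OF assms] by (metis add.right_neutral)
  then have "from_coords n v \<in> cell_box 2 N"
    unfolding from_coords_def
    by (rule sum_induct_set) (auto intro: cell_box_add)
  moreover have "x \<in> growth d (N + 2) m" if "x \<in> frac_ideal (- int N)" "m \<le> 2" for m and x :: "'a fract"
    using that by (auto simp: growth_def intro: frac_ideal_mono[rotated])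
  ultimately have "from_coords n v i \<in> growth d (N + 2) (cell_len i)" for i
    using cell_boxD[of "from_coords n v" 2 N i] by (cases "from_coords n v i = 0") auto
  then show ?thesis unfolding chain_lat_def by blast
qed

section \<open>The twisted group algebra and its dagger completion\<close>

interpretation pscale_ring: module "pscale :: 'k::comm_ring_1 \<Rightarrow> ('i \<Rightarrow> 'k) \<Rightarrow> 'i \<Rightarrow> 'k"
  by unfold_locales (auto simp: fun_eq_iff fun_apply algebra_simps)

definition bset :: "bool \<Rightarrow> nat \<Rightarrow> (int \<times> int \<Rightarrow> 'v::dvr fract) set" where
  "bset d N = {y. \<forall>g. y g \<in> growth d N (len g)}"

definition torus_alg :: "bool \<Rightarrow> 'v::dvr \<Rightarrow> ('v fract, int \<times> int \<Rightarrow> 'v fract) born_alg" where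
  "torus_alg d l = base_change (if d then torus_dagger l else torus l)"

lemma bset_mono: "N \<le> N' \<Longrightarrow> y \<in> bset d N \<Longrightarrow> y \<in> bset d N'"
  by (auto simp: bset_def intro: growth_mono)

lemma bsetD: "y \<in> bset d N \<Longrightarrow> y g \<in> growth d N (len g)"
  unfolding bset_def by blast

lemma bsetI: "(\<And>g. y g \<in> growth d N (len g)) \<Longrightarrow> y \<in> bset d N"
  unfolding bset_def by blast

lemma finite_len_le: "finite {g. len g \<le> N}"
proof (rule finite_subset)
  show "{g. len g \<le> N} \<subseteq> {- int N..int N} \<times> {- int N..int N}"
    by (auto simp: len_def)
qed auto

lemma fraction_apply: "fraction c x i = to_fract (x i) / to_fract c"
  by (simp add: fraction_def Fract_conv_to_fract)

text \<open>One denominator \<open>unif ^ N\<close> serves all coefficients of an element of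
  \<open>bset d N\<close>.\<close>

lemma growth_lift:
  assumes "y \<in> bset d N"
  shows "\<exists>x. y = fraction (unif ^ N) x \<and> (\<forall>g. to_fract (x g) \<in> frac_ideal (if d then int (len g div Suc N) else 0))
           \<and> (\<not> d \<longrightarrow> (\<forall>g. len g > N \<longrightarrow> x g = 0))"
proof -
  have *: "y g * unif_fract ^ N \<in> frac_ideal (if d then int (len g div Suc N) else 0)" for g
  proof -
    have "y g \<in> growth d N (len g)" using assms by (rule bsetD)
    then have "y g \<in> frac_ideal ((if d then int (len g div Suc N) else 0) - int N)"
      by (auto simp: growth_def split: if_splits)
    from frac_ideal_mult[OF this unif_fract_powi_in[of "int N"]] show ?thesis by simp
  qed
  have "\<exists>v. y g * unif_fract ^ N = to_fract v" for g
    by (rule frac_ideal_0E, rule frac_ideal_mono[OF _ *[of g]]) auto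
  then obtain x where x: "\<And>g. y g * unif_fract ^ N = to_fract (x g)" by metis
  then have "y = fraction (unif ^ N) x"
    by (simp add: fun_eq_iff fraction_apply to_fract_power x[symmetric])
  moreover have "x g = 0" if "\<not> d" "len g > N" for g
  proof -
    have "y g \<in> growth d N (len g)" using assms by (rule bsetD)
    then have "y g = 0" using that by (simp add: growth_def)
    with x[of g] show ?thesis by (metis mult_zero_left to_fract_eq_0_iff)
  qed
  ultimately show ?thesis using * x by auto
qed

section \<open>The two bornologies in terms of growth conditions\<close>

lemma dagger_growth_iff:
  "dagger_growth C x \<longleftrightarrow> (\<forall>g. ereal_of_enat (val (x g)) + 1 \<ge> ereal (C * real (len g)))"
  by (simp add: dagger_growth_def split_paired_all len_def)

text \<open>The slope \<open>C\<close> exceeds \<open>1 / Suc M\<close> as soon as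
  \<open>inverse C < real M\<close>. In \<open>N\<close> the summand 1 accounts for the 1 in
  \<open>dagger_growth\<close>, and \<open>r\<close> for the denominator \<open>c\<close>.\<close>

lemma dagger_growth_bset:
  assumes "C > 0" "c \<noteq> 0"
  shows "\<exists>N. fraction c ` {x. dagger_growth C x} \<subseteq> bset True N"
proof -
  obtain r where r: "inverse (to_fract c) \<in> frac_ideal (- int r)" using ex_frac_ideal by blast
  obtain M :: nat where M: "inverse C < real M" using reals_Archimedean2 by blast
  define N where "N = M + 1 + r"
  have "fraction c x g \<in> growth True N (len g)" if x: "dagger_growth C x" for x g
  proof -
    define k where "k = len g div Suc M - 1"
    have "enat k \<le> val (x g)"
    proof (cases "val (x g)")
      case (enat v)
      have "ereal_of_enat (val (x g)) + 1 \<ge> ereal (C * real (len g))"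
        using x unfolding dagger_growth_iff by blast
      then have v: "real v + 1 \<ge> C * real (len g)" by (simp add: enat)
      have "1 \<le> C * real (Suc M)" using M assms(1) by (simp add: field_simps)
      then have "real (len g) \<le> C * real (len g) * real (Suc M)"
        using mult_right_mono[of 1 "C * real (Suc M)" "real (len g)"] by (simp add: mult_ac)
      also have "\<dots> \<le> (real v + 1) * real (Suc M)" using v by (intro mult_right_mono) auto
      finally have "real (len g) \<le> real ((v + 1) * Suc M)" by (simp add: algebra_simps)
      then have "len g \<le> (v + 1) * Suc M" by (simp only: of_nat_le_iff)
      then have "len g div Suc M \<le> v + 1" by (metis div_le_mono div_mult_self_is_m zero_less_Suc)
      then show ?thesis using enat by (simp add: k_def)
    qed simp
    then have "to_fract (x g) \<in> frac_ideal (int k)"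
      by (simp add: le_val_iff to_fract_in_frac_ideal_iff)
    from frac_ideal_mult[OF this r] have "fraction c x g \<in> frac_ideal (int k + - int r)"
      by (simp add: fraction_apply divide_inverse)
    moreover have "len g div Suc N \<le> len g div Suc M" by (intro div_le_mono2) (auto simp: N_def)
    then have "int (len g div Suc N) - int N \<le> int k + - int r" by (simp add: k_def N_def)
    ultimately show ?thesis by (auto simp: growth_def intro: frac_ideal_mono)
  qed
  then show ?thesis unfolding bset_def by blast
qed

lemma bset_dagger_growth:
  "\<exists>C>0. bset True N \<subseteq> fraction (unif ^ N) ` {x :: int \<times> int \<Rightarrow> 'v::dvr. dagger_growth C x}"
proof -
  \<comment> \<open>With this slope the rounding in \<open>len g div Suc N\<close> is covered by the
    1 in \<open>dagger_growth\<close>.\<close>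
  define C where "C = 1 / real (Suc N)"
  have "y \<in> fraction (unif ^ N) ` {x. dagger_growth C x}" if y: "y \<in> bset True N" for y :: "int \<times> int \<Rightarrow> 'v fract"
  proof -
    obtain x where x: "y = fraction (unif ^ N) x" "\<And>g. to_fract (x g) \<in> frac_ideal (int (len g div Suc N))"
      using growth_lift[OF y] by auto
    have "ereal_of_enat (val (x g)) + 1 \<ge> ereal (C * real (len g))" for g
    proof (cases "val (x g)")
      case (enat v)
      have "enat (len g div Suc N) \<le> val (x g)"
        using x(2)[of g] unfolding le_val_iff by (simp only: to_fract_in_frac_ideal_iff)
      then have "len g div Suc N \<le> v" by (simp add: enat)
      moreover have "len g < Suc N * (len g div Suc N + 1)"
        by (metis Suc_eq_plus1 dividend_less_times_div zero_less_Suc mult_Suc_right add.commute)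
      ultimately have "len g \<le> Suc N * (v + 1)"
        by (meson add_le_mono1 le_trans less_imp_le mult_le_mono2)
      then have "real (len g) \<le> real (Suc N * (v + 1))" by (simp only: of_nat_le_iff)
      then have "C * real (len g) \<le> real v + 1" by (simp add: C_def field_simps)
      then show ?thesis by (simp add: enat)
    qed simp
    then show ?thesis using x(1) by (auto simp: dagger_growth_iff)
  qed
  moreover have "C > 0" by (simp add: C_def)
  ultimately show ?thesis by blast
qed

lemma span_bset:
  assumes "finite T" "T \<subseteq> {x. finite {g. x g \<noteq> 0}}" "c \<noteq> (0 :: 'v::dvr)"
  shows "\<exists>N. fraction c ` module.span pscale T \<subseteq> bset False N"
proof -
  define U where "U = (\<Union>t\<in>T. {g. t g \<noteq> 0})"
  have U: "finite U" using assms unfolding U_def by auto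
  obtain r where r: "inverse (to_fract c) \<in> frac_ideal (- int r)" using ex_frac_ideal by blast
  define N where "N = r + (\<Sum>g\<in>U. len g)"
  have N: "len g \<le> N" if "g \<in> U" for g
    using member_le_sum[of g U len] U that by (simp add: N_def)
  have "module.span pscale T \<subseteq> {x. \<forall>g. g \<notin> U \<longrightarrow> x g = 0}"
  proof (rule pscale_ring.span_minimal)
    show "module.subspace pscale {x. \<forall>g. g \<notin> U \<longrightarrow> x g = (0 :: 'v)}"
      by (auto simp: pscale_ring.subspace_def fun_apply)
  qed (auto simp: U_def)
  moreover have "fraction c x \<in> bset False N" if x: "\<forall>g. g \<notin> U \<longrightarrow> x g = 0" for x
  proof -
    have "fraction c x g \<in> frac_ideal (- int N)" for g
    proof -
      have "fraction c x g \<in> frac_ideal (- int r)"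
        using frac_ideal_scale[OF to_fract_in_frac_ideal r] by (simp add: fraction_apply divide_inverse)
      then show ?thesis by (rule frac_ideal_mono[rotated]) (simp add: N_def sum_nonneg)
    qed
    moreover have "fraction c x g = 0" if "len g > N" for g
    proof -
      have "g \<notin> U" using N[of g] that by auto
      with x have "x g = 0" by blast
      then show ?thesis by (simp add: fraction_apply)
    qed
    ultimately show ?thesis by (auto simp: bset_def growth_def)
  qed
  ultimately show ?thesis by blast
qed

lemma bset_span:
  "\<exists>T. finite T \<and> T \<subseteq> {x. finite {g. x g \<noteq> 0}} \<and> bset False N \<subseteq> fraction (unif ^ N :: 'v::dvr) ` module.span pscale T"
proof -
  define T where "T = (delta :: _ \<Rightarrow> _ \<Rightarrow> 'v) ` {g. len g \<le> N}"
  have "y \<in> fraction (unif ^ N :: 'v) ` module.span pscale T" if y: "y \<in> bset False N" for y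
  proof -
    obtain x where x: "y = fraction (unif ^ N) x" "\<And>g. len g > N \<Longrightarrow> x g = 0"
      using growth_lift[OF y] by auto
    have "x = (\<Sum>g | len g \<le> N. pscale (x g) (delta g))"
    proof
      fix h
      have "(\<Sum>g | len g \<le> N. pscale (x g) (delta g)) h = (\<Sum>g | len g \<le> N. if g = h then x h else 0)"
        unfolding sum_fun_apply by (rule sum.cong) (auto simp: fun_apply delta_def)
      also have "\<dots> = x h" using x(2)[of h] finite_len_le[of N] by (auto simp: not_le)
      finally show "x h = (\<Sum>g | len g \<le> N. pscale (x g) (delta g)) h" by simp
    qed
    also have "\<dots> \<in> module.span pscale T"
      by (intro pscale_ring.span_sum pscale_ring.span_scale pscale_ring.span_base) (auto simp: T_def)
    finally show ?thesis using x(1) by blast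
  qed
  moreover have "finite T" "T \<subseteq> {x. finite {g. x g \<noteq> 0}}"
    using finite_len_le by (auto simp: T_def)
  ultimately show ?thesis by blast
qed

lemma torus_alg_simps:
  "Scale (torus_alg d l) = pscale" "One (torus_alg d l) = delta 0"
proof -
  have "fraction 1 (delta 0) = delta (0 :: int \<times> int)"
    by (auto simp: fun_eq_iff fraction_apply delta_def)
  then show "One (torus_alg d l) = delta 0"
    by (simp add: torus_alg_def base_change_def torus_def torus_dagger_def)
qed (simp add: torus_alg_def base_change_def)

text \<open>Replaces the two bornologies, base change included, by the cofinal growth sets
  \<open>bset d N\<close>, so that both algebras can be treated uniformly in
  \<open>d\<close>.\<close>

lemma Bounded_torus_alg: "Bounded (torus_alg d (l::'v::dvr)) = {Y. \<exists>N. Y \<subseteq> bset d N}"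
proof (cases d)
  case True
  have "Bounded (torus_alg d l) = {Y. \<exists>c S. c \<noteq> (0 :: 'v) \<and> (\<exists>C>0. \<forall>x\<in>S. dagger_growth C x) \<and> Y \<subseteq> fraction c ` S}"
    using True by (simp add: torus_alg_def base_change_def torus_dagger_def)
  also have "\<dots> = {Y. \<exists>N. Y \<subseteq> bset d N}"
  proof (intro Collect_cong iffI)
    fix Y :: "(int \<times> int \<Rightarrow> 'v fract) set"
    assume "\<exists>c S. c \<noteq> (0 :: 'v) \<and> (\<exists>C>0. \<forall>x\<in>S. dagger_growth C x) \<and> Y \<subseteq> fraction c ` S"
    then obtain c C where "c \<noteq> (0 :: 'v)" "C > 0" "Y \<subseteq> fraction c ` {x. dagger_growth C x}" by blast
    moreover from dagger_growth_bset[OF this(2,1)] obtain N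
      where "fraction c ` {x. dagger_growth C x} \<subseteq> bset True N" ..
    ultimately show "\<exists>N. Y \<subseteq> bset d N" using True by (intro exI[of _ N]) auto
  next
    fix Y :: "(int \<times> int \<Rightarrow> 'v fract) set"
    assume "\<exists>N. Y \<subseteq> bset d N"
    then obtain N where N: "Y \<subseteq> bset True N" using True by auto
    from bset_dagger_growth[of N] obtain C where
      C: "C > 0" "bset True N \<subseteq> fraction (unif ^ N) ` {x :: int \<times> int \<Rightarrow> 'v. dagger_growth C x}" by blast
    have "(unif ^ N :: 'v) \<noteq> 0" by simp
    with N C show "\<exists>c S. c \<noteq> (0 :: 'v) \<and> (\<exists>C>0. \<forall>x\<in>S. dagger_growth C x) \<and> Y \<subseteq> fraction c ` S"
      by (intro exI[of _ "unif ^ N"] exI[of _ "{x. dagger_growth C x}"]) auto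
  qed
  finally show ?thesis .
next
  case False
  have "Bounded (torus_alg d l) = {Y. \<exists>c S. c \<noteq> (0 :: 'v) \<and> (\<exists>T. finite T \<and> T \<subseteq> {x. finite {g. x g \<noteq> 0}} \<and>
      S \<subseteq> module.span pscale T) \<and> Y \<subseteq> fraction c ` S}"
    using False by (simp add: torus_alg_def base_change_def torus_def)
  also have "\<dots> = {Y. \<exists>N. Y \<subseteq> bset d N}"
  proof (intro Collect_cong iffI)
    fix Y :: "(int \<times> int \<Rightarrow> 'v fract) set"
    assume "\<exists>c S. c \<noteq> (0 :: 'v) \<and> (\<exists>T. finite T \<and> T \<subseteq> {x. finite {g. x g \<noteq> 0}} \<and>
      S \<subseteq> module.span pscale T) \<and> Y \<subseteq> fraction c ` S"
    then obtain c S T where *: "c \<noteq> (0 :: 'v)" "finite T" "T \<subseteq> {x. finite {g. x g \<noteq> 0}}"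
      "S \<subseteq> module.span pscale T" "Y \<subseteq> fraction c ` S" by (elim exE conjE) (rule that)
    from *(4,5) have "Y \<subseteq> fraction c ` module.span pscale T" by (meson image_mono order_trans)
    moreover from span_bset[OF *(2,3,1)] obtain N
      where "fraction c ` module.span pscale T \<subseteq> bset False N" ..
    ultimately show "\<exists>N. Y \<subseteq> bset d N" using False by (intro exI[of _ N]) auto
  next
    fix Y :: "(int \<times> int \<Rightarrow> 'v fract) set"
    assume "\<exists>N. Y \<subseteq> bset d N"
    then obtain N where N: "Y \<subseteq> bset False N" using False by auto
    from bset_span[of N] obtain T where
      T: "finite T" "T \<subseteq> {x. finite {g. x g \<noteq> 0}}" "bset False N \<subseteq> fraction (unif ^ N :: 'v) ` module.span pscale T"
      by blast
    have "(unif ^ N :: 'v) \<noteq> 0" by simp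
    with N T show "\<exists>c S. c \<noteq> (0 :: 'v) \<and> (\<exists>T. finite T \<and> T \<subseteq> {x. finite {g. x g \<noteq> 0}} \<and>
      S \<subseteq> module.span pscale T) \<and> Y \<subseteq> fraction c ` S"
      by (intro exI[of _ "unif ^ N"] exI[of _ "module.span pscale T"]) auto
  qed
  finally show ?thesis .
qed

lemma singleton_in_span: "x \<in> module.span pscale {x :: 'i \<Rightarrow> 'k::comm_ring_1}"
  by (rule pscale_ring.span_base) simp

text \<open>Lets the carrier be read off from the bornology computed above.\<close>

lemma Carrier_eq_Bounded: "Carrier (torus_alg d (l::'v::dvr)) = {y. {y} \<in> Bounded (torus_alg d l)}"
proof (cases d)
  case True
  then show ?thesis
    by (simp add: torus_alg_def base_change_def torus_dagger_def) (blast intro: singletonI)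
next
  case False
  have "(\<exists>c x. y = fraction c x \<and> c \<noteq> (0 :: 'v) \<and> finite {g. x g \<noteq> 0}) \<longleftrightarrow>
      (\<exists>c S. c \<noteq> (0 :: 'v) \<and> (\<exists>T. finite T \<and> T \<subseteq> {x. finite {g. x g \<noteq> 0}} \<and>
        S \<subseteq> module.span pscale T) \<and> y \<in> fraction c ` S)" (is "?L \<longleftrightarrow> ?R") for y :: "int \<times> int \<Rightarrow> 'v fract"
  proof
    assume ?L
    then obtain c x where "y = fraction c x" "c \<noteq> (0 :: 'v)" "finite {g. x g \<noteq> 0}" by blast
    then show ?R using singleton_in_span[of x]
      by (intro exI[of _ c] exI[of _ "{x}"] conjI exI[of _ "{x}"]) auto
  next
    assume ?R
    then obtain c T x where *: "c \<noteq> (0 :: 'v)" "finite T" "T \<subseteq> {x. finite {g. x g \<noteq> 0}}"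
      "x \<in> module.span pscale T" "y = fraction c x" by blast
    have "module.span pscale T \<subseteq> {x :: _ \<Rightarrow> 'v. finite {g. x g \<noteq> 0}}"
    proof (rule pscale_ring.span_minimal)
      show "module.subspace pscale {x :: int \<times> int \<Rightarrow> 'v. finite {g. x g \<noteq> 0}}"
        by (simp add: pscale_ring.subspace_def)
    qed (use * in auto)
    with * show ?L by blast
  qed
  then show ?thesis using False
    by (simp add: torus_alg_def base_change_def torus_def)
qed

lemma Carrier_torus_alg: "Carrier (torus_alg d l) = (\<Union>N. bset d N)"
  by (auto simp: Carrier_eq_Bounded Bounded_torus_alg)

lemma bset_Carrier: "y \<in> bset d N \<Longrightarrow> y \<in> Carrier (torus_alg d l)"
  by (auto simp: Carrier_torus_alg)

lemma bset_False_True: "y \<in> bset False N \<Longrightarrow> y \<in> bset True N"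
proof (rule bsetI)
  fix g
  assume "y \<in> bset False N"
  from bsetD[OF this, of g] show "y g \<in> growth True N (len g)"
    by (cases "len g \<le> N") (simp_all add: growth_def)
qed

lemma Carrier_False_True: "Carrier (torus_alg False l) \<subseteq> Carrier (torus_alg True l)"
  by (auto simp: Carrier_torus_alg intro: bset_False_True)

subsection \<open>Summation in the fraction field\<close>

text \<open>Summation in the fraction field as a relation with unique values. It replaces the
  definite descriptions in \<open>adic_sum\<close> and in the multiplication of
  \<open>base_change\<close>, so identities of products become identities of summands.\<close>

definition fsums :: "('i \<Rightarrow> 'v::dvr fract) \<Rightarrow> 'v fract \<Rightarrow> bool" where
  "fsums f s \<longleftrightarrow> (\<forall>k. \<exists>I. finite I \<and> (\<forall>J. finite J \<and> I \<subseteq> J \<longrightarrow> s - sum f J \<in> frac_ideal (int k)))"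

lemma fsums_finite: "finite S \<Longrightarrow> (\<And>i. i \<notin> S \<Longrightarrow> f i = 0) \<Longrightarrow> fsums f (sum f S)"
  unfolding fsums_def
proof (intro allI exI[of _ S] conjI impI)
  fix k J
  assume "finite S" "\<And>i. i \<notin> S \<Longrightarrow> f i = 0" "finite J \<and> S \<subseteq> J"
  then have "sum f S = sum f J" by (intro sum.mono_neutral_left) auto
  then show "sum f S - sum f J \<in> frac_ideal (int k)" by simp
qed

lemma fsums_add: "fsums f s \<Longrightarrow> fsums g r \<Longrightarrow> fsums (\<lambda>i. f i + g i) (s + r)"
  unfolding fsums_def
proof
  fix k
  assume "\<forall>k. \<exists>I. finite I \<and> (\<forall>J. finite J \<and> I \<subseteq> J \<longrightarrow> s - sum f J \<in> frac_ideal (int k))"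
    "\<forall>k. \<exists>I. finite I \<and> (\<forall>J. finite J \<and> I \<subseteq> J \<longrightarrow> r - sum g J \<in> frac_ideal (int k))"
  then obtain I I' where *: "finite I" "\<And>J. finite J \<Longrightarrow> I \<subseteq> J \<Longrightarrow> s - sum f J \<in> frac_ideal (int k)"
    "finite I'" "\<And>J. finite J \<Longrightarrow> I' \<subseteq> J \<Longrightarrow> r - sum g J \<in> frac_ideal (int k)" by metis
  have "s + r - (\<Sum>i\<in>J. f i + g i) \<in> frac_ideal (int k)" if "finite J" "I \<union> I' \<subseteq> J" for J
    using frac_ideal_add[OF *(2)[of J] *(4)[of J]] that by (simp add: sum.distrib algebra_simps)
  then show "\<exists>I. finite I \<and> (\<forall>J. finite J \<and> I \<subseteq> J \<longrightarrow> s + r - (\<Sum>i\<in>J. f i + g i) \<in> frac_ideal (int k))"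
    using * by (intro exI[of _ "I \<union> I'"]) auto
qed

lemma fsums_mult: "fsums f s \<Longrightarrow> fsums (\<lambda>i. a * f i) (a * s)"
  unfolding fsums_def
proof
  fix k
  assume *: "\<forall>k. \<exists>I. finite I \<and> (\<forall>J. finite J \<and> I \<subseteq> J \<longrightarrow> s - sum f J \<in> frac_ideal (int k))"
  obtain r where r: "a \<in> frac_ideal (- int r)" using ex_frac_ideal by blast
  from * obtain I where I: "finite I" "\<And>J. finite J \<Longrightarrow> I \<subseteq> J \<Longrightarrow> s - sum f J \<in> frac_ideal (int (k + r))"
    by metis
  have "a * s - (\<Sum>i\<in>J. a * f i) \<in> frac_ideal (int k)" if "finite J" "I \<subseteq> J" for J
    using frac_ideal_mult[OF r I(2)[OF that]] by (simp add: sum_distrib_left right_diff_distrib)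
  then show "\<exists>I. finite I \<and> (\<forall>J. finite J \<and> I \<subseteq> J \<longrightarrow> a * s - (\<Sum>i\<in>J. a * f i) \<in> frac_ideal (int k))"
    using I(1) by blast
qed

lemma fsums_unique: "fsums f s \<Longrightarrow> fsums f r \<Longrightarrow> s = r"
proof -
  assume *: "fsums f s" "fsums f r"
  have "s - r \<in> frac_ideal (int k)" for k
  proof -
    from * obtain I I' where "finite I" "\<And>J. finite J \<Longrightarrow> I \<subseteq> J \<Longrightarrow> s - sum f J \<in> frac_ideal (int k)"
      "finite I'" "\<And>J. finite J \<Longrightarrow> I' \<subseteq> J \<Longrightarrow> r - sum f J \<in> frac_ideal (int k)" unfolding fsums_def by metis
    then have "s - sum f (I \<union> I') \<in> frac_ideal (int k)" "r - sum f (I \<union> I') \<in> frac_ideal (int k)" by auto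
    from frac_ideal_diff[OF this] show ?thesis by simp
  qed
  then have "s - r = 0" by (rule frac_ideal_all)
  then show ?thesis by simp
qed

text \<open>Finite partial sums satisfy the growth condition, and the condition is closed.\<close>

lemma fsums_growth: "fsums f s \<Longrightarrow> (\<And>i. f i \<in> growth d N m) \<Longrightarrow> s \<in> growth d N m"
proof (rule growth_closed)
  fix k
  assume "fsums f s" and f: "\<And>i. f i \<in> growth d N m"
  then obtain I where "s - sum f I \<in> frac_ideal (int k)" unfolding fsums_def by blast
  then show "\<exists>z\<in>growth d N m. s - z \<in> frac_ideal (int k)" using growth_sum[of I f, OF f] by blast
qed

text \<open>The partial sums over the finite sets of terms not divisible by \<open>unif ^ k\<close>
  form the sequence to which \<open>adically_complete\<close> applies; all later terms are
  small.\<close>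

lemma adic_sums_exist:
  fixes f :: "'i \<Rightarrow> 'v::complete_dvr"
  assumes fin: "\<And>k. finite {i. \<not> unif ^ k dvd f i}"
  shows "\<exists>s. adic_sums f s"
proof -
  define I where "I k = {i. \<not> unif ^ k dvd f i}" for k
  have tail: "unif ^ k dvd sum f J" if "J \<inter> I k = {}" for J k
    using that by (intro dvd_sum) (auto simp: I_def)
  have "unif ^ k dvd sum f (I (Suc k)) - sum f (I k)" for k
  proof -
    have "I k \<subseteq> I (Suc k)" by (auto simp: I_def intro: dvd_trans le_imp_power_dvd)
    then have "sum f (I (Suc k)) - sum f (I k) = sum f (I (Suc k) - I k)"
      using fin[of "Suc k"] by (subst sum_diff) (simp_all add: I_def)
    then show ?thesis using tail[of "I (Suc k) - I k" k] by auto
  qed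
  from adically_complete[OF uniformizer_unif this] obtain L where L: "\<And>n. unif ^ n dvd sum f (I n) - L" by blast
  have "unif ^ k dvd L - sum f J" if "finite J" "I k \<subseteq> J" for k J
  proof -
    have "L - sum f J = - (sum f (I k) - L) - sum f (J - I k)"
      using that by (subst sum_diff) auto
    moreover have "unif ^ k dvd - (sum f (I k) - L)" using L[of k] by (subst dvd_minus_iff)
    moreover have "unif ^ k dvd sum f (J - I k)" by (rule tail) auto
    ultimately show ?thesis by (simp only: dvd_diff)
  qed
  then have "adic_sums f L" unfolding adic_sums_def using fin unfolding I_def by blast
  then show ?thesis ..
qed

lemma adic_sums_fsums: "adic_sums f s \<Longrightarrow> fsums (\<lambda>i. to_fract (f i)) (to_fract s)"
  unfolding adic_sums_def fsums_def
  by (simp add: to_fract_in_frac_ideal_iff flip: to_fract_sum to_fract_diff)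

lemma adic_sum_fsums:
  fixes f :: "'i \<Rightarrow> 'v::complete_dvr"
  assumes "\<And>k. finite {i. \<not> unif ^ k dvd f i}"
  shows "fsums (\<lambda>i. to_fract (f i)) (to_fract (adic_sum f))"
proof -
  obtain s where s: "adic_sums f s" using adic_sums_exist[OF assms] by blast
  then have "adic_sum f = s" unfolding adic_sum_def
    using adic_sums_fsums[OF s] by (intro the_equality) (auto dest!: adic_sums_fsums dest: fsums_unique)
  with adic_sums_fsums[OF s] show ?thesis by simp
qed

subsection \<open>Multiplication\<close>

definition conv_term :: "'v::dvr \<Rightarrow> (int \<times> int \<Rightarrow> 'v fract) \<Rightarrow> (int \<times> int \<Rightarrow> 'v fract) \<Rightarrow>
    int \<times> int \<Rightarrow> int \<times> int \<Rightarrow> 'v fract" where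
  "conv_term l y y' g h = to_fract l powi (snd h * fst (g - h)) * y h * y' (g - h)"

lemma to_fract_unit_power:
  assumes "l dvd 1"
  shows "to_fract (unit_power l k) = to_fract l powi k"
proof (cases "k \<ge> 0")
  case False
  obtain w where w: "1 = l * w" using assms by (auto elim: dvdE)
  have l: "to_fract l \<noteq> 0" using assms by auto
  have "unit_power l k = w ^ nat (- k)"
    unfolding unit_power_def if_not_P[OF False]
  proof (rule the_equality)
    show *: "w ^ nat (- k) * l ^ nat (- k) = 1"
      by (simp add: power_mult_distrib[symmetric] w[symmetric] mult.commute)
    fix u
    assume "u * l ^ nat (- k) = 1"
    with * show "u = w ^ nat (- k)" using l by (metis mult_right_cancel mult_zero_right zero_neq_one)
  qed
  moreover have "to_fract w = inverse (to_fract l)"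
    using w by (metis inverse_unique to_fract_1 to_fract_mult)
  ultimately show ?thesis using False by (simp add: power_int_def to_fract_power)
qed (simp add: unit_power_def power_int_def to_fract_power)

lemma Carrier_vanishing:
  assumes "x \<in> Carrier (if d then torus_dagger l else torus l)"
  shows "finite {h. \<not> unif ^ k dvd x h}"
proof (cases d)
  case False
  then have "finite {h. x h \<noteq> 0}" using assms by (simp add: torus_def)
  then show ?thesis by (rule finite_subset[rotated]) auto
next
  case True
  then obtain C where C: "C > 0" "dagger_growth C x" using assms by (auto simp: torus_dagger_def)
  obtain N where N: "fraction 1 x \<in> bset True N"
    using dagger_growth_bset[OF C(1), of 1] C(2) by auto
  \<comment> \<open>Beyond this radius the exponent \<open>len h div Suc N - N\<close> is at least
    \<open>k\<close>.\<close>
  have "len h \<le> Suc N * (N + k)" if "\<not> unif ^ k dvd x h" for h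
  proof (rule ccontr)
    assume "\<not> len h \<le> Suc N * (N + k)"
    then have "Suc N * (N + k) div Suc N \<le> len h div Suc N" by (intro div_le_mono) simp
    then have "N + k \<le> len h div Suc N" by (subst (asm) nonzero_mult_div_cancel_left) auto
    then have "int k \<le> int (len h div Suc N) - int N" by simp
    moreover have "to_fract (x h) \<in> frac_ideal (int (len h div Suc N) - int N)"
      using bsetD[OF N, of h] by (simp add: growth_def fraction_apply)
    ultimately have "to_fract (x h) \<in> frac_ideal (int k)" by (rule frac_ideal_mono)
    with that show False by (simp add: to_fract_in_frac_ideal_iff)
  qed
  then show ?thesis by (intro finite_subset[OF _ finite_len_le[of "Suc N * (N + k)"]]) auto
qed

locale unit_twist =
  fixes l :: "'v::complete_dvr"
  assumes unit: "l dvd 1"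
begin

lemma twisted_conv_fsums:
  assumes "x \<in> Carrier (if d then torus_dagger l else torus l)" "x' \<in> Carrier (if d then torus_dagger l else torus l)"
  shows "fsums (conv_term l (fraction c x) (fraction c' x') g) (fraction (c * c') (twisted_conv l x x') g)"
proof -
  let ?f = "\<lambda>h. cocycle l h (g - h) * x h * x' (g - h)"
  have "finite {h. \<not> unif ^ k dvd ?f h}" for k
    by (rule finite_subset[OF _ Carrier_vanishing[OF assms(1), of k]]) auto
  from fsums_mult[OF adic_sum_fsums[OF this], of "inverse (to_fract (c * c'))"]
  have "fsums (\<lambda>h. inverse (to_fract (c * c')) * to_fract (?f h)) (fraction (c * c') (twisted_conv l x x') g)"
    by (simp add: fraction_apply twisted_conv_def divide_inverse mult.commute)
  also have "(\<lambda>h. inverse (to_fract (c * c')) * to_fract (?f h)) = conv_term l (fraction c x) (fraction c' x') g"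
    by (simp add: fun_eq_iff conv_term_def cocycle_def to_fract_unit_power[OF unit] fraction_apply divide_inverse mult_ac)
  finally show ?thesis .
qed

text \<open>Different fractions representing \<open>y\<close> and \<open>y'\<close> lead to sums of
  the same family \<open>conv_term l y y' g\<close>, so the definite description in
  \<open>base_change\<close> denotes their common value.\<close>

lemma Mult_fsums:
  assumes "y \<in> Carrier (torus_alg d l)" "y' \<in> Carrier (torus_alg d l)"
  shows "fsums (conv_term l y y' g) (Mult (torus_alg d l) y y' g)"
proof -
  let ?M = "if d then torus_dagger l else torus l"
  have M: "Mult ?M = twisted_conv l" by (simp add: torus_def torus_dagger_def)
  from assms obtain c x c' x' where y: "c \<noteq> 0" "x \<in> Carrier ?M" "y = fraction c x"
    "c' \<noteq> 0" "x' \<in> Carrier ?M" "y' = fraction c' x'"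
    unfolding torus_alg_def base_change_def by auto
  let ?z = "fraction (c * c') (Mult ?M x x')"
  have "Mult (torus_alg d l) y y' = (THE z. \<exists>c x d x'. c \<noteq> 0 \<and> d \<noteq> 0 \<and> x \<in> Carrier ?M \<and> x' \<in> Carrier ?M \<and>
                y = fraction c x \<and> y' = fraction d x' \<and> z = fraction (c * d) (Mult ?M x x'))"
    unfolding torus_alg_def base_change_def by simp
  also have "\<dots> = ?z"
  proof (rule the_equality)
    fix z
    assume "\<exists>c x d x'. c \<noteq> 0 \<and> d \<noteq> 0 \<and> x \<in> Carrier ?M \<and> x' \<in> Carrier ?M \<and>
                y = fraction c x \<and> y' = fraction d x' \<and> z = fraction (c * d) (Mult ?M x x')"
    then have "fsums (conv_term l y y' g) (z g)" for g
      using twisted_conv_fsums[of _ d] unfolding M by blast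
    moreover have "fsums (conv_term l y y' g) (?z g)" for g
      unfolding y(3,6) M using y(2,5) by (rule twisted_conv_fsums)
    ultimately show "z = ?z" using fsums_unique by blast
  qed (use y in blast)
  finally show ?thesis unfolding y(3,6) M using y(2,5) by (simp add: twisted_conv_fsums[of _ d])
qed

text \<open>Products are identified by checking summands only; bilinearity and the unit laws below
  are proved in this way.\<close>

lemma Mult_unique:
  assumes "y \<in> Carrier (torus_alg d l)" "y' \<in> Carrier (torus_alg d l)"
    and "\<And>g. fsums (conv_term l y y' g) (z g)"
  shows "Mult (torus_alg d l) y y' = z"
  using Mult_fsums[OF assms(1,2)] assms(3) fsums_unique by blast

lemma Mult_False_True:
  assumes "y \<in> Carrier (torus_alg False l)" "y' \<in> Carrier (torus_alg False l)"
  shows "Mult (torus_alg True l) y y' = Mult (torus_alg False l) y y'"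
  using assms Carrier_False_True by (intro Mult_unique Mult_fsums) auto

lemma Carrier_add:
  assumes "y \<in> Carrier (torus_alg d l)" "y' \<in> Carrier (torus_alg d l)"
  shows "y + y' \<in> Carrier (torus_alg d l)"
proof -
  from assms obtain N N' where "y \<in> bset d N" "y' \<in> bset d N'" by (auto simp: Carrier_torus_alg)
  then have "y \<in> bset d (N + N')" "y' \<in> bset d (N + N')" by (auto intro: bset_mono[rotated])
  then have "y + y' \<in> bset d (N + N')" by (auto simp: bset_def fun_apply intro: growth_add)
  then show ?thesis by (rule bset_Carrier)
qed

lemma Carrier_pscale:
  assumes "y \<in> Carrier (torus_alg d l)"
  shows "pscale a y \<in> Carrier (torus_alg d l)"
proof -
  from assms obtain N where y: "y \<in> bset d N" by (auto simp: Carrier_torus_alg)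
  obtain N' where "\<And>m x. x \<in> growth d N m \<Longrightarrow> a * x \<in> growth d N' m"
    using growth_scale_any[of d N a] by blast
  with y have "pscale a y \<in> bset d N'" by (auto simp: bset_def fun_apply)
  then show ?thesis by (rule bset_Carrier)
qed

lemma delta_bset: "len g \<le> N \<Longrightarrow> delta g \<in> bset d N"
  by (auto simp: bset_def delta_def growth_def intro!: frac_ideal_mono[OF _ frac_ideal_1])

lemma delta_Carrier: "delta g \<in> Carrier (torus_alg d l)"
  using delta_bset[OF order_refl] by (rule bset_Carrier)

text \<open>Each summand lives at length \<open>len h + len (g - h)\<close>, which is at least
  \<open>len g\<close>, and the powers of the unit \<open>l\<close> do not affect
  valuations.\<close>

lemma Mult_bset:
  "\<exists>N'. \<forall>y\<in>bset d N. \<forall>y'\<in>bset d N. Mult (torus_alg d l) y y' \<in> bset d N'"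
proof -
  obtain N' where N': "\<And>m m' (x::'v fract). m \<le> 1 * m' + 1 \<Longrightarrow> x \<in> growth d (2 * N + 1) m' \<Longrightarrow> x \<in> growth d N' m"
    using growth_control[of 1 d "2 * N + 1"] by blast
  have "Mult (torus_alg d l) y y' g \<in> growth d N' (len g)" if y: "y \<in> bset d N" "y' \<in> bset d N" for y y' g
  proof (rule fsums_growth[OF Mult_fsums])
    fix h
    have "y h * y' (g - h) \<in> growth d (2 * N + 1) (len h + len (g - h))"
      using y by (intro growth_mult bsetD)
    then have "y h * y' (g - h) \<in> growth d N' (len g)"
      using len_add[of h "g - h"] by (intro N'[of _ "len h + len (g - h)"]) auto
    then show "conv_term l y y' g h \<in> growth d N' (len g)"
      unfolding conv_term_def mult.assoc by (rule growth_scale[OF unit_powi_in_frac_ideal[OF unit]])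
  qed (use y in \<open>auto intro: bset_Carrier\<close>)
  then show ?thesis unfolding bset_def by blast
qed

lemma Mult_Carrier:
  assumes "y \<in> Carrier (torus_alg d l)" "y' \<in> Carrier (torus_alg d l)"
  shows "Mult (torus_alg d l) y y' \<in> Carrier (torus_alg d l)"
proof -
  from assms obtain N N' where "y \<in> bset d N" "y' \<in> bset d N'" by (auto simp: Carrier_torus_alg)
  then have "y \<in> bset d (N + N')" "y' \<in> bset d (N + N')" by (auto intro: bset_mono[rotated])
  then show ?thesis using Mult_bset[of d "N + N'"] bset_Carrier by blast
qed

lemma Mult_add_left:
  assumes "y \<in> Carrier (torus_alg d l)" "z \<in> Carrier (torus_alg d l)" "y' \<in> Carrier (torus_alg d l)"
  shows "Mult (torus_alg d l) (y + z) y' = Mult (torus_alg d l) y y' + Mult (torus_alg d l) z y'"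
proof (rule Mult_unique)
  fix g
  show "fsums (conv_term l (y + z) y' g) ((Mult (torus_alg d l) y y' + Mult (torus_alg d l) z y') g)"
    using fsums_add[OF Mult_fsums[OF assms(1,3)] Mult_fsums[OF assms(2,3)]]
    by (simp add: fun_apply conv_term_def[abs_def] algebra_simps)
qed (use assms in \<open>simp_all add: Carrier_add\<close>)

lemma Mult_add_right:
  assumes "y \<in> Carrier (torus_alg d l)" "z \<in> Carrier (torus_alg d l)" "y' \<in> Carrier (torus_alg d l)"
  shows "Mult (torus_alg d l) y' (y + z) = Mult (torus_alg d l) y' y + Mult (torus_alg d l) y' z"
proof (rule Mult_unique)
  fix g
  show "fsums (conv_term l y' (y + z) g) ((Mult (torus_alg d l) y' y + Mult (torus_alg d l) y' z) g)"
    using fsums_add[OF Mult_fsums[OF assms(3,1)] Mult_fsums[OF assms(3,2)]]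
    by (simp add: fun_apply conv_term_def[abs_def] algebra_simps)
qed (use assms in \<open>simp_all add: Carrier_add\<close>)

lemma Mult_pscale_left:
  assumes "y \<in> Carrier (torus_alg d l)" "y' \<in> Carrier (torus_alg d l)"
  shows "Mult (torus_alg d l) (pscale a y) y' = pscale a (Mult (torus_alg d l) y y')"
proof (rule Mult_unique)
  fix g
  show "fsums (conv_term l (pscale a y) y' g) (pscale a (Mult (torus_alg d l) y y') g)"
    using fsums_mult[OF Mult_fsums[OF assms], of a]
    by (simp add: fun_apply conv_term_def[abs_def] mult_ac)
qed (use assms in \<open>simp_all add: Carrier_pscale\<close>)

lemma Mult_pscale_right:
  assumes "y \<in> Carrier (torus_alg d l)" "y' \<in> Carrier (torus_alg d l)"
  shows "Mult (torus_alg d l) y (pscale a y') = pscale a (Mult (torus_alg d l) y y')"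
proof (rule Mult_unique)
  fix g
  show "fsums (conv_term l y (pscale a y') g) (pscale a (Mult (torus_alg d l) y y') g)"
    using fsums_mult[OF Mult_fsums[OF assms], of a]
    by (simp add: fun_apply conv_term_def[abs_def] mult_ac)
qed (use assms in \<open>simp_all add: Carrier_pscale\<close>)

lemma Mult_delta_left:
  assumes "y \<in> Carrier (torus_alg d l)"
  shows "Mult (torus_alg d l) (delta g) y = (\<lambda>k. to_fract l powi (snd g * fst (k - g)) * y (k - g))"
proof (rule Mult_unique[OF delta_Carrier assms])
  fix k
  show "fsums (conv_term l (delta g) y k) (to_fract l powi (snd g * fst (k - g)) * y (k - g))"
    using fsums_finite[of "{g}" "conv_term l (delta g) y k"] by (simp add: conv_term_def delta_def)
qed

lemma Mult_delta_delta:
  "Mult (torus_alg d l) (delta g) (delta h) = pscale (to_fract l powi (snd g * fst h)) (delta (g + h))"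
  unfolding Mult_delta_left[OF delta_Carrier]
proof
  fix k
  have "k - g = h \<longleftrightarrow> k = g + h" by (auto simp: algebra_simps)
  then show "to_fract l powi (snd g * fst (k - g)) * delta h (k - g) =
      pscale (to_fract l powi (snd g * fst h)) (delta (g + h)) k"
    by (auto simp: fun_apply delta_def)
qed

lemma Mult_One_left: "y \<in> Carrier (torus_alg d l) \<Longrightarrow> Mult (torus_alg d l) (delta 0) y = y"
  by (simp add: Mult_delta_left fun_eq_iff)

lemma Mult_One_right:
  assumes "y \<in> Carrier (torus_alg d l)"
  shows "Mult (torus_alg d l) y (delta 0) = y"
proof (rule Mult_unique[OF assms delta_Carrier])
  fix k
  show "fsums (conv_term l y (delta 0) k) (y k)"
    using fsums_finite[of "{k}" "conv_term l y (delta 0) k"] by (simp add: conv_term_def delta_def)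
qed

end

section \<open>Noncommutative differential forms\<close>

definition mrg :: "('a \<Rightarrow> 'a \<Rightarrow> 'a) \<Rightarrow> nat \<Rightarrow> 'a list \<Rightarrow> 'a list" where
  "mrg m i xs = take i xs @ [m (xs ! i) (xs ! Suc i)] @ drop (i + 2) xs"

text \<open>One index range for all summands of \<open>b_word\<close>, the cyclic face being the
  last one.\<close>

definition face :: "('a \<Rightarrow> 'a \<Rightarrow> 'a) \<Rightarrow> nat \<Rightarrow> 'a list \<Rightarrow> 'a list" where
  "face m i xs = (if Suc i < length xs then mrg m i xs else m (last xs) (hd xs) # butlast (tl xs))"

lemma mrg_0 [simp]: "mrg m 0 (x # y # zs) = m x y # zs"
  and mrg_Suc [simp]: "mrg m (Suc i) (x # xs) = x # mrg m i xs"
  by (simp_all add: mrg_def)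

lemma mrg_append1: "Suc i < length us \<Longrightarrow> mrg m i (us @ ys) = mrg m i us @ ys"
  by (simp add: mrg_def nth_append)

lemma mrg_append2: "mrg m (length us + i) (us @ ys) = us @ mrg m i ys"
  by (induction us) auto

lemma length_mrg: "Suc i < length xs \<Longrightarrow> length (mrg m i xs) = length xs - 1"
  by (simp add: mrg_def)

lemma mrg_set_subset:
  "Suc i < length xs \<Longrightarrow> set xs \<subseteq> S \<Longrightarrow> (\<And>x y. x \<in> S \<Longrightarrow> y \<in> S \<Longrightarrow> m x y \<in> S') \<Longrightarrow> S \<subseteq> S' \<Longrightarrow> set (mrg m i xs) \<subseteq> S'"
  using set_take_subset[of i xs] set_drop_subset[of "i + 2" xs]
  by (auto simp: mrg_def subset_iff)

lemma length_face: "length xs \<ge> 2 \<Longrightarrow> length (face m i xs) = length xs - 1"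
  by (simp add: face_def length_mrg) arith

lemma face_set_subset:
  assumes "length xs \<ge> 2" "set xs \<subseteq> S" "\<And>x y. x \<in> S \<Longrightarrow> y \<in> S \<Longrightarrow> m x y \<in> S'" "S \<subseteq> S'"
  shows "set (face m i xs) \<subseteq> S'"
proof (cases "Suc i < length xs")
  case True
  then show ?thesis using mrg_set_subset[OF _ assms(2,3,4)] by (simp add: face_def)
next
  case False
  obtain x ys where xs: "xs = x # ys" "ys \<noteq> []" using assms(1) by (cases xs; cases "tl xs") auto
  have "last ys \<in> S" "x \<in> S" "set (butlast ys) \<subseteq> S"
    using assms(2) xs by (auto dest: in_set_butlastD)
  then show ?thesis using False xs assms(3,4) by (auto simp: face_def)
qed

lemma face_words:
  assumes "xs \<in> words S (Suc n)" "\<And>x y. x \<in> S \<Longrightarrow> y \<in> S \<Longrightarrow> m x y \<in> S'" "S \<subseteq> S'"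
  shows "face m i xs \<in> words S' n"
  using assms face_set_subset[of xs S m S' i] by (auto simp: words_def length_face)

lemma b_word_face:
  fixes A :: "('k::field, 'a) born_alg"
  assumes "length xs = Suc (Suc n)"
  shows "b_word A xs = (\<Sum>i\<le>Suc n. pscale ((- 1) ^ i) (delta (face (Mult A) i xs)))"
proof -
  have "(\<Sum>i<Suc n. pscale ((- 1) ^ i) (delta (face (Mult A) i xs) :: 'a list \<Rightarrow> 'k)) =
      (\<Sum>i<Suc n. pscale ((- 1) ^ i) (delta (take i xs @ [Mult A (xs ! i) (xs ! Suc i)] @ drop (i + 2) xs)))"
    using assms by (intro sum.cong) (auto simp: face_def mrg_def)
  moreover have "face (Mult A) (Suc n) xs = Mult A (last xs) (hd xs) # butlast (tl xs)"
    using assms by (simp add: face_def)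
  moreover have "length xs - 1 = Suc n" using assms by simp
  ultimately show ?thesis
    unfolding lessThan_Suc_atMost[symmetric] sum.lessThan_Suc[of _ "Suc n"]
    by (simp only: b_word_def Let_def) (simp del: sum.lessThan_Suc)
qed

lemma words_append: "us @ a # vs \<in> words S n \<longleftrightarrow>
    length us + length vs = n \<and> set us \<subseteq> S \<and> a \<in> S \<and> set vs \<subseteq> S"
  by (auto simp: words_def)

lemma words_update_cases:
  assumes "xs \<in> words S n" "i \<le> n"
  obtains us vs where "length us = i" "\<And>a. xs[i := a] = us @ a # vs" "length us + length vs = n"
    "set us \<subseteq> S" "set vs \<subseteq> S"
proof (rule that)
  show "xs[i := a] = take i xs @ a # drop (Suc i) xs" for a
    using assms by (intro upd_conv_take_nth_drop) (auto simp: words_def)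
qed (use assms in \<open>auto simp: words_def dest: in_set_takeD in_set_dropD\<close>)

lemma pi_mult_iff:
  fixes f :: "'i \<Rightarrow> 'w::dvr fract"
  shows "f \<in> pi_mult k L \<longleftrightarrow> pscale (unif_fract powi (- int k)) f \<in> L"
proof
  assume "f \<in> pi_mult k L"
  then obtain x where "x \<in> L" "f = pscale (to_fract (unif ^ k)) x" unfolding pi_mult_def by blast
  then show "pscale (unif_fract powi (- int k)) f \<in> L"
    by (simp add: to_fract_power power_int_minus)
next
  assume "pscale (unif_fract powi (- int k)) f \<in> L"
  moreover have "f = pscale (to_fract (unif ^ k)) (pscale (unif_fract powi (- int k)) f)"
    by (simp add: to_fract_power power_int_minus)
  ultimately show "f \<in> pi_mult k L" unfolding pi_mult_def by blast
qed

text \<open>The power of \<open>\<lambda>\<close> in the product of the group elements \<open>hs\<close> in the twisted group algebra.\<close>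

fun twist_exp :: "(int \<times> int) list \<Rightarrow> int" where
  "twist_exp [] = 0"
| "twist_exp (h # hs) = snd h * fst (sum_list hs) + twist_exp hs"

text \<open>Recovers the zeroth letter, which a cell stores only through its total degree.\<close>

definition full_word :: "cell_index \<Rightarrow> (int \<times> int) list" where
  "full_word i = (fst i - sum_list (snd i)) # snd i"

fun evl :: "('g \<Rightarrow> 'k::field) list \<Rightarrow> 'g list \<Rightarrow> 'k" where
  "evl [] [] = 1"
| "evl (a # xs) (h # hs) = a h * evl xs hs"
| "evl _ _ = 0"

text \<open>The negative power of \<open>t\<close> normalizes the product of the letters to
  \<open>\<delta>\<^sub>g\<close>.\<close>

definition iota_word :: "'k::field \<Rightarrow> cell_index \<Rightarrow> (int \<times> int \<Rightarrow> 'k) list \<Rightarrow> 'k" where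
  "iota_word t i = pscale (t powi (- twist_exp (full_word i))) (delta (map delta (full_word i)))"

text \<open>Carries the normalization inverse to that of \<open>iota_word\<close>. For letters in
  the dagger algebra infinitely many coefficients may be nonzero, so the result need not be a
  chain.\<close>

definition coeff_word :: "'k::field \<Rightarrow> (int \<times> int \<Rightarrow> 'k) list \<Rightarrow> cell_index \<Rightarrow> 'k" where
  "coeff_word t xs i =
     (if 0 \<in> set (snd i) then 0 else t powi twist_exp (full_word i) * evl xs (full_word i))"

definition trunc :: "nat \<Rightarrow> (int \<times> int \<Rightarrow> 'k::zero) \<Rightarrow> int \<times> int \<Rightarrow> 'k" where
  "trunc m a = (\<lambda>g. if len g \<le> m then a g else 0)"

definition chain_trunc :: "nat \<Rightarrow> (cell_index \<Rightarrow> 'k::zero) \<Rightarrow> cell_index \<Rightarrow> 'k" where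
  "chain_trunc m f = (\<lambda>i. if \<forall>h\<in>set (full_word i). len h \<le> m then f i else 0)"

lemma evl_length: "length xs \<noteq> length hs \<Longrightarrow> evl xs hs = 0"
  by (induction xs hs rule: evl.induct) auto

lemma evl_add: "evl (us @ (a + a') # vs) hs = evl (us @ a # vs) hs + evl (us @ a' # vs) hs"
proof (induction us arbitrary: hs)
  case Nil then show ?case by (cases hs) (auto simp: fun_apply algebra_simps)
next
  case (Cons u us) then show ?case by (cases hs) (auto simp: algebra_simps)
qed

lemma evl_pscale: "evl (us @ pscale c a # vs) hs = c * evl (us @ a # vs) hs"
proof (induction us arbitrary: hs)
  case Nil then show ?case by (cases hs) (auto simp: fun_apply)
next
  case (Cons u us) then show ?case by (cases hs) auto
qed

lemma evl_delta: "h \<notin> set hs \<Longrightarrow> evl (us @ delta h # vs) hs = 0"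
proof (induction us arbitrary: hs)
  case Nil then show ?case by (cases hs) (auto simp: delta_def)
next
  case (Cons u us) then show ?case by (cases hs) auto
qed

lemma evl_map_delta: "evl (map delta hs) hs' = (if hs' = hs then 1 else 0)"
proof (induction hs arbitrary: hs')
  case Nil then show ?case by (cases hs') auto
next
  case (Cons h hs) then show ?case by (cases hs') (auto simp: delta_def)
qed

lemma evl_trunc: "evl (map (trunc m) xs) hs = (if \<forall>h\<in>set hs. len h \<le> m then evl xs hs else 0)"
  by (induction xs hs rule: evl.induct) (auto simp: trunc_def)

lemma coeff_word_add: "coeff_word t (us @ (a + a') # vs) = coeff_word t (us @ a # vs) + coeff_word t (us @ a' # vs)"
  by (auto simp: fun_eq_iff coeff_word_def fun_apply evl_add algebra_simps)

lemma coeff_word_pscale: "coeff_word t (us @ pscale c a # vs) = pscale c (coeff_word t (us @ a # vs))"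
  by (auto simp: fun_eq_iff coeff_word_def fun_apply evl_pscale)

lemma coeff_word_One: "us \<noteq> [] \<Longrightarrow> coeff_word t (us @ delta 0 # vs) = 0"
  by (cases us) (auto simp: fun_eq_iff coeff_word_def fun_apply full_word_def evl_delta)

lemma coeff_word_trunc: "coeff_word t (map (trunc m) xs) = chain_trunc m (coeff_word t xs)"
  by (auto simp: fun_eq_iff coeff_word_def chain_trunc_def evl_trunc)

lemma full_word_eq_iff: "full_word i = full_word j \<longleftrightarrow> i = j"
  by (cases i, cases j) (auto simp: full_word_def)

lemma sum_list_full_word [simp]: "sum_list (full_word i) = fst i"
  by (simp add: full_word_def)

lemma full_word_nonempty [simp]: "full_word i \<noteq> []"
  by (simp add: full_word_def)

lemma coeff_word_delta:
  assumes "t \<noteq> 0"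
  shows "coeff_word t (map delta (full_word (g, ws))) = pscale (t powi twist_exp (full_word (g, ws))) (cell g ws)"
  by (auto simp: fun_eq_iff coeff_word_def fun_apply evl_map_delta full_word_eq_iff cell_def delta_def)

lemma coeff_iota_word:
  assumes "t \<noteq> 0"
  shows "lin_ext (coeff_word t) (iota_word t (g, ws)) = cell g ws"
  using assms
  by (simp add: iota_word_def lin_ext_pscale coeff_word_delta power_int_minus)

lemma fin_supp_iota_word [simp]: "fin_supp (iota_word t i)"
  by (simp add: iota_word_def)

lemma fin_supp_iota [simp]: "fin_supp (lin_ext (iota_word t) f)"
  by (rule fin_supp_lin_ext) simp

lemma coeff_iota:
  assumes "t \<noteq> 0" "f \<in> nchains n"
  shows "lin_ext (coeff_word t) (lin_ext (iota_word t) f) = f"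
  using assms(2)
proof (induction f rule: nchains_induct)
  case (add c g ws f)
  have "lin_ext (iota_word t) (cell g ws) = iota_word t (g, ws)"
    using add by (simp add: cell_def)
  then show ?case using add assms(1)
    by (simp add: lin_ext_add lin_ext_pscale nchains_fin_supp coeff_iota_word)
qed simp

lemma chain_trunc_linear:
  "chain_trunc m (f + h) = chain_trunc m f + chain_trunc m (h :: cell_index \<Rightarrow> 'k::field)"
  "chain_trunc m (f - h) = chain_trunc m f - chain_trunc m h"
  "chain_trunc m (pscale c f) = pscale c (chain_trunc m f)"
  by (auto simp: fun_eq_iff chain_trunc_def fun_apply)

lemma chain_trunc_nchains:
  assumes "\<And>g ws. f (g, ws) \<noteq> 0 \<Longrightarrow> length ws = n \<and> 0 \<notin> set ws"
  shows "chain_trunc m f \<in> nchains n"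
proof (rule nchainsI)
  let ?B = "{hs. set hs \<subseteq> {h. len h \<le> m} \<and> length hs = Suc n}"
  have "finite ?B" by (intro finite_lists_length_eq finite_len_le)
  moreover have "{i. chain_trunc m f i \<noteq> 0} \<subseteq> (\<lambda>hs. (sum_list hs, tl hs)) ` ?B"
  proof
    fix i
    assume "i \<in> {i. chain_trunc m f i \<noteq> 0}"
    then have i: "\<forall>h\<in>set (full_word i). len h \<le> m" "f i \<noteq> 0"
      by (auto simp: chain_trunc_def split: if_splits)
    have "length (snd i) = n" using assms[of "fst i" "snd i"] i(2) by simp
    then have "full_word i \<in> ?B" using i(1) by (auto simp: full_word_def)
    moreover have "i = (sum_list (full_word i), tl (full_word i))" by (simp add: full_word_def)
    ultimately show "i \<in> (\<lambda>hs. (sum_list hs, tl hs)) ` ?B" by blast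
  qed
  ultimately show "fin_supp (chain_trunc m f)" by (rule finite_surj)
qed (use assms in \<open>auto simp: chain_trunc_def split: if_splits\<close>)

lemma twist_exp_append: "twist_exp (xs @ ys) = twist_exp xs + snd (sum_list xs) * fst (sum_list ys) + twist_exp ys"
  by (induction xs) (auto simp: algebra_simps)

lemma twist_exp_mrg:
  assumes "Suc i < length hs"
  shows "twist_exp hs = twist_exp (mrg (+) i hs) + snd (hs ! i) * fst (hs ! Suc i)"
    and "sum_list (mrg (+) i hs) = sum_list hs"
proof -
  have "hs = take i hs @ hs ! i # hs ! Suc i # drop (i + 2) hs"
    using assms by (metis Cons_nth_drop_Suc Suc_lessD add_2_eq_Suc' append_take_drop_id)
  then obtain us a b vs where hs: "hs = us @ a # b # vs" "length us = i"
    using assms by (metis Suc_lessD length_take min.absorb4)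
  have m: "mrg (+) i hs = us @ (a + b) # vs"
    using mrg_append2[of "(+)" us 0 "a # b # vs"] by (simp add: hs)
  show "twist_exp hs = twist_exp (mrg (+) i hs) + snd (hs ! i) * fst (hs ! Suc i)"
    unfolding m using hs(2) by (auto simp: hs(1) nth_append twist_exp_append algebra_simps)
  show "sum_list (mrg (+) i hs) = sum_list hs"
    unfolding m by (simp add: hs(1) add.assoc)
qed

lemma prepend_sum: "prepend a (sum f I) = (\<Sum>i\<in>I. prepend a (f i))"
  by (induction I rule: infinite_finite_induct) (auto simp: prepend_linear)

text \<open>Unrolls the recursion to an alternating sum of faces, the shape of the Hochschild
  boundary.\<close>

lemma bdt_sum:
  fixes t :: "'k::field"
  assumes "ws \<noteq> []"
  shows "bdt t g ws =
     (\<Sum>i<length ws - 1. pscale ((- 1) ^ Suc i) (cell g (mrg (+) i ws)))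
     + pscale ((- 1) ^ length ws * chi t g (last ws)) (cell g (butlast ws))"
  using assms
proof (induction t g ws rule: bdt.induct)
  case (3 t g a b w)
  define S :: "(int \<times> int) list \<Rightarrow> cell_index \<Rightarrow> 'k"
    where "S v = (\<Sum>i<length v - 1. pscale ((- 1) ^ Suc i) (cell g (mrg (+) i v)))" for v
  define X where "X v = pscale ((- 1) ^ length v * chi t g (last v)) (cell g (butlast v))" for v
  have "S (a # b # w) = - cell g ((a + b) # w) + (\<Sum>i<length w. pscale ((- 1) ^ Suc (Suc i)) (cell g (a # mrg (+) i (b # w))))"
    by (simp add: S_def sum.lessThan_Suc_shift del: sum.lessThan_Suc)
  also have "(\<Sum>i<length w. pscale ((- 1) ^ Suc (Suc i)) (cell g (a # mrg (+) i (b # w)))) = - prepend a (S (b # w))"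
    by (simp add: S_def prepend_sum prepend_linear sum_negf[symmetric])
  finally have S: "S (a # b # w) = - cell g ((a + b) # w) - prepend a (S (b # w))" by simp
  have X: "X (a # b # w) = - prepend a (X (b # w))"
    by (simp add: X_def prepend_linear)
  have "bdt t g (b # w) = S (b # w) + X (b # w)"
    using 3 unfolding S_def X_def by simp
  then have "bdt t g (a # b # w) = S (a # b # w) + X (a # b # w)"
    by (simp add: S X prepend_linear)
  then show ?case unfolding S_def X_def .
qed auto

text \<open>Face 0 merges the first letter of \<open>ws\<close> into the zeroth letter
  \<open>x\<close>, which \<open>tl\<close> then discards; this makes the zeroth face uniform with
  the inner ones.\<close>

lemma bd_sum:
  fixes t :: "'k::field"
  assumes "length ws = Suc n"
  shows "bd t g ws = (\<Sum>i<Suc n. pscale ((- 1) ^ i) (cell g (tl (mrg (+) i (x # ws)))))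
     + pscale ((- 1) ^ Suc n * chi t g (last ws)) (cell g (butlast ws))"
proof -
  obtain a w where ws: "ws = a # w" using assms by (cases ws) auto
  have "(\<Sum>i<Suc n. pscale ((- 1) ^ i) (cell g (tl (mrg (+) i (x # ws))) :: cell_index \<Rightarrow> 'k)) =
      cell g w + (\<Sum>i<n. pscale ((- 1) ^ Suc i) (cell g (mrg (+) i ws)))"
    by (simp add: sum.lessThan_Suc_shift ws del: sum.lessThan_Suc)
  moreover have "bd t g ws = cell g w + bdt t g ws" by (simp add: bd_def ws)
  moreover have "ws \<noteq> []" by (simp add: ws)
  note bdt_sum[OF this, of t g, unfolded assms diff_Suc_1]
  ultimately show ?thesis by (simp only: add.assoc)
qed

type_synonym 'v form = "(int \<times> int \<Rightarrow> 'v fract) list \<Rightarrow> 'v fract"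

context unit_twist
begin

abbreviation "alg d \<equiv> torus_alg d l"
abbreviation "carr d \<equiv> Carrier (torus_alg d l)"
abbreviation "tw \<equiv> to_fract l"
abbreviation "rel d \<equiv> form_rel (torus_alg d l)"
abbreviation "free d \<equiv> form_free (torus_alg d l)"

definition lat :: "bool \<Rightarrow> nat \<Rightarrow> nat \<Rightarrow> 'v form set" where
  "lat d n N = form_lattice (alg d) n (bset d N)"

lemma l_nonzero [simp]: "l \<noteq> 0"
  using unit by auto

lemma tw_nonzero: "tw \<noteq> 0"
  by simp

lemma Carrier_0: "0 \<in> carr d"
  using Carrier_pscale[OF delta_Carrier[of 0 d], of 0] by simp

lemma rel_subspace: "pscale.subspace (rel d n)"
  unfolding form_rel_def by (rule pscale.subspace_span)

lemmas rel_0 [simp] = pscale.subspace_0[OF rel_subspace]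
  and rel_plus = pscale.subspace_add[OF rel_subspace]
  and rel_mult = pscale.subspace_scale[OF rel_subspace]
  and rel_sum = pscale.subspace_sum[OF rel_subspace]

lemma rel_trans: "f - h \<in> rel d n \<Longrightarrow> h - k \<in> rel d n \<Longrightarrow> f - k \<in> rel d n"
  by (drule (1) rel_plus) simp

lemma rel_add:
  assumes "length us + length vs = n" "set us \<subseteq> carr d" "set vs \<subseteq> carr d" "a \<in> carr d" "a' \<in> carr d"
  shows "delta (us @ (a + a') # vs) - delta (us @ a # vs) - delta (us @ a' # vs) \<in> rel d n"
  unfolding form_rel_def
proof (rule pscale.span_base, rule UnI1, rule UnI1, safe)
  show "\<exists>xs i b b'. delta (us @ (a + a') # vs) - delta (us @ a # vs) - delta (us @ a' # vs) =
      delta (xs[i := b + b']) - delta (xs[i := b]) - delta (xs[i := b']) \<and>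
      xs \<in> words (carr d) n \<and> i \<le> n \<and> b \<in> carr d \<and> b' \<in> carr d"
    using assms
    by (intro exI[of _ "us @ a # vs"] exI[of _ "length us"] exI[of _ a] exI[of _ a']) (auto simp: words_append)
qed

lemma rel_scale:
  assumes "length us + length vs = n" "set us \<subseteq> carr d" "set vs \<subseteq> carr d" "a \<in> carr d"
  shows "delta (us @ pscale c a # vs) - pscale c (delta (us @ a # vs)) \<in> rel d n"
  unfolding form_rel_def
proof (rule pscale.span_base, rule UnI1, rule UnI2, safe)
  show "\<exists>xs i k b. delta (us @ pscale c a # vs) - pscale c (delta (us @ a # vs)) =
      delta (xs[i := Scale (alg d) k b]) - pscale k (delta (xs[i := b])) \<and>
      xs \<in> words (carr d) n \<and> i \<le> n \<and> b \<in> carr d"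
    using assms
    by (intro exI[of _ "us @ a # vs"] exI[of _ "length us"] exI[of _ c] exI[of _ a])
      (auto simp: words_append torus_alg_simps)
qed

lemma rel_One:
  assumes "length us + length vs = n" "set us \<subseteq> carr d" "set vs \<subseteq> carr d" "us \<noteq> []"
  shows "delta (us @ delta 0 # vs) \<in> rel d n"
  unfolding form_rel_def
proof (rule pscale.span_base, rule UnI2, safe)
  show "\<exists>xs i. delta (us @ delta 0 # vs) = delta (xs[i := One (alg d)]) \<and>
      xs \<in> words (carr d) n \<and> 1 \<le> i \<and> i \<le> n"
    using assms
    by (intro exI[of _ "us @ 0 # vs"] exI[of _ "length us"])
      (auto simp: words_append torus_alg_simps Carrier_0 Suc_le_eq)
qed

text \<open>List updates are replaced by a splitting of the word around the slot, the form in which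
  faces can be computed.\<close>

lemma rel_subset:
  assumes T: "pscale.subspace T"
    and "\<And>us vs a a'. length us + length vs = n \<Longrightarrow> set us \<subseteq> carr d \<Longrightarrow> set vs \<subseteq> carr d \<Longrightarrow> a \<in> carr d \<Longrightarrow> a' \<in> carr d
      \<Longrightarrow> delta (us @ (a + a') # vs) - delta (us @ a # vs) - delta (us @ a' # vs) \<in> T"
    and "\<And>us vs c a. length us + length vs = n \<Longrightarrow> set us \<subseteq> carr d \<Longrightarrow> set vs \<subseteq> carr d \<Longrightarrow> a \<in> carr d
      \<Longrightarrow> delta (us @ pscale c a # vs) - pscale c (delta (us @ a # vs)) \<in> T"
    and "\<And>us vs. length us + length vs = n \<Longrightarrow> set us \<subseteq> carr d \<Longrightarrow> set vs \<subseteq> carr d \<Longrightarrow> us \<noteq> []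
      \<Longrightarrow> delta (us @ delta 0 # vs) \<in> T"
  shows "rel d n \<subseteq> T"
  unfolding form_rel_def
proof (rule pscale.span_minimal[OF _ T], safe)
  fix xs i a a'
  assume *: "xs \<in> words (carr d) n" "i \<le> n" and a: "a \<in> carr d" "a' \<in> carr d"
  from * obtain us vs where "\<And>a. xs[i := a] = us @ a # vs" "length us + length vs = n"
    "set us \<subseteq> carr d" "set vs \<subseteq> carr d" by (rule words_update_cases) blast
  with a assms(2)[of us vs] show "delta (xs[i := a + a']) - delta (xs[i := a]) - delta (xs[i := a']) \<in> T"
    by simp
next
  fix xs i c a
  assume *: "xs \<in> words (carr d) n" "i \<le> n" and a: "a \<in> carr d"
  from * obtain us vs where "\<And>a. xs[i := a] = us @ a # vs" "length us + length vs = n"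
    "set us \<subseteq> carr d" "set vs \<subseteq> carr d" by (rule words_update_cases) blast
  with a assms(3)[of us vs] show "delta (xs[i := Scale (alg d) c a]) - pscale c (delta (xs[i := a])) \<in> T"
    by (simp add: torus_alg_simps)
next
  fix xs i
  assume *: "xs \<in> words (carr d) n" "1 \<le> i" "i \<le> n"
  from *(1,3) obtain us vs where "length us = i" "\<And>a. xs[i := a] = us @ a # vs" "length us + length vs = n"
    "set us \<subseteq> carr d" "set vs \<subseteq> carr d" by (rule words_update_cases) blast
  moreover from this(1) *(2) have "us \<noteq> []" by auto
  ultimately show "delta (xs[i := One (alg d)]) \<in> T"
    using assms(4)[of us vs] by (auto simp: torus_alg_simps)
qed

lemma free_subspace: "pscale.subspace (free d n)"
  unfolding pscale.subspace_def form_free_def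
proof (safe)
  fix x y :: "'v form" and w
  assume "{xs. x xs \<noteq> 0} \<subseteq> words (carr d) n" "{xs. y xs \<noteq> 0} \<subseteq> words (carr d) n" "(x + y) w \<noteq> 0"
  then have "x w \<noteq> 0 \<or> y w \<noteq> 0" by (auto simp: fun_apply)
  then show "w \<in> words (carr d) n" using \<open>{xs. x xs \<noteq> 0} \<subseteq> _\<close> \<open>{xs. y xs \<noteq> 0} \<subseteq> _\<close> by blast
next
  fix c and x :: "'v form" and w
  assume "{xs. x xs \<noteq> 0} \<subseteq> words (carr d) n" "pscale c x w \<noteq> 0"
  then show "w \<in> words (carr d) n" by (auto simp: fun_apply)
next
  fix w
  assume "(0 :: 'v form) w \<noteq> 0"
  then show "w \<in> words (carr d) n" by (simp add: fun_apply)
qed simp_all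

lemma free_fin_supp: "f \<in> free d n \<Longrightarrow> fin_supp f"
  by (simp add: form_free_def)

lemma delta_free: "xs \<in> words (carr d) n \<Longrightarrow> delta xs \<in> free d n"
  by (auto simp: form_free_def delta_def split: if_splits)

lemmas free_plus = pscale.subspace_add[OF free_subspace]
  and free_minus = pscale.subspace_diff[OF free_subspace]
  and free_mult = pscale.subspace_scale[OF free_subspace]
  and free_sum = pscale.subspace_sum[OF free_subspace]

lemma rel_free: "rel d n \<subseteq> free d n"
  by (rule rel_subset[OF free_subspace])
    (auto intro!: free_minus free_mult delta_free simp: words_append Carrier_add Carrier_pscale delta_Carrier)

lemma rel_fin_supp: "r \<in> rel d n \<Longrightarrow> fin_supp r"
  using rel_free free_fin_supp by blast

lemma form_free_induct [consumes 1, case_names zero add]: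
  assumes "f \<in> free d n"
    and "P 0"
    and "\<And>c xs f. xs \<in> words (carr d) n \<Longrightarrow> f \<in> free d n \<Longrightarrow> P f \<Longrightarrow> P (pscale c (delta xs) + f)"
  shows "P f"
proof -
  have "fin_supp f" using assms(1) by (rule free_fin_supp)
  then show ?thesis using assms(1)
  proof (induction f rule: fin_supp_induct)
    case (add c xs f)
    have "(pscale c (delta xs) + f) xs \<noteq> 0" using add by (simp add: delta_def fun_apply)
    with add.prems have xs: "xs \<in> words (carr d) n" unfolding form_free_def by blast
    have "f \<in> free d n"
      using free_minus[OF add.prems free_mult[OF delta_free[OF xs], of c]] by simp
    with add.IH assms(3) xs show ?case by simp
  qed (use assms in simp)
qed

subsection \<open>Lattices of forms\<close>

lemma latE:
  assumes "f \<in> lat d n N"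
  obtains x r where "x \<in> fract_scale.span (delta ` words (bset d N) n)" "r \<in> rel d n" "f = x + r"
  using assms unfolding lat_def form_lattice_def by blast

lemma lat_subspace: "fract_scale.subspace (lat d n N)"
proof -
  have "lat d n N = {x + r | x r. x \<in> fract_scale.span (delta ` words (bset d N) n) \<and> r \<in> rel d n}"
    by (simp add: lat_def form_lattice_def)
  also have "fract_scale.subspace \<dots>"
  proof (unfold fract_scale.subspace_def, intro conjI ballI allI)
    fix f h and c
    assume "f \<in> {x + r | x r. x \<in> fract_scale.span (delta ` words (bset d N) n) \<and> r \<in> rel d n}"
    then obtain x r where x: "x \<in> fract_scale.span (delta ` words (bset d N) n)" "r \<in> rel d n" "f = x + r"
      by blast
    then have "pscale (to_fract c) f = pscale (to_fract c) x + pscale (to_fract c) r"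
      by (simp add: pscale.scale_right_distrib)
    with x show "pscale (to_fract c) f \<in> {x + r | x r. x \<in> fract_scale.span (delta ` words (bset d N) n) \<and> r \<in> rel d n}"
      using fract_scale.span_scale rel_mult by blast
    assume "h \<in> {x + r | x r. x \<in> fract_scale.span (delta ` words (bset d N) n) \<and> r \<in> rel d n}"
    then obtain y s where y: "y \<in> fract_scale.span (delta ` words (bset d N) n)" "s \<in> rel d n" "h = y + s"
      by blast
    have "f + h = (x + y) + (r + s)" by (simp add: x y)
    with x y show "f + h \<in> {x + r | x r. x \<in> fract_scale.span (delta ` words (bset d N) n) \<and> r \<in> rel d n}"
      using fract_scale.span_add rel_plus by blast
  next
    have "0 = 0 + (0 :: 'v form)" by simp
    then show "0 \<in> {x + r | x r. x \<in> fract_scale.span (delta ` words (bset d N) n) \<and> r \<in> rel d n}"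
      using fract_scale.span_zero rel_0 by blast
  qed
  finally show ?thesis .
qed

lemmas lat_0 [simp] = fract_scale.subspace_0[OF lat_subspace]
  and lat_plus = fract_scale.subspace_add[OF lat_subspace]
  and lat_minus = fract_scale.subspace_diff[OF lat_subspace]
  and lat_mult = fract_scale.subspace_scale[OF lat_subspace]
  and lat_sum = fract_scale.subspace_sum[OF lat_subspace]

lemma lat_word: "xs \<in> words (bset d N) n \<Longrightarrow> delta xs \<in> lat d n N"
proof -
  assume "xs \<in> words (bset d N) n"
  then have "delta xs \<in> fract_scale.span (delta ` words (bset d N) n)" by (intro fract_scale.span_base) simp
  moreover have "delta xs = delta xs + (0 :: 'v form)" by simp
  ultimately show ?thesis unfolding lat_def form_lattice_def using rel_0 by blast
qed

lemma lat_rel: "r \<in> rel d n \<Longrightarrow> r \<in> lat d n N"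
proof -
  assume "r \<in> rel d n"
  moreover have "r = 0 + r" by simp
  ultimately show ?thesis unfolding lat_def form_lattice_def using fract_scale.span_zero by blast
qed

lemma lat_frac_mult: "a \<in> frac_ideal 0 \<Longrightarrow> f \<in> lat d n N \<Longrightarrow> pscale a f \<in> lat d n N"
  using lat_mult frac_ideal_0E by metis

lemma lat_subset:
  assumes T: "fract_scale.subspace T" and "\<And>xs. xs \<in> words (bset d N) n \<Longrightarrow> delta xs \<in> T"
    and "rel d n \<subseteq> T"
  shows "lat d n N \<subseteq> T"
proof
  fix f
  assume "f \<in> lat d n N"
  then obtain x r where *: "x \<in> fract_scale.span (delta ` words (bset d N) n)" "r \<in> rel d n" "f = x + r"
    by (rule latE)
  have "fract_scale.span (delta ` words (bset d N) n) \<subseteq> T"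
    by (rule fract_scale.span_minimal[OF _ T]) (use assms(2) in auto)
  with * assms(3) show "f \<in> T" using fract_scale.subspace_add[OF T] by blast
qed

lemma lat_mono: "N \<le> N' \<Longrightarrow> lat d n N \<subseteq> lat d n N'"
proof (rule lat_subset[OF lat_subspace])
  assume "N \<le> N'"
  then have "bset d N \<subseteq> bset d N'" by (blast intro: bset_mono)
  then show "delta xs \<in> lat d n N'" if "xs \<in> words (bset d N) n" for xs
    using that by (intro lat_word) (auto simp: words_def)
qed (blast intro: lat_rel)

text \<open>The finitely many words of a form have their letters in a common \<open>bset\<close>,
  and one power of \<open>unif\<close> clears the finitely many scalars.\<close>

lemma free_absorbed:
  assumes "f \<in> free d n"
  shows "\<exists>N r. pscale (unif_fract ^ r) f \<in> lat d n N"
  using assms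
proof (induction f rule: form_free_induct)
  case (add c xs f)
  then obtain N r where N: "pscale (unif_fract ^ r) f \<in> lat d n N" by blast
  obtain s where s: "c \<in> frac_ideal (- int s)" using ex_frac_ideal by blast
  have bounded: "\<exists>M. set ys \<subseteq> bset d M" if "set ys \<subseteq> carr d" for ys
    using that
  proof (induction ys)
    case (Cons y ys)
    then obtain M M' where "set ys \<subseteq> bset d M" "y \<in> bset d M'" by (auto simp: Carrier_torus_alg)
    then have "set (y # ys) \<subseteq> bset d (M + M')" using bset_mono[of M "M + M'"] bset_mono[of M' "M + M'"] by auto
    then show ?case ..
  qed auto
  obtain M where M: "xs \<in> words (bset d M) n" using add(1) bounded[of xs] by (auto simp: words_def)
  have "pscale (unif_fract ^ (r + s)) (pscale c (delta xs) + f) =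
      pscale (unif_fract ^ r * (c * unif_fract ^ s)) (delta xs) + pscale (unif_fract ^ s) (pscale (unif_fract ^ r) f)"
    by (simp add: pscale.scale_right_distrib power_add mult_ac)
  moreover have "c * unif_fract ^ s \<in> frac_ideal 0"
    using frac_ideal_mult[OF s unif_fract_powi_in[of "int s"]] by simp
  then have "unif_fract ^ r * (c * unif_fract ^ s) \<in> frac_ideal 0"
    using frac_ideal_scale to_fract_in_frac_ideal[of "unif ^ r"] by (metis to_fract_power)
  then have "pscale (unif_fract ^ r * (c * unif_fract ^ s)) (delta xs) \<in> lat d n (N + M)"
    using lat_mono[of M "N + M"] by (intro lat_frac_mult subsetD[OF _ lat_word[OF M]]) auto
  moreover have "pscale (unif_fract ^ s) (pscale (unif_fract ^ r) f) \<in> lat d n (N + M)"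
    using N lat_mono[of N "N + M" d n]
    by (intro lat_frac_mult[OF to_fract_in_frac_ideal[of "unif ^ s", unfolded to_fract_power]]) auto
  ultimately show ?case by (metis lat_plus)
qed (auto intro: exI[of _ 0])

subsection \<open>The Hochschild boundary on words\<close>

text \<open>Every face of a word is linear in each letter. The last clause lets a letter \<open>1\<close> that is not in
  front survive in all faces but two, and these two cancel in the boundary.\<close>

lemma face_slot:
  assumes "length us + length vs = Suc n" "set us \<subseteq> carr d" "set vs \<subseteq> carr d" "i \<le> Suc n"
  obtains us' vs' T where "\<And>a. a \<in> carr d \<Longrightarrow> face (Mult (alg d)) i (us @ a # vs) = us' @ T a # vs'"
    "length us' + length vs' = n" "set us' \<subseteq> carr d" "set vs' \<subseteq> carr d"
    "\<And>a. a \<in> carr d \<Longrightarrow> T a \<in> carr d"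
    "\<And>a b. a \<in> carr d \<Longrightarrow> b \<in> carr d \<Longrightarrow> T (a + b) = T a + T b"
    "\<And>a c. a \<in> carr d \<Longrightarrow> T (pscale c a) = pscale c (T a)"
    "us \<noteq> [] \<Longrightarrow> i \<noteq> length us \<Longrightarrow> Suc i \<noteq> length us \<Longrightarrow> us' \<noteq> [] \<and> T (delta 0) = delta 0"
proof -
  let ?M = "Mult (alg d)"
  have mrg_carr: "set (mrg ?M j ys) \<subseteq> carr d" if "Suc j < length ys" "set ys \<subseteq> carr d" for j ys
    using that Mult_Carrier by (intro mrg_set_subset[of _ _ "carr d"]) auto
  \<comment> \<open>For an inner face the slot lies to the right of the merged pair, is its right or
    left member, or lies to its left; for the cyclic face it is the first, the last or an interior
    letter.\<close>
  consider "Suc i < length us" | "Suc i = length us" | "i = length us" "vs \<noteq> []"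
    | j where "i = length us + Suc j" "Suc j < length vs"
    | "i = Suc n" "us = []" | "i = Suc n" "vs = []" | "i = Suc n" "us \<noteq> []" "vs \<noteq> []"
  proof -
    assume *: "Suc i < length us \<Longrightarrow> thesis" "Suc i = length us \<Longrightarrow> thesis" "i = length us \<Longrightarrow> vs \<noteq> [] \<Longrightarrow> thesis"
      "\<And>j. i = length us + Suc j \<Longrightarrow> Suc j < length vs \<Longrightarrow> thesis"
      "i = Suc n \<Longrightarrow> us = [] \<Longrightarrow> thesis" "i = Suc n \<Longrightarrow> vs = [] \<Longrightarrow> thesis"
      "i = Suc n \<Longrightarrow> us \<noteq> [] \<Longrightarrow> vs \<noteq> [] \<Longrightarrow> thesis"
    show thesis
    proof (cases "i = Suc n")
      case True then show ?thesis using *(5,6,7) by blast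
    next
      case False
      then have i: "i < length us + length vs" using assms by simp
      consider "Suc i < length us" | "Suc i = length us" | "i = length us" | j where "i = length us + Suc j"
        by (metis Suc_lessI add_Suc_right less_imp_Suc_add linorder_neqE_nat)
      then show ?thesis by cases (use i * in auto)
    qed
  qed
  then show ?thesis
  proof cases
    case 1
    show ?thesis
    proof (rule that[of "mrg ?M i us" "\<lambda>a. a" vs])
      show "mrg ?M i us \<noteq> [] \<and> delta 0 = delta 0" using 1 by (simp add: mrg_def)
    qed (use 1 assms mrg_carr in \<open>auto simp: face_def mrg_append1 length_mrg\<close>)
  next
    case 2
    then obtain ws u where us: "us = ws @ [u]" by (cases us rule: rev_cases) auto
    show ?thesis
      by (rule that[of ws "?M u" vs])
        (use 2 us assms mrg_append2[of ?M ws 0] in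
          \<open>auto simp: face_def Mult_Carrier Mult_add_right Mult_pscale_right\<close>)
  next
    case 3
    then obtain v ws where vs: "vs = v # ws" by (cases vs) auto
    show ?thesis
      by (rule that[of us "\<lambda>a. ?M a v" ws])
        (use 3 vs assms mrg_append2[of ?M us 0] in
          \<open>auto simp: face_def Mult_Carrier Mult_add_left Mult_pscale_left\<close>)
  next
    case (4 j)
    show ?thesis
      by (rule that[of us "\<lambda>a. a" "mrg ?M j vs"])
        (use 4 assms mrg_carr[of j vs] mrg_append2[of ?M us "Suc j"] in \<open>auto simp: face_def length_mrg\<close>)
  next
    case 5
    then obtain ws v where vs: "vs = ws @ [v]" using assms(1) by (cases vs rule: rev_cases) auto
    show ?thesis
      by (rule that[of "[]" "?M v" ws])
        (use 5 vs assms in \<open>auto simp: face_def Mult_Carrier Mult_add_right Mult_pscale_right\<close>)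
  next
    case 6
    then obtain u ws where us: "us = u # ws" using assms(1) by (cases us) auto
    show ?thesis
      by (rule that[of "[]" "\<lambda>a. ?M a u" ws])
        (use 6 us assms in \<open>auto simp: face_def Mult_Carrier Mult_add_left Mult_pscale_left\<close>)
  next
    case 7
    then obtain u ws zs v where us: "us = u # ws" and vs: "vs = zs @ [v]"
      by (cases us; cases vs rule: rev_cases) auto
    show ?thesis
      by (rule that[of "?M v u # ws" "\<lambda>a. a" zs])
        (use 7 us vs assms in \<open>auto simp: face_def Mult_Carrier butlast_append\<close>)
  qed
qed

lemma fin_supp_b_word [simp]: "fin_supp (b_word A xs)"
  by (auto simp: b_word_def Let_def)

lemma b_word_sum:
  assumes "xs \<in> words S (Suc n)"
  shows "b_word A xs = (\<Sum>i\<le>Suc n. pscale ((- 1) ^ i) (delta (face (Mult A) i xs)))"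
  using assms by (intro b_word_face) (simp add: words_def)

lemma b_rel:
  assumes "r \<in> rel d (Suc n)"
  shows "lin_ext (b_word (alg d)) r \<in> rel d n"
proof -
  let ?b = "lin_ext (b_word (alg d))" and ?M = "Mult (alg d)"
  let ?T = "{f. fin_supp f \<and> ?b f \<in> rel d n}"
  have w: "b_word (alg d) (us @ a # vs) = (\<Sum>i\<le>Suc n. pscale ((- 1) ^ i) (delta (face ?M i (us @ a # vs))))"
    if "length us + length vs = Suc n" for us a vs
    using that by (intro b_word_face) simp
  have "rel d (Suc n) \<subseteq> ?T"
  proof (rule rel_subset)
    show "pscale.subspace ?T"
      by (simp add: pscale.subspace_def lin_ext_add lin_ext_pscale rel_plus rel_mult)
  next
    fix us vs :: "(int \<times> int \<Rightarrow> 'v fract) list" and a a'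
    assume *: "length us + length vs = Suc n" "set us \<subseteq> carr d" "set vs \<subseteq> carr d" "a \<in> carr d" "a' \<in> carr d"
    have "delta (face ?M i (us @ (a + a') # vs)) - delta (face ?M i (us @ a # vs)) - delta (face ?M i (us @ a' # vs))
        \<in> rel d n" if "i \<le> Suc n" for i
      by (rule face_slot[OF *(1,2,3) that]) (simp add: * Carrier_add rel_add)
    then have "(\<Sum>i\<le>Suc n. pscale ((- 1) ^ i) (delta (face ?M i (us @ (a + a') # vs))
        - delta (face ?M i (us @ a # vs)) - delta (face ?M i (us @ a' # vs)))) \<in> rel d n"
      by (intro rel_sum rel_mult) auto
    then show "delta (us @ (a + a') # vs) - delta (us @ a # vs) - delta (us @ a' # vs) \<in> ?T"
      by (simp add: lin_ext_diff w[OF *(1)] sum_subtractf pscale.scale_right_diff_distrib del: sum.atMost_Suc)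
  next
    fix us vs :: "(int \<times> int \<Rightarrow> 'v fract) list" and c a
    assume *: "length us + length vs = Suc n" "set us \<subseteq> carr d" "set vs \<subseteq> carr d" "a \<in> carr d"
    have "delta (face ?M i (us @ pscale c a # vs)) - pscale c (delta (face ?M i (us @ a # vs)))
        \<in> rel d n" if "i \<le> Suc n" for i
      by (rule face_slot[OF *(1,2,3) that]) (simp add: * Carrier_pscale rel_scale)
    then have "(\<Sum>i\<le>Suc n. pscale ((- 1) ^ i) (delta (face ?M i (us @ pscale c a # vs))
        - pscale c (delta (face ?M i (us @ a # vs))))) \<in> rel d n"
      by (intro rel_sum rel_mult) auto
    then show "delta (us @ pscale c a # vs) - pscale c (delta (us @ a # vs)) \<in> ?T"
      by (simp add: lin_ext_diff lin_ext_pscale w[OF *(1)] sum_subtractf pscale.scale_right_diff_distrib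
          pscale.scale_sum_right mult.commute del: sum.atMost_Suc)
  next
    fix us vs :: "(int \<times> int \<Rightarrow> 'v fract) list"
    assume *: "length us + length vs = Suc n" "set us \<subseteq> carr d" "set vs \<subseteq> carr d" and us: "us \<noteq> []"
    define F where "F i = (delta (face ?M i (us @ delta 0 # vs)) :: _ \<Rightarrow> 'v fract)" for i
    obtain ws u where ws: "us = ws @ [u]" using us by (cases us rule: rev_cases) auto
    define k where "k = length ws"
    have k: "length us = Suc k" "k \<le> n" using * by (auto simp: ws k_def)
    have other: "F i \<in> rel d n" if "i \<le> Suc n" "i \<noteq> k" "i \<noteq> Suc k" for i
      unfolding F_def
      by (rule face_slot[OF * that(1)])
        (use that us k in \<open>auto simp: delta_Carrier intro!: rel_One\<close>)
    have u: "u \<in> carr d" using * ws by auto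
    have Fk: "F k = delta (us @ vs)"
      using mrg_append2[of ?M ws 0 "u # delta 0 # vs"] Mult_One_right[OF u] k
      by (simp add: F_def face_def ws k_def)
    \<comment> \<open>If the unit is the last letter, this is the cyclic face.\<close>
    have FSk: "F (Suc k) = delta (us @ vs)"
    proof (cases vs)
      case Nil
      then obtain x ys where xy: "us = x # ys" using us by (cases us) auto
      have "x \<in> carr d" using * xy by auto
      then show ?thesis using Nil k xy by (simp add: F_def face_def Mult_One_left)
    next
      case (Cons v zs)
      then show ?thesis using * mrg_append2[of ?M us 0 "delta 0 # vs"] k
        by (simp add: F_def face_def Mult_One_left)
    qed
    have "(\<Sum>i\<le>Suc n. pscale ((- 1) ^ i) (F i)) =
        (\<Sum>i\<in>{..Suc n} - {k, Suc k}. pscale ((- 1) ^ i) (F i)) + (\<Sum>i\<in>{k, Suc k}. pscale ((- 1) ^ i) (F i))"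
      using k by (intro sum.subset_diff) auto
    also have "(\<Sum>i\<in>{k, Suc k}. pscale ((- 1) ^ i) (F i)) = 0"
      by (simp add: Fk FSk)
    finally have "(\<Sum>i\<le>Suc n. pscale ((- 1) ^ i) (F i)) = (\<Sum>i\<in>{..Suc n} - {k, Suc k}. pscale ((- 1) ^ i) (F i))"
      by simp
    also have "\<dots> \<in> rel d n" using other by (intro rel_sum rel_mult) auto
    finally have "(\<Sum>i\<le>Suc n. pscale ((- 1) ^ i) (F i)) \<in> rel d n" .
    then show "delta (us @ delta 0 # vs) \<in> ?T"
      by (simp add: w[OF *(1)] F_def del: sum.atMost_Suc)
  qed
  with assms show ?thesis by blast
qed

lemma b_lat: "\<exists>N'. \<forall>f\<in>lat d (Suc n) N. lin_ext (b_word (alg d)) f \<in> lat d n N'"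
proof -
  obtain N1 where N1: "\<And>y y'. y \<in> bset d N \<Longrightarrow> y' \<in> bset d N \<Longrightarrow> Mult (alg d) y y' \<in> bset d N1"
    using Mult_bset by blast
  define N' where "N' = N + N1"
  let ?T = "{f. fin_supp f \<and> lin_ext (b_word (alg d)) f \<in> lat d n N'}"
  have "lat d (Suc n) N \<subseteq> ?T"
  proof (rule lat_subset)
    show "fract_scale.subspace ?T"
      by (simp add: fract_scale.subspace_def lin_ext_add lin_ext_pscale lat_plus lat_mult)
    show "rel d (Suc n) \<subseteq> ?T" using b_rel lat_rel rel_fin_supp by blast
  next
    fix xs :: "(int \<times> int \<Rightarrow> 'v fract) list"
    assume xs: "xs \<in> words (bset d N) (Suc n)"
    have "face (Mult (alg d)) i xs \<in> words (bset d N') n" for i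
      using xs N1 bset_mono[of N1 N'] bset_mono[of N N'] by (intro face_words[of _ "bset d N"]) (auto simp: N'_def)
    then have "pscale ((- 1) ^ i) (delta (face (Mult (alg d)) i xs)) \<in> lat d n N'" for i
      by (intro lat_frac_mult lat_word) (cases "even i"; simp add: frac_ideal_of_int[of "-1", simplified])
    then show "delta xs \<in> ?T" by (simp add: b_word_sum[OF xs] lat_sum del: sum.atMost_Suc)
  qed
  then show ?thesis by blast
qed

subsection \<open>Comparison with normalized chains\<close>

lemma iota_word_degenerate:
  assumes "0 \<in> set ws"
  shows "iota_word tw (g, ws) \<in> rel d (length ws)"
proof -
  from assms obtain us vs where ws: "ws = us @ 0 # vs" by (metis split_list)
  have "delta (map delta ((g - sum_list ws) # us) @ delta 0 # map delta vs) \<in> rel d (length ws)"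
    by (rule rel_One) (auto simp: ws delta_Carrier)
  then show ?thesis unfolding iota_word_def full_word_def by (intro rel_mult) (simp add: ws)
qed

lemma iota_cell: "iota_word tw (g, ws) - lin_ext (iota_word tw) (cell g ws) \<in> rel d (length ws)"
  using iota_word_degenerate[of ws g d] by (simp add: cell_def)

lemma iota_free: "f \<in> nchains n \<Longrightarrow> lin_ext (iota_word tw) f \<in> free d n"
proof (induction f rule: nchains_induct)
  case (add c g ws f)
  have "iota_word tw (g, ws) \<in> free d n"
    unfolding iota_word_def full_word_def using add(1)
    by (intro free_mult delta_free) (auto simp: words_def delta_Carrier)
  with add show ?case
    by (simp add: lin_ext_add lin_ext_pscale nchains_fin_supp free_plus free_mult cell_def)
qed (simp add: pscale.subspace_0[OF free_subspace])

text \<open>Face by face: merging neighbours changes the power of \<open>l\<close> exactly as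
  \<open>twist_exp\<close> records, so inner faces carry no scalar, while the cyclic face picks up
  \<open>chi\<close>. The comparison is modulo relations because products are scalar multiples of
  monomials and a merged letter may be the unit.\<close>

lemma b_iota_word:
  assumes ws: "length ws = Suc n"
  shows "lin_ext (b_word (alg d)) (iota_word tw (g, ws)) - lin_ext (iota_word tw) (bd tw g ws) \<in> rel d n"
proof -
  let ?h = "full_word (g, ws)" and ?M = "Mult (alg d)" and ?i = "lin_ext (iota_word tw)"
  let ?k = "tw powi (- twist_exp ?h)"
  have len: "length ?h = Suc (Suc n)" using ws by (simp add: full_word_def)
  have inner: "pscale ?k (delta (face ?M i (map delta ?h))) - ?i (cell g (tl (mrg (+) i ?h))) \<in> rel d n"
    if i: "i < Suc n" for i
  proof -
    have "?h = take i ?h @ ?h ! i # ?h ! Suc i # drop (i + 2) ?h"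
      using i len by (metis Cons_nth_drop_Suc Suc_lessD Suc_mono add_2_eq_Suc' append_take_drop_id)
    then obtain us a b vs where hs: "?h = us @ a # b # vs" "length us = i"
      using i len by (metis Suc_lessD length_take less_SucI min.absorb4)
    have m: "mrg (+) i ?h = us @ (a + b) # vs"
      using mrg_append2[of "(+)" us 0 "a # b # vs"] by (simp add: hs)
    have f: "face ?M i (map delta ?h) =
        map delta us @ pscale (tw powi (snd a * fst b)) (delta (a + b)) # map delta vs"
      using mrg_append2[of ?M "map delta us" 0 "delta a # delta b # map delta vs"] len i hs
      by (simp add: face_def Mult_delta_delta)
    have ab: "?h ! i = a" "?h ! Suc i = b" using hs by (auto simp: nth_append)
    have exp: "twist_exp ?h = twist_exp (us @ (a + b) # vs) + snd a * fst b"
      using twist_exp_mrg(1)[of i ?h] i len by (simp only: ab m)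
    have full: "full_word (g, tl (us @ (a + b) # vs)) = us @ (a + b) # vs"
    proof -
      have "sum_list (us @ (a + b) # vs) = g"
        using twist_exp_mrg(2)[of i ?h] i len by (simp only: m) simp
      then have "g - sum_list (tl (us @ (a + b) # vs)) = hd (us @ (a + b) # vs)"
        by (cases us) (auto simp: algebra_simps)
      then show ?thesis unfolding full_word_def by (cases us) auto
    qed
    have l: "length us + length vs = n" using hs len by simp
    have 1: "pscale ?k (delta (face ?M i (map delta ?h)))
        - pscale (?k * tw powi (snd a * fst b)) (delta (map delta us @ delta (a + b) # map delta vs))
        \<in> rel d n"
      unfolding f pscale.scale_scale[symmetric] pscale.scale_right_diff_distrib[symmetric]
      by (intro rel_mult rel_scale) (use l in \<open>auto simp: delta_Carrier\<close>)
    have "?k * tw powi (snd a * fst b) = tw powi (- twist_exp (us @ (a + b) # vs))"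
      by (subst power_int_add[symmetric]) (auto simp: exp)
    then have 2: "pscale (?k * tw powi (snd a * fst b)) (delta (map delta us @ delta (a + b) # map delta vs))
        = iota_word tw (g, tl (us @ (a + b) # vs))"
      by (simp add: iota_word_def full)
    have "length (tl (us @ (a + b) # vs)) = n" using l by simp
    with iota_cell[of g "tl (us @ (a + b) # vs)" d] 1 show ?thesis
      unfolding 2 m by (metis rel_trans)
  qed
  have last: "pscale ?k (delta (face ?M (Suc n) (map delta ?h)))
      - ?i (pscale (chi tw g (last ws)) (cell g (butlast ws))) \<in> rel d n"
  proof -
    define a b us where "a = last ws" and "b = g - sum_list ws" and "us = butlast ws"
    have ws': "ws = us @ [a]" using ws by (cases ws rule: rev_cases) (auto simp: a_def us_def)
    have h: "?h = b # us @ [a]" by (simp add: full_word_def b_def ws')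
    have l: "length us = n" using ws by (simp add: ws')
    have f: "face ?M (Suc n) (map delta ?h) = [] @ pscale (tw powi (snd a * fst b)) (delta (a + b)) # map delta us"
      using l by (simp add: face_def h Mult_delta_delta butlast_append)
    have full: "full_word (g, us) = (a + b) # us"
      by (simp add: full_word_def b_def ws' algebra_simps)
    have g: "g = b + sum_list us + a" by (simp add: b_def ws' algebra_simps)
    \<comment> \<open>The excess over the normalization of the shortened word is the exponent of
      \<open>chi tw g a\<close>.\<close>
    have exp: "- twist_exp ?h + snd a * fst b = - twist_exp ((a + b) # us) + (snd a * fst g - fst a * snd g)"
      unfolding h unfolding g by (simp add: twist_exp_append algebra_simps)
    have 1: "pscale ?k (delta (face ?M (Suc n) (map delta ?h)))
        - pscale (?k * tw powi (snd a * fst b)) (delta ([] @ delta (a + b) # map delta us)) \<in> rel d n"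
      unfolding f pscale.scale_scale[symmetric] pscale.scale_right_diff_distrib[symmetric]
      by (intro rel_mult rel_scale) (use l in \<open>auto simp: delta_Carrier\<close>)
    have "?k * tw powi (snd a * fst b) = tw powi (- twist_exp ?h + snd a * fst b)"
      by (rule power_int_add[symmetric]) simp
    also have "\<dots> = tw powi (- twist_exp ((a + b) # us)) * chi tw g a"
      unfolding exp chi_def by (rule power_int_add) simp
    finally have "?k * tw powi (snd a * fst b) = tw powi (- twist_exp ((a + b) # us)) * chi tw g a" .
    then have 2: "pscale (?k * tw powi (snd a * fst b)) (delta ([] @ delta (a + b) # map delta us))
        = pscale (chi tw g a) (iota_word tw (g, us))"
      by (simp add: iota_word_def full mult.commute)
    have "pscale (chi tw g a) (iota_word tw (g, us)) - ?i (pscale (chi tw g a) (cell g us)) \<in> rel d n"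
      using rel_mult[OF iota_cell[of g us d], of "chi tw g a"] l
      by (simp add: lin_ext_pscale pscale.scale_right_diff_distrib)
    with 1 show ?thesis unfolding 2 a_def[symmetric] us_def[symmetric] by (rule rel_trans)
  qed
  have "lin_ext (b_word (alg d)) (iota_word tw (g, ws)) =
      (\<Sum>i<Suc n. pscale ((- 1) ^ i) (pscale ?k (delta (face ?M i (map delta ?h)))))
      + pscale ((- 1) ^ Suc n) (pscale ?k (delta (face ?M (Suc n) (map delta ?h))))"
    unfolding iota_word_def using b_word_face[of "map delta ?h" n "alg d"] len
    by (simp add: lin_ext_pscale lessThan_Suc_atMost[symmetric] pscale.scale_right_distrib
        pscale.scale_sum_right mult.commute del: power_Suc)
  moreover have "?i (bd tw g ws) =
      (\<Sum>i<Suc n. pscale ((- 1) ^ i) (?i (cell g (tl (mrg (+) i ?h)))))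
      + pscale ((- 1) ^ Suc n) (?i (pscale (chi tw g (last ws)) (cell g (butlast ws))))"
    unfolding full_word_def snd_conv bd_sum[OF ws, of tw g "fst (g, ws) - sum_list ws"]
    by (simp add: lin_ext_add lin_ext_sum lin_ext_pscale del: sum.lessThan_Suc power_Suc)
  ultimately have "lin_ext (b_word (alg d)) (iota_word tw (g, ws)) - ?i (bd tw g ws) =
      (\<Sum>i<Suc n. pscale ((- 1) ^ i) (pscale ?k (delta (face ?M i (map delta ?h))) - ?i (cell g (tl (mrg (+) i ?h)))))
      + pscale ((- 1) ^ Suc n) (pscale ?k (delta (face ?M (Suc n) (map delta ?h)))
        - ?i (pscale (chi tw g (last ws)) (cell g (butlast ws))))"
    by (simp add: sum_subtractf pscale.scale_right_diff_distrib algebra_simps del: sum.lessThan_Suc power_Suc)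
  also have "\<dots> \<in> rel d n"
    using inner last by (intro rel_plus rel_sum rel_mult) auto
  finally show ?thesis .
qed

lemma b_iota:
  assumes "f \<in> nchains (Suc n)"
  shows "lin_ext (b_word (alg d)) (lin_ext (iota_word tw) f) - lin_ext (iota_word tw) (linop (bd tw) f)
     \<in> rel d n"
  using assms
proof (induction f rule: nchains_induct)
  case (add c g ws f)
  let ?b = "lin_ext (b_word (alg d))" and ?i = "lin_ext (iota_word tw)"
  have c: "?i (cell g ws) = iota_word tw (g, ws)" using add by (simp add: cell_def)
  have fs: "fin_supp (linop (bd tw) f)" by (simp add: linop_def split_def)
  have i: "fin_supp (iota_word tw (g, ws))" by (simp add: iota_word_def)
  have "?b (?i (pscale c (cell g ws) + f)) - ?i (linop (bd tw) (pscale c (cell g ws) + f)) =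
      pscale c (?b (iota_word tw (g, ws)) - ?i (bd tw g ws)) + (?b (?i f) - ?i (linop (bd tw) f))"
    using add fs i
    by (simp add: lin_ext_add lin_ext_pscale linop_add linop_pscale nchains_fin_supp c pscale.scale_right_diff_distrib)
  then show ?case using add b_iota_word[OF add(1)] by (simp add: rel_plus rel_mult)
qed simp

lemma coeff_rel:
  assumes "r \<in> rel d n"
  shows "lin_ext (coeff_word tw) r = 0"
proof -
  have "rel d n \<subseteq> {f. fin_supp f \<and> lin_ext (coeff_word tw) f = 0}"
    by (rule rel_subset)
      (simp_all add: pscale.subspace_def lin_ext_add lin_ext_diff lin_ext_pscale coeff_word_add
        coeff_word_pscale coeff_word_One)
  with assms show ?thesis by blast
qed

text \<open>Iterates \<open>growth_mult\<close>, one letter at a time.\<close>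

lemma evl_growth:
  "\<exists>N'. \<forall>xs hs. length xs = n \<and> set xs \<subseteq> (bset d N :: (int \<times> int \<Rightarrow> 'v fract) set) \<longrightarrow> evl xs hs \<in> growth d N' (sum_list (map len hs))"
proof (induction n)
  case 0
  have "evl [] hs \<in> growth d 0 (sum_list (map len hs))" for hs :: "(int \<times> int) list"
    by (cases hs) (auto simp: growth_def)
  then show ?case by auto
next
  case (Suc n)
  then obtain N1 where N1: "\<And>(xs :: (int \<times> int \<Rightarrow> 'v fract) list) hs. length xs = n \<Longrightarrow> set xs \<subseteq> bset d N \<Longrightarrow> evl xs hs \<in> growth d N1 (sum_list (map len hs))"
    by blast
  define N' where "N' = 2 * (N + N1) + 1"
  have "evl xs hs \<in> growth d N' (sum_list (map len hs))" if L: "length xs = Suc n" "set xs \<subseteq> bset d N" for xs :: "(int \<times> int \<Rightarrow> 'v fract) list" and hs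
  proof (cases hs)
    case (Cons h ks)
    obtain a ys where xs: "xs = a # ys" using L by (cases xs) auto
    have "a h \<in> growth d (N + N1) (len h)" using L by (intro growth_mono[OF _ bsetD[of a d N]]) (auto simp: xs)
    moreover have "evl ys ks \<in> growth d (N + N1) (sum_list (map len ks))"
      using L by (intro growth_mono[OF _ N1]) (auto simp: xs)
    ultimately show ?thesis using growth_mult by (fastforce simp: xs Cons N'_def)
  next
    case Nil
    then show ?thesis using L by (cases xs) auto
  qed
  then show ?case by blast
qed

lemma len_sum_list: "len (sum_list hs) \<le> sum_list (map len hs)"
  by (induction hs) (auto intro: order_trans[OF len_add])

lemma cell_len_full_word: "cell_len i \<le> 2 * sum_list (map len (full_word i))"
  "sum_list (map len (full_word i)) \<le> 2 * cell_len i"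
proof -
  have "len (fst i) \<le> sum_list (map len (full_word i))"
    using len_sum_list[of "full_word i"] by simp
  then show "cell_len i \<le> 2 * sum_list (map len (full_word i))"
    by (simp add: cell_len_def full_word_def)
  have "len (fst i - sum_list (snd i)) \<le> len (fst i) + sum_list (map len (snd i))"
    using len_add[of "fst i" "- sum_list (snd i)"] len_sum_list[of "snd i"] by simp
  then show "sum_list (map len (full_word i)) \<le> 2 * cell_len i"
    by (simp add: cell_len_def full_word_def)
qed

lemma chain_lat_subspace: "fract_scale.subspace (chain_lat d N)"
  unfolding fract_scale.subspace_def chain_lat_def
  by (auto simp: fun_apply simp del: split_paired_All intro: growth_add growth_scale to_fract_in_frac_ideal)

text \<open>A coefficient of a word is a unit times a product of coefficients of its letters, so it
  decays with the length of the full word, which is at least half the length of the cell.\<close>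

lemma coeff_lat: "\<exists>N'. \<forall>f\<in>lat d n N. lin_ext (coeff_word tw) f \<in> chain_lat d N'"
proof -
  obtain N1 where N1: "\<And>(xs :: (int \<times> int \<Rightarrow> 'v fract) list) hs. length xs = Suc n \<Longrightarrow> set xs \<subseteq> bset d N \<Longrightarrow> evl xs hs \<in> growth d N1 (sum_list (map len hs))"
    using evl_growth[of "Suc n" d N] by blast
  obtain N' where N': "\<And>m m' (x :: 'v fract). m \<le> 2 * m' + 2 \<Longrightarrow> x \<in> growth d N1 m' \<Longrightarrow> x \<in> growth d N' m"
    using growth_control[of 2 d N1] by blast
  let ?T = "{f. fin_supp f \<and> lin_ext (coeff_word tw) f \<in> chain_lat d N'}"
  have "lat d n N \<subseteq> ?T"
  proof (rule lat_subset)
    show "fract_scale.subspace ?T"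
      using chain_lat_subspace[of d N']
      by (simp add: fract_scale.subspace_def lin_ext_add lin_ext_pscale) blast
    show "rel d n \<subseteq> ?T"
      using coeff_rel rel_fin_supp fract_scale.subspace_0[OF chain_lat_subspace] by fastforce
  next
    fix xs :: "(int \<times> int \<Rightarrow> 'v fract) list"
    assume xs: "xs \<in> words (bset d N) n"
    have "coeff_word tw xs i \<in> growth d N' (cell_len i)" for i
    proof -
      have "evl xs (full_word i) \<in> growth d N1 (sum_list (map len (full_word i)))"
        using xs by (intro N1) (auto simp: words_def)
      then have "evl xs (full_word i) \<in> growth d N' (cell_len i)"
        using cell_len_full_word(1)[of i] by (intro N'[of _ "sum_list (map len (full_word i))"]) auto
      then show ?thesis
        by (simp add: coeff_word_def growth_scale unit_powi_in_frac_ideal[OF unit])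
    qed
    then show "delta xs \<in> ?T" by (simp add: chain_lat_def)
  qed
  then show ?thesis by blast
qed

lemma rel_scale_all:
  assumes "length cs = length as" "length us + length as = Suc n" "set us \<subseteq> carr d" "set as \<subseteq> carr d"
  shows "delta (us @ map2 pscale cs as) - pscale (prod_list cs) (delta (us @ as)) \<in> rel d n"
  using assms
proof (induction cs as arbitrary: us rule: list_induct2)
  case (Cons c cs a as)
  have carr: "set (map2 pscale cs as) \<subseteq> carr d"
    using Cons.prems(3) by (auto dest!: set_zip_rightD intro!: Carrier_pscale)
  have "delta (us @ pscale c a # map2 pscale cs as) - pscale c (delta (us @ a # map2 pscale cs as)) \<in> rel d n"
    using Cons carr by (intro rel_scale) auto
  moreover have "pscale c (delta ((us @ [a]) @ map2 pscale cs as) - pscale (prod_list cs) (delta ((us @ [a]) @ as))) \<in> rel d n"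
    using Cons.prems by (intro rel_mult Cons.IH) auto
  then have "pscale c (delta (us @ a # map2 pscale cs as)) - pscale (c * prod_list cs) (delta (us @ a # as)) \<in> rel d n"
    by (simp add: pscale.scale_right_diff_distrib)
  ultimately show ?case by simp (rule rel_trans)
qed simp

text \<open>\<open>growth_split\<close> spreads the coefficient of each monomial word over its
  letters; the rescaled letters are bounded, and multilinearity moves the scalars back out.\<close>

lemma iota_lat:
  assumes "f \<in> chain_lat d N" "f \<in> nchains n"
  shows "lin_ext (iota_word tw) f \<in> lat d n (2 * N + 1)"
proof -
  have "pscale (f i) (iota_word tw i) \<in> lat d n (2 * N + 1)" if "f i \<noteq> 0" for i
  proof -
    have n: "length (full_word i) = Suc n"
      using assms(2) that by (cases i) (auto simp: nchains_def full_word_def)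
    have "f i \<in> growth d N (cell_len i)" using assms(1) unfolding chain_lat_def by blast
    then obtain v xs where xs: "length xs = length (full_word i)"
      "\<And>j. j < length (full_word i) \<Longrightarrow> xs ! j \<in> growth d (2 * N + 1) (len (full_word i ! j))"
      "f i = to_fract v * prod_list xs"
      using growth_split[of "map len (full_word i)" "cell_len i" "f i" d N] cell_len_full_word(2)[of i]
      by (auto simp: full_word_nonempty)
    let ?ys = "map2 pscale xs (map delta (full_word i))"
    have "?ys ! j \<in> bset d (2 * N + 1)" if "j < Suc n" for j
      using xs(1,2) n that by (intro bsetI) (auto simp: fun_apply delta_def)
    then have "set ?ys \<subseteq> bset d (2 * N + 1)" using xs(1) n by (force simp: in_set_conv_nth)
    then have "delta ?ys \<in> lat d n (2 * N + 1)" using xs(1) n by (intro lat_word) (simp add: words_def)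
    moreover have "delta ([] @ ?ys) - pscale (prod_list xs) (delta ([] @ map delta (full_word i))) \<in> rel d n"
      using xs(1) n by (intro rel_scale_all) (auto simp: delta_Carrier)
    ultimately have "delta ?ys - (delta ([] @ ?ys) - pscale (prod_list xs) (delta ([] @ map delta (full_word i)))) \<in> lat d n (2 * N + 1)"
      by (rule lat_minus[OF _ lat_rel])
    then have "pscale (prod_list xs) (delta (map delta (full_word i))) \<in> lat d n (2 * N + 1)" by simp
    then have "pscale (tw powi (- twist_exp (full_word i)) * to_fract v) (pscale (prod_list xs) (delta (map delta (full_word i)))) \<in> lat d n (2 * N + 1)"
      by (rule lat_frac_mult[OF frac_ideal_scale[OF unit_powi_in_frac_ideal[OF unit] to_fract_in_frac_ideal]])
    then show ?thesis by (simp add: iota_word_def xs(3) mult_ac)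
  qed
  then show ?thesis unfolding lin_ext_def by (intro lat_sum) auto
qed

subsection \<open>Truncation\<close>

text \<open>Finitely supported letters are expanded into monomials one at a time from the right, so
  the letters already treated appear as \<open>map delta hs\<close>.\<close>

lemma trunc_word_rel:
  assumes "length fs + length hs = Suc n" "\<And>a. a \<in> set fs \<Longrightarrow> a \<in> carr d \<and> fin_supp a"
  shows "coeff_word tw (fs @ map delta hs) \<in> nchains n \<and>
     delta (fs @ map delta hs) - lin_ext (iota_word tw) (coeff_word tw (fs @ map delta hs)) \<in> rel d n"
  using assms
proof (induction fs arbitrary: hs rule: rev_induct)
  case Nil
  define ws g where "ws = tl hs" and "g = sum_list hs"
  have hs: "hs = full_word (g, ws)" "length ws = n"
    using Nil by (cases hs; simp add: ws_def g_def full_word_def)+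
  let ?e = "tw powi twist_exp (full_word (g, ws))"
  have "pscale ?e (iota_word tw (g, ws)) - pscale ?e (lin_ext (iota_word tw) (cell g ws)) \<in> rel d n"
    using rel_mult[OF iota_cell[of g ws d], of ?e] hs(2) by (simp add: pscale.scale_right_diff_distrib)
  moreover have "pscale ?e (iota_word tw (g, ws)) = delta (map delta hs)"
    by (simp add: iota_word_def hs(1) power_int_minus)
  ultimately show ?case
    using hs(2) by (simp add: hs(1) coeff_word_delta lin_ext_pscale nchains_pscale nchains_cell)
next
  case (snoc a fs)
  let ?C = "\<lambda>a. coeff_word tw (fs @ a # map delta hs)" and ?i = "lin_ext (iota_word tw)"
  have l: "length fs + length (map delta hs) = n" using snoc.prems(1) by simp
  have carr: "set fs \<subseteq> carr d" "set (map delta hs) \<subseteq> carr d" using snoc.prems(2) by (auto simp: delta_Carrier)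
  have IH: "?C (delta h) \<in> nchains n \<and> delta (fs @ delta h # map delta hs) - ?i (?C (delta h)) \<in> rel d n" for h
    using snoc.IH[of "h # hs"] snoc.prems by simp
  have "fin_supp a" using snoc.prems(2) by simp
  then have "a \<in> carr d \<and> ?C a \<in> nchains n \<and> delta (fs @ a # map delta hs) - ?i (?C a) \<in> rel d n"
  proof (induction a rule: fin_supp_induct)
    case zero
    have z: "?C 0 = 0" using coeff_word_pscale[of tw fs 0 0 "map delta hs"] by simp
    show ?case using rel_scale[OF l carr Carrier_0, of 0] by (simp add: z Carrier_0)
  next
    case (add c h a)
    have C: "?C (pscale c (delta h) + a) = pscale c (?C (delta h)) + ?C a"
      by (simp add: coeff_word_add coeff_word_pscale)
    have ch: "pscale c (delta h) \<in> carr d" by (intro Carrier_pscale delta_Carrier)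
    have "delta (fs @ (pscale c (delta h) + a) # map delta hs) - delta (fs @ pscale c (delta h) # map delta hs)
        - delta (fs @ a # map delta hs) \<in> rel d n"
      using add ch by (intro rel_add l carr) auto
    moreover have "delta (fs @ pscale c (delta h) # map delta hs) - pscale c (delta (fs @ delta h # map delta hs)) \<in> rel d n"
      by (intro rel_scale l carr delta_Carrier)
    moreover have "pscale c (delta (fs @ delta h # map delta hs) - ?i (?C (delta h))) \<in> rel d n"
      using IH by (intro rel_mult) auto
    moreover have "delta (fs @ a # map delta hs) - ?i (?C a) \<in> rel d n" using add by blast
    ultimately have "(delta (fs @ (pscale c (delta h) + a) # map delta hs) - delta (fs @ pscale c (delta h) # map delta hs)
        - delta (fs @ a # map delta hs))
        + (delta (fs @ pscale c (delta h) # map delta hs) - pscale c (delta (fs @ delta h # map delta hs)))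
        + pscale c (delta (fs @ delta h # map delta hs) - ?i (?C (delta h)))
        + (delta (fs @ a # map delta hs) - ?i (?C a)) \<in> rel d n"
      by (intro rel_plus)
    then have "delta (fs @ (pscale c (delta h) + a) # map delta hs) - (pscale c (?i (?C (delta h))) + ?i (?C a)) \<in> rel d n"
      by (simp add: pscale.scale_right_diff_distrib algebra_simps)
    moreover have "?i (?C (pscale c (delta h) + a)) = pscale c (?i (?C (delta h))) + ?i (?C a)"
      unfolding C using IH[of h] add nchains_fin_supp[of "?C (delta h)" n] nchains_fin_supp[of "?C a" n]
      by (simp add: lin_ext_add lin_ext_pscale)
    moreover have "pscale c (?C (delta h)) + ?C a \<in> nchains n"
      using IH[of h] add by (intro nchains_add nchains_pscale) blast+
    moreover have "pscale c (delta h) + a \<in> carr d" using add ch by (intro Carrier_add) blast+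
    ultimately show ?case unfolding C by simp
  qed
  then show ?case by simp
qed

lemma trunc_bset: "a \<in> bset d N \<Longrightarrow> trunc m a \<in> bset d N"
  by (intro bsetI) (auto simp: trunc_def dest: bsetD)

lemma lat_rel_pi: "r \<in> rel d n \<Longrightarrow> r \<in> pi_mult k (lat d n N)"
  unfolding pi_mult_iff by (intro lat_rel rel_mult)

lemma lat_pi_plus: "f \<in> pi_mult k (lat d n N) \<Longrightarrow> h \<in> pi_mult k (lat d n N) \<Longrightarrow> f + h \<in> pi_mult k (lat d n N)"
  unfolding pi_mult_iff by (simp add: pscale.scale_right_distrib lat_plus)

text \<open>Letters are truncated one at a time. By multilinearity each replacement changes the form
  by a word with one letter divisible by \<open>unif ^ k\<close>, the other letters staying
  bounded.\<close>

lemma trunc_telescope: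
  assumes N': "N \<le> N'"
    and tail: "\<And>a :: int \<times> int \<Rightarrow> 'v fract. a \<in> bset d N \<Longrightarrow> pscale (unif_fract powi (- int k)) (a - trunc m a) \<in> bset d N'"
    and "length us + length xs = Suc n" "set us \<subseteq> bset d N'" "set xs \<subseteq> bset d N"
  shows "delta (us @ xs) - delta (us @ map (trunc m) xs) \<in> pi_mult k (lat d n N')"
  using assms(3-)
proof (induction xs arbitrary: us)
  case Nil
  then show ?case by (simp add: pi_mult_iff)
next
  case (Cons x xs)
  have sub: "bset d N \<subseteq> bset d N'" "bset d N' \<subseteq> carr d" using N' bset_mono bset_Carrier by blast+
  have x: "x \<in> bset d N" "trunc m x \<in> bset d N" using Cons.prems trunc_bset by auto
  define y where "y = pscale (unif_fract powi (- int k)) (x - trunc m x)"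
  have y: "y \<in> bset d N'" unfolding y_def by (rule tail[OF x(1)])
  have xy: "x = trunc m x + pscale (unif_fract powi int k) y"
    unfolding y_def by (simp add: power_int_minus)
  have carr: "length us + length xs = n" "set us \<subseteq> carr d" "set xs \<subseteq> carr d" "trunc m x \<in> carr d" "y \<in> carr d"
    using Cons.prems x y sub by auto
  have "delta (us @ (trunc m x + pscale (unif_fract powi int k) y) # xs) - delta (us @ trunc m x # xs)
      - delta (us @ pscale (unif_fract powi int k) y # xs) \<in> rel d n"
    using carr by (intro rel_add Carrier_pscale)
  moreover have "delta (us @ pscale (unif_fract powi int k) y # xs) - pscale (unif_fract powi int k) (delta (us @ y # xs)) \<in> rel d n"
    using carr by (intro rel_scale)
  ultimately have "(delta (us @ (trunc m x + pscale (unif_fract powi int k) y) # xs) - delta (us @ trunc m x # xs)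
      - delta (us @ pscale (unif_fract powi int k) y # xs))
      + (delta (us @ pscale (unif_fract powi int k) y # xs) - pscale (unif_fract powi int k) (delta (us @ y # xs))) \<in> rel d n"
    by (rule rel_plus)
  then have "delta (us @ x # xs) - delta (us @ trunc m x # xs) - pscale (unif_fract powi int k) (delta (us @ y # xs)) \<in> rel d n"
    unfolding xy[symmetric] by (simp add: algebra_simps)
  then have "delta (us @ x # xs) - delta (us @ trunc m x # xs) - pscale (unif_fract powi int k) (delta (us @ y # xs)) \<in> pi_mult k (lat d n N')"
    by (rule lat_rel_pi)
  moreover have "pscale (unif_fract powi int k) (delta (us @ y # xs)) \<in> pi_mult k (lat d n N')"
    using Cons.prems y sub carr(1) by (auto simp: pi_mult_iff power_int_minus words_append intro!: lat_word)
  moreover have "delta ((us @ [trunc m x]) @ xs) - delta ((us @ [trunc m x]) @ map (trunc m) xs) \<in> pi_mult k (lat d n N')"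
    using Cons.prems x sub by (intro Cons.IH) auto
  ultimately have "(delta (us @ x # xs) - delta (us @ trunc m x # xs) - pscale (unif_fract powi int k) (delta (us @ y # xs)))
      + pscale (unif_fract powi int k) (delta (us @ y # xs))
      + (delta ((us @ [trunc m x]) @ xs) - delta ((us @ [trunc m x]) @ map (trunc m) xs)) \<in> pi_mult k (lat d n N')"
    by (intro lat_pi_plus)
  then show ?case by simp
qed

lemma coeff_support:
  assumes "f \<in> free d n" "lin_ext (coeff_word tw) f (g, ws) \<noteq> 0"
  shows "length ws = n \<and> 0 \<notin> set ws"
proof (rule ccontr)
  assume *: "\<not> (length ws = n \<and> 0 \<notin> set ws)"
  have "coeff_word tw xs (g, ws) = 0" if "xs \<in> words (carr d) n" for xs
    using * that evl_length[of xs "full_word (g, ws)"] by (auto simp: coeff_word_def words_def full_word_def)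
  then have "lin_ext (coeff_word tw) f (g, ws) = 0"
    using assms(1) unfolding lin_ext_apply by (intro sum.neutral) (auto simp: form_free_def)
  with assms(2) show False by simp
qed

definition approx :: "nat \<Rightarrow> ('v form) \<Rightarrow> cell_index \<Rightarrow> 'v fract" where
  "approx m f = chain_trunc m (lin_ext (coeff_word tw) f)"

lemma approx_nchains: "f \<in> free d n \<Longrightarrow> approx m f \<in> nchains n"
  unfolding approx_def by (rule chain_trunc_nchains) (rule coeff_support)

lemma approx_add: "f \<in> free d n \<Longrightarrow> h \<in> free d n \<Longrightarrow> approx m (f + h) = approx m f + approx m h"
  and approx_pscale: "f \<in> free d n \<Longrightarrow> approx m (pscale c f) = pscale c (approx m f)"
  unfolding approx_def by (simp_all add: lin_ext_add lin_ext_pscale free_fin_supp chain_trunc_linear)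

text \<open>The bound \<open>J\<close> depends on \<open>k\<close> but not on \<open>f\<close>, so
  the truncation radius may vary along a sequence. For this the forms satisfying the estimate are
  shown to be a submodule containing the words and the relations.\<close>

lemma approx_lat:
  "\<exists>N'. \<forall>k. \<exists>J. \<forall>m\<ge>J. \<forall>f\<in>lat d n N. f - lin_ext (iota_word tw) (approx m f) \<in> pi_mult k (lat d n N')"
proof -
  obtain N1 where N1: "\<And>k. \<exists>J. \<forall>m>J. \<forall>x :: 'v fract. x \<in> growth d N m \<longrightarrow> x * unif_fract powi (- int k) \<in> growth d N1 m"
    using growth_tail[of d N] by blast
  define N' where "N' = N + N1"
  have "\<exists>J. \<forall>m\<ge>J. \<forall>f\<in>lat d n N. f - lin_ext (iota_word tw) (approx m f) \<in> pi_mult k (lat d n N')" for k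
  proof -
    obtain J where J: "\<And>m (x :: 'v fract). m > J \<Longrightarrow> x \<in> growth d N m \<Longrightarrow> x * unif_fract powi (- int k) \<in> growth d N1 m"
      using N1 by blast
    have "lat d n N \<subseteq> {f \<in> free d n. f - lin_ext (iota_word tw) (approx m f) \<in> pi_mult k (lat d n N')}"
      (is "_ \<subseteq> ?T") if m: "m \<ge> J" for m
    proof (rule lat_subset)
      have fs: "fin_supp (approx m f)" if "f \<in> ?T" for f
        using that nchains_fin_supp[OF approx_nchains] by blast
      have add: "f + h \<in> ?T" if "f \<in> ?T" "h \<in> ?T" for f h
      proof -
        have eq: "f + h - lin_ext (iota_word tw) (approx m (f + h)) =
            (f - lin_ext (iota_word tw) (approx m f)) + (h - lin_ext (iota_word tw) (approx m h))"
          using that fs[of f] fs[of h] by (simp add: approx_add[of f d n h] lin_ext_add)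
        show ?thesis using that unfolding mem_Collect_eq eq by (blast intro: lat_pi_plus free_plus)
      qed
      have scale: "pscale (to_fract v) f \<in> ?T" if "f \<in> ?T" for v f
      proof -
        have "pscale (to_fract v) f - lin_ext (iota_word tw) (approx m (pscale (to_fract v) f)) =
            pscale (to_fract v) (f - lin_ext (iota_word tw) (approx m f))"
          using that fs[of f] by (simp add: approx_pscale[of f d n] lin_ext_pscale
              pscale.scale_right_diff_distrib)
        moreover have "pscale (to_fract v) (f - lin_ext (iota_word tw) (approx m f)) \<in> pi_mult k (lat d n N')"
          using that lat_mult[of "pscale (unif_fract powi (- int k)) (f - lin_ext (iota_word tw) (approx m f))" d n N' v]
          by (simp add: pi_mult_iff mult.commute)
        ultimately show ?thesis using that by (simp add: free_mult)
      qed
      have "approx m 0 = 0"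
        by (simp add: approx_def chain_trunc_def fun_eq_iff fun_apply)
      then have "0 \<in> ?T"
        by (simp add: pscale.subspace_0[OF free_subspace] pi_mult_iff)
      with add scale show "fract_scale.subspace ?T" unfolding fract_scale.subspace_def by blast
    next
      show "rel d n \<subseteq> ?T"
      proof
        fix r
        assume r: "r \<in> rel d n"
        have "approx m r = 0"
          by (simp add: approx_def coeff_rel[OF r] chain_trunc_def fun_eq_iff fun_apply)
        then show "r \<in> ?T" using r rel_free lat_rel_pi by auto
      qed
    next
      fix xs :: "(int \<times> int \<Rightarrow> 'v fract) list"
      assume xs: "xs \<in> words (bset d N) n"
      then have free: "delta xs \<in> free d n"
        by (intro delta_free) (auto simp: words_def bset_Carrier subset_iff)
      have fs: "fin_supp (trunc m a)" for a :: "int \<times> int \<Rightarrow> 'v fract"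
        by (rule finite_subset[OF _ finite_len_le[of m]]) (auto simp: trunc_def)
      have "delta ([] @ xs) - delta ([] @ map (trunc m) xs) \<in> pi_mult k (lat d n N')"
      proof (rule trunc_telescope[of N])
        fix a :: "int \<times> int \<Rightarrow> 'v fract"
        assume a: "a \<in> bset d N"
        have "unif_fract powi (- int k) * (a - trunc m a) g \<in> growth d N1 (len g)" for g
          using J[of "len g" "a g"] bsetD[OF a, of g] m by (auto simp: fun_apply trunc_def mult.commute)
        then have "pscale (unif_fract powi (- int k)) (a - trunc m a) \<in> bset d N1"
          by (intro bsetI) (simp add: fun_apply)
        then show "pscale (unif_fract powi (- int k)) (a - trunc m a) \<in> bset d N'"
          by (rule bset_mono[rotated]) (simp add: N'_def)
      qed (use xs in \<open>auto simp: N'_def words_def\<close>)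
      moreover have "delta (map (trunc m) xs @ map delta [])
          - lin_ext (iota_word tw) (coeff_word tw (map (trunc m) xs @ map delta [])) \<in> rel d n"
        using xs by (intro conjunct2[OF trunc_word_rel]) (auto simp: words_def fs intro!: bset_Carrier[OF trunc_bset])
      moreover have "approx m (delta xs) = coeff_word tw (map (trunc m) xs)"
        by (simp add: approx_def coeff_word_trunc)
      ultimately have "(delta xs - delta (map (trunc m) xs)) + (delta (map (trunc m) xs)
          - lin_ext (iota_word tw) (approx m (delta xs))) \<in> pi_mult k (lat d n N')"
        by (intro lat_pi_plus[OF _ lat_rel_pi]) simp_all
      then show "delta xs \<in> ?T" using free by simp
    qed
    then show ?thesis by blast
  qed
  then show ?thesis by blast
qed

end

section \<open>Completions\<close>

definition null_in :: "('i \<Rightarrow> 'v::dvr fract) set \<Rightarrow> (nat \<Rightarrow> 'i \<Rightarrow> 'v fract) \<Rightarrow> bool" where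
  "null_in L x \<longleftrightarrow> (\<forall>k. \<exists>N. \<forall>i\<ge>N. x i \<in> pi_mult k L)"

lemma pi_mult_mono: "L \<subseteq> L' \<Longrightarrow> pi_mult k L \<subseteq> pi_mult k L'"
  unfolding pi_mult_def by (rule image_mono)

lemma cauchy_in_mono: "L \<subseteq> L' \<Longrightarrow> cauchy_in L x \<Longrightarrow> cauchy_in L' x"
  unfolding cauchy_in_def by (meson pi_mult_mono subsetD)

lemma pi_mult_0: "fract_scale.subspace L \<Longrightarrow> 0 \<in> pi_mult k L"
  by (simp add: pi_mult_iff fract_scale.subspace_0)

lemma pi_mult_add: "fract_scale.subspace L \<Longrightarrow> f \<in> pi_mult k L \<Longrightarrow> h \<in> pi_mult k L \<Longrightarrow> f + h \<in> pi_mult k L"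
  by (simp add: pi_mult_iff pscale.scale_right_distrib fract_scale.subspace_add)

lemma pi_mult_diff: "fract_scale.subspace L \<Longrightarrow> f \<in> pi_mult k L \<Longrightarrow> h \<in> pi_mult k L \<Longrightarrow> f - h \<in> pi_mult k L"
  by (simp add: pi_mult_iff pscale.scale_right_diff_distrib fract_scale.subspace_diff)

lemma pi_mult_pscale:
  assumes L: "fract_scale.subspace L" and a: "a \<in> frac_ideal (- int r)" and f: "f \<in> pi_mult (k + r) L"
  shows "pscale a f \<in> pi_mult k L"
proof -
  obtain v where "a * unif_fract ^ r = to_fract v"
    using frac_ideal_mult[OF a unif_fract_powi_in[of "int r"]] frac_ideal_0E by force
  then have a: "a = to_fract v * unif_fract powi (- int r)"
    by (simp add: power_int_minus field_simps)
  have "pscale (unif_fract powi (- int k)) (pscale a f) =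
      pscale (to_fract v) (pscale (unif_fract powi (- int (k + r))) f)"
    unfolding a pscale.scale_scale of_nat_add minus_add_distrib
    by (subst power_int_add) (simp_all add: mult_ac)
  also have "\<dots> \<in> L" using f by (intro fract_scale.subspace_scale[OF L]) (simp only: pi_mult_iff)
  finally show ?thesis by (simp only: pi_mult_iff)
qed

lemma cauchy_in_add:
  assumes "fract_scale.subspace L" "cauchy_in L x" "cauchy_in L y"
  shows "cauchy_in L (x + y)"
  unfolding cauchy_in_def
proof
  fix k
  obtain N N' where "\<And>i j. i \<ge> N \<Longrightarrow> j \<ge> N \<Longrightarrow> x i - x j \<in> pi_mult k L"
    "\<And>i j. i \<ge> N' \<Longrightarrow> j \<ge> N' \<Longrightarrow> y i - y j \<in> pi_mult k L"
    using assms(2,3) unfolding cauchy_in_def by meson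
  then have "(x i - x j) + (y i - y j) \<in> pi_mult k L" if "i \<ge> max N N'" "j \<ge> max N N'" for i j
    using that by (intro pi_mult_add assms(1)) auto
  then have "\<forall>i\<ge>max N N'. \<forall>j\<ge>max N N'. (x + y) i - (x + y) j \<in> pi_mult k L"
    by (simp add: fun_apply algebra_simps)
  then show "\<exists>N. \<forall>i\<ge>N. \<forall>j\<ge>N. (x + y) i - (x + y) j \<in> pi_mult k L" ..
qed

lemma cauchy_in_scale:
  assumes "fract_scale.subspace L" "cauchy_in L x"
  shows "cauchy_in L (seq_scale a x)"
  unfolding cauchy_in_def
proof
  fix k
  obtain r where r: "a \<in> frac_ideal (- int r)" using ex_frac_ideal by blast
  obtain N where "\<And>i j. i \<ge> N \<Longrightarrow> j \<ge> N \<Longrightarrow> x i - x j \<in> pi_mult (k + r) L"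
    using assms(2) unfolding cauchy_in_def by meson
  then have "pscale a (x i - x j) \<in> pi_mult k L" if "i \<ge> N" "j \<ge> N" for i j
    using that by (intro pi_mult_pscale[OF assms(1) r])
  then show "\<exists>N. \<forall>i\<ge>N. \<forall>j\<ge>N. pscale a (x i) - pscale a (x j) \<in> pi_mult k L"
    unfolding pscale.scale_right_diff_distrib by blast
qed

lemma null_in_cauchy:
  assumes "fract_scale.subspace L" "null_in L x"
  shows "cauchy_in L x"
  unfolding cauchy_in_def
proof
  fix k
  obtain N where "\<And>i. i \<ge> N \<Longrightarrow> x i \<in> pi_mult k L" using assms(2) unfolding null_in_def by meson
  then show "\<exists>N. \<forall>i\<ge>N. \<forall>j\<ge>N. x i - x j \<in> pi_mult k L" using pi_mult_diff[OF assms(1)] by blast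
qed

text \<open>Linearity is demanded on a subspace only, because \<open>lin_ext\<close> is additive on
  finitely supported functions but not on all functions.\<close>

definition lin_on :: "('i \<Rightarrow> 'k::field) set \<Rightarrow> (('i \<Rightarrow> 'k) \<Rightarrow> 'j \<Rightarrow> 'k) \<Rightarrow> bool" where
  "lin_on M T \<longleftrightarrow> pscale.subspace M \<and> (\<forall>f\<in>M. \<forall>h\<in>M. T (f + h) = T f + T h) \<and>
     (\<forall>c. \<forall>f\<in>M. T (pscale c f) = pscale c (T f))"

lemma lin_on_add: "lin_on M T \<Longrightarrow> f \<in> M \<Longrightarrow> h \<in> M \<Longrightarrow> T (f + h) = T f + T h"
  and lin_on_pscale: "lin_on M T \<Longrightarrow> f \<in> M \<Longrightarrow> T (pscale c f) = pscale c (T f)"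
  by (simp_all add: lin_on_def)

lemma lin_on_diff:
  assumes "lin_on M T" "f \<in> M" "h \<in> M"
  shows "T (f - h) = T f - T h"
proof -
  have "pscale.subspace M" using assms(1) by (simp add: lin_on_def)
  then have "pscale (-1) h \<in> M" using assms(3) by (rule pscale.subspace_scale)
  then have "T (f + pscale (-1) h) = T f + T (pscale (-1) h)" using assms by (intro lin_on_add)
  also have "T (pscale (-1) h) = pscale (-1) (T h)" using assms(1,3) by (rule lin_on_pscale)
  finally show ?thesis by simp
qed

lemma lin_on_lin_ext: "pscale.subspace M \<Longrightarrow> (\<And>f. f \<in> M \<Longrightarrow> fin_supp f) \<Longrightarrow> lin_on M (lin_ext \<phi>)"
  by (simp add: lin_on_def lin_ext_add lin_ext_pscale)

lemma pi_mult_map: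
  assumes "lin_on M T" "\<And>f. f \<in> L \<Longrightarrow> f \<in> M \<Longrightarrow> T f \<in> L'" "f \<in> pi_mult k L" "f \<in> M"
  shows "T f \<in> pi_mult k L'"
proof -
  have "pscale (unif_fract powi (- int k)) f \<in> M"
    using assms(1,4) by (simp add: lin_on_def pscale.subspace_scale)
  moreover have "pscale (unif_fract powi (- int k)) f \<in> L" using assms(3) by (simp only: pi_mult_iff)
  ultimately have "T (pscale (unif_fract powi (- int k)) f) \<in> L'" using assms(2) by blast
  then show ?thesis using lin_on_pscale[OF assms(1,4)] by (simp only: pi_mult_iff)
qed

lemma cauchy_in_map:
  assumes "lin_on M T" "\<And>f. f \<in> L \<Longrightarrow> f \<in> M \<Longrightarrow> T f \<in> L'" "cauchy_in L x" "\<And>i. x i \<in> M"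
  shows "cauchy_in L' (\<lambda>i. T (x i))"
proof -
  have "T (x i) - T (x j) \<in> pi_mult k L'" if "x i - x j \<in> pi_mult k L" for i j k
  proof -
    have "x i - x j \<in> M" using assms(1,4) by (simp add: lin_on_def pscale.subspace_diff)
    with that have "T (x i - x j) \<in> pi_mult k L'" by (intro pi_mult_map[OF assms(1,2)])
    then show ?thesis by (simp add: lin_on_diff[OF assms(1) assms(4) assms(4)])
  qed
  then show ?thesis using assms(3) unfolding cauchy_in_def by meson
qed

lemma null_in_map:
  assumes "lin_on M T" "\<And>f. f \<in> L \<Longrightarrow> f \<in> M \<Longrightarrow> T f \<in> L'" "null_in L x" "\<And>i. x i \<in> M"
  shows "null_in L' (\<lambda>i. T (x i))"
  using assms(3) pi_mult_map[OF assms(1,2) _ assms(4)] unfolding null_in_def by meson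

lemma nchains_subspace: "pscale.subspace (nchains n)"
  by (simp add: pscale.subspace_def nchains_add nchains_pscale)

lemma lin_on_linop: "lin_on (nchains n) (linop \<phi>)"
  unfolding linop_def using nchains_subspace nchains_fin_supp by (rule lin_on_lin_ext)

lemma lin_on_from_coords: "lin_on UNIV (from_coords n)"
  by (simp add: lin_on_def from_coords_add from_coords_pscale)

definition coord_lat :: "nat \<Rightarrow> (nat \<Rightarrow> 'v::dvr fract) set" where
  "coord_lat N = {v. \<forall>k. v k \<in> frac_ideal (- int N)}"

lemma pi_mult_coord_lat: "v \<in> pi_mult k (coord_lat N) \<longleftrightarrow> (\<forall>j. v j \<in> frac_ideal (int k - int N))"
proof -
  have "unif_fract powi (- int k) * a \<in> frac_ideal (- int N) \<longleftrightarrow> a \<in> frac_ideal (int k - int N)" for a :: "'a fract"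
    using frac_ideal_shift[of a "- int k" "int k - int N"] by (simp add: mult.commute)
  then show ?thesis by (simp add: pi_mult_iff coord_lat_def fun_apply)
qed

text \<open>Limits exist in each component by completeness. The Cauchy estimate is uniform in the
  components and passes to the limit because fractional ideals are closed.\<close>

lemma cauchy_coord_lat_limit:
  fixes z :: "nat \<Rightarrow> nat \<Rightarrow> 'v::complete_dvr fract"
  assumes "cauchy_in (coord_lat N) z"
  shows "\<exists>v. null_in (coord_lat N) (\<lambda>i. z i - v)"
proof -
  have c: "\<exists>M. \<forall>i\<ge>M. \<forall>j\<ge>M. \<forall>m. z i m - z j m \<in> frac_ideal (int k - int N)" for k
    using assms unfolding cauchy_in_def pi_mult_coord_lat fun_apply by blast
  have "\<exists>L. null_seq (\<lambda>i. z i m - L)" for m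
  proof (rule frac_complete)
    fix k
    from c[of "k + N"] show "\<exists>M. \<forall>i\<ge>M. \<forall>j\<ge>M. z i m - z j m \<in> frac_ideal (int k)"
      by (auto simp: ac_simps)
  qed
  then obtain v where v: "\<And>m. null_seq (\<lambda>i. z i m - v m)" by metis
  have "\<exists>M. \<forall>i\<ge>M. \<forall>m. z i m - v m \<in> frac_ideal (int k - int N)" for k
  proof -
    obtain M where M: "\<And>i j m. i \<ge> M \<Longrightarrow> j \<ge> M \<Longrightarrow> z i m - z j m \<in> frac_ideal (int k - int N)"
      using c[of k] by blast
    have "z i m - v m \<in> frac_ideal (int k - int N)" if "i \<ge> M" for i m
    proof -
      obtain M' where M': "\<And>j. j \<ge> M' \<Longrightarrow> z j m - v m \<in> frac_ideal (int k)"
        using v[of m] unfolding null_seq_def by blast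
      have "z (max M M') m - v m \<in> frac_ideal (int k)" by (rule M') simp
      then have "z (max M M') m - v m \<in> frac_ideal (int k - int N)"
        by (rule frac_ideal_mono[rotated]) simp
      from frac_ideal_add[OF M[OF that, of "max M M'" m] this] show ?thesis by simp
    qed
    then show ?thesis by blast
  qed
  then show ?thesis unfolding null_in_def pi_mult_coord_lat fun_apply by blast
qed

text \<open>The growth conditions are closed for pointwise convergence.\<close>

lemma cauchy_null_in_chain_lat:
  assumes "cauchy_in (chain_lat d N) y" "\<And>i. null_seq (\<lambda>k. y k i)"
  shows "null_in (chain_lat d N) y"
  unfolding null_in_def
proof
  fix k
  obtain M where M: "\<And>i j. i \<ge> M \<Longrightarrow> j \<ge> M \<Longrightarrow> y i - y j \<in> pi_mult k (chain_lat d N)"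
    using assms(1) unfolding cauchy_in_def by meson
  have "y i \<in> pi_mult k (chain_lat d N)" if i: "i \<ge> M" for i
  proof -
    have "unif_fract powi (- int k) * y i c \<in> growth d N (cell_len c)" for c
    proof (rule growth_closed)
      fix m
      obtain M' where M': "\<And>j. j \<ge> M' \<Longrightarrow> y j c \<in> frac_ideal (int (m + k))"
        using assms(2)[of c] unfolding null_seq_def by blast
      let ?j = "max M M'"
      have "y i - y ?j \<in> pi_mult k (chain_lat d N)" using M[OF i, of ?j] by simp
      then have "pscale (unif_fract powi (- int k)) (y i - y ?j) c \<in> growth d N (cell_len c)"
        unfolding pi_mult_iff chain_lat_def by blast
      moreover have "unif_fract powi (- int k) * y ?j c \<in> frac_ideal (int m)"
        using frac_ideal_mult[OF unif_fract_powi_in M'[of ?j], of "- int k"] by simp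
      ultimately show "\<exists>w\<in>growth d N (cell_len c). unif_fract powi (- int k) * y i c - w \<in> frac_ideal (int m)"
        by (intro bexI[of _ "pscale (unif_fract powi (- int k)) (y i - y ?j) c"])
          (simp_all add: fun_apply algebra_simps)
    qed
    then show ?thesis by (simp add: pi_mult_iff chain_lat_def fun_apply)
  qed
  then show "\<exists>M. \<forall>i\<ge>M. y i \<in> pi_mult k (chain_lat d N)" by blast
qed

context unit_twist
begin

section \<open>Null forms as a least closed subspace\<close>

definition form_seqs :: "bool \<Rightarrow> nat \<Rightarrow> (nat \<Rightarrow> 'v form) set" where
  "form_seqs d n = {x. (\<forall>i. x i \<in> free d n) \<and> (\<exists>N. cauchy_in (lat d n N) x)}"

definition form_lim :: "bool \<Rightarrow> nat \<Rightarrow> (nat \<Rightarrow> nat \<Rightarrow> 'v form) \<Rightarrow>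
    (nat \<Rightarrow> 'v form) \<Rightarrow> bool" where
  "form_lim d n X x \<longleftrightarrow> (\<exists>N. \<forall>k. \<exists>J. \<forall>j\<ge>J.
      cauchy_in (lat d n N) (x - X j) \<and> (\<exists>M. \<forall>i\<ge>M. (x - X j) i \<in> pi_mult k (lat d n N)))"

definition form_null :: "bool \<Rightarrow> nat \<Rightarrow> (nat \<Rightarrow> 'v form) set" where
  "form_null d n = denom (Omega (alg d) n)"

definition closed_subspace :: "bool \<Rightarrow> nat \<Rightarrow> (nat \<Rightarrow> 'v form) set \<Rightarrow> bool" where
  "closed_subspace d n Q \<longleftrightarrow> Q \<subseteq> form_seqs d n \<and> seq_scale.subspace Q \<and>
     (\<forall>X. \<forall>x\<in>form_seqs d n. range X \<subseteq> Q \<and> form_lim d n X x \<longrightarrow> x \<in> Q)"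

lemma closed_subspaceD:
  assumes "closed_subspace d n Q" "x \<in> form_seqs d n" "\<And>j. X j \<in> Q" "form_lim d n X x"
  shows "x \<in> Q"
proof -
  have "\<forall>X. \<forall>x\<in>form_seqs d n. range X \<subseteq> Q \<and> form_lim d n X x \<longrightarrow> x \<in> Q"
    using assms(1) unfolding closed_subspace_def by (elim conjE)
  moreover have "range X \<subseteq> Q" using assms(3) by (rule image_subsetI)
  ultimately show ?thesis using assms(2,4) by (meson bspec)
qed

text \<open>The lattices of the sets \<open>bset d N\<close> are cofinal, so quantifiers over
  bounded sets can be replaced by quantifiers over \<open>N\<close>.\<close>

lemma lattices:
  "L \<in> form_lattice (alg d) n ` Bounded (alg d) \<Longrightarrow> \<exists>N. L \<subseteq> lat d n N"
  "lat d n N \<in> form_lattice (alg d) n ` Bounded (alg d)"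
proof -
  assume "L \<in> form_lattice (alg d) n ` Bounded (alg d)"
  then obtain S N where S: "S \<subseteq> bset d N" "L = form_lattice (alg d) n S" by (auto simp: Bounded_torus_alg)
  then have "delta ` words S n \<subseteq> (delta ` words (bset d N) n :: 'v form set)"
    by (auto simp: words_def)
  from fract_scale.span_mono[OF this] have "L \<subseteq> lat d n N"
    unfolding S(2) lat_def form_lattice_def by blast
  then show "\<exists>N. L \<subseteq> lat d n N" ..
qed (auto simp: lat_def Bounded_torus_alg)

lemma numer_Omega: "numer (Omega (alg d) n) = form_seqs d n"
proof -
  have "(\<exists>L\<in>form_lattice (alg d) n ` Bounded (alg d). cauchy_in L x) \<longleftrightarrow> (\<exists>N. cauchy_in (lat d n N) x)" for x
    using lattices cauchy_in_mono by meson
  then show ?thesis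
    by (auto simp: Omega_def completion_def cauchy_seqs_def form_seqs_def)
qed

lemma born_lim_iff: "born_lim (form_lattice (alg d) n ` Bounded (alg d)) X x \<longleftrightarrow> form_lim d n X x"
proof
  assume "born_lim (form_lattice (alg d) n ` Bounded (alg d)) X x"
  then obtain L where L: "L \<in> form_lattice (alg d) n ` Bounded (alg d)"
    "\<forall>k. \<exists>J. \<forall>j\<ge>J. cauchy_in L (x - X j) \<and> (\<exists>M. \<forall>i\<ge>M. (x - X j) i \<in> pi_mult k L)"
    unfolding born_lim_def by blast
  from lattices(1)[OF L(1)] obtain N where N: "L \<subseteq> lat d n N" ..
  show "form_lim d n X x"
    unfolding form_lim_def using L(2) cauchy_in_mono[OF N] pi_mult_mono[OF N]
    by (intro exI[of _ N]) (meson subsetD)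
next
  assume "form_lim d n X x"
  then show "born_lim (form_lattice (alg d) n ` Bounded (alg d)) X x"
    unfolding form_lim_def born_lim_def using lattices(2) by blast
qed

text \<open>Turns the closure of 0 into an induction principle: a property holds for all null forms
  once the sequences having it form a closed subspace.\<close>

lemma form_null_eq: "form_null d n = \<Inter>{Q. closed_subspace d n Q}"
proof -
  have "cauchy_seqs (free d n) (form_lattice (alg d) n ` Bounded (alg d)) = form_seqs d n"
    using numer_Omega[of d n] by (simp add: Omega_def completion_def)
  then show ?thesis
    unfolding form_null_def Omega_def completion_def by (simp add: born_lim_iff closed_subspace_def)
qed

lemma form_null_subset: "closed_subspace d n Q \<Longrightarrow> form_null d n \<subseteq> Q"
  unfolding form_null_eq by blast

lemma form_seqs_subspace: "seq_scale.subspace (form_seqs d n)"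
  unfolding seq_scale.subspace_def
proof (intro conjI ballI allI)
  show "0 \<in> form_seqs d n"
    by (auto simp: form_seqs_def fun_apply cauchy_in_def pi_mult_0[OF lat_subspace] pscale.subspace_0[OF free_subspace])
next
  fix x y
  assume "x \<in> form_seqs d n" "y \<in> form_seqs d n"
  then obtain N N' where *: "cauchy_in (lat d n N) x" "cauchy_in (lat d n N') y"
    "\<forall>i. x i \<in> free d n" "\<forall>i. y i \<in> free d n" by (auto simp: form_seqs_def)
  have "cauchy_in (lat d n (max N N')) (x + y)"
    by (intro cauchy_in_add[OF lat_subspace] cauchy_in_mono[OF lat_mono *(1)] cauchy_in_mono[OF lat_mono *(2)]) auto
  with * show "x + y \<in> form_seqs d n" by (auto simp: form_seqs_def fun_apply intro: free_plus)
next
  fix c x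
  assume "x \<in> form_seqs d n"
  then obtain N where *: "cauchy_in (lat d n N) x" "\<And>i. x i \<in> free d n" by (auto simp: form_seqs_def)
  from cauchy_in_scale[OF lat_subspace *(1)] free_mult[OF *(2)] show "seq_scale c x \<in> form_seqs d n"
    unfolding form_seqs_def by blast
qed

lemma form_seqs_closed: "closed_subspace d n (form_seqs d n)"
  by (simp add: closed_subspace_def form_seqs_subspace)

lemma form_null_seqs: "form_null d n \<subseteq> form_seqs d n"
  using form_seqs_closed by (rule form_null_subset)

lemma form_null_closed: "closed_subspace d n (form_null d n)"
  unfolding closed_subspace_def
proof (intro conjI form_null_seqs allI ballI impI)
  show "seq_scale.subspace (form_null d n)"
    unfolding form_null_eq by (rule seq_scale.subspace_Inter) (auto simp: closed_subspace_def)
next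
  fix X x
  assume *: "x \<in> form_seqs d n" "range X \<subseteq> form_null d n \<and> form_lim d n X x"
  have "x \<in> Q" if Q: "closed_subspace d n Q" for Q
  proof -
    have "range X \<subseteq> Q" using * form_null_subset[OF Q] by (meson order_trans)
    from Q *(1) range_subsetD[OF this] conjunct2[OF *(2)] show ?thesis by (rule closed_subspaceD)
  qed
  then show "x \<in> form_null d n" unfolding form_null_eq by simp
qed

lemma form_null_subspace: "seq_scale.subspace (form_null d n)"
  using form_null_closed by (simp add: closed_subspace_def)

lemmas form_null_0 = seq_scale.subspace_0[OF form_null_subspace]
  and form_null_add = seq_scale.subspace_add[OF form_null_subspace]
  and form_null_diff = seq_scale.subspace_diff[OF form_null_subspace]
  and form_null_scale = seq_scale.subspace_scale[OF form_null_subspace]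
  and form_seqs_0 = seq_scale.subspace_0[OF form_seqs_subspace]
  and form_seqs_add = seq_scale.subspace_add[OF form_seqs_subspace]
  and form_seqs_diff = seq_scale.subspace_diff[OF form_seqs_subspace]
  and form_seqs_scale = seq_scale.subspace_scale[OF form_seqs_subspace]

lemma form_seqsI: "(\<And>i. x i \<in> free d n) \<Longrightarrow> cauchy_in (lat d n N) x \<Longrightarrow> x \<in> form_seqs d n"
  by (auto simp: form_seqs_def)

lemma form_seqsE:
  assumes "x \<in> form_seqs d n"
  obtains N where "cauchy_in (lat d n N) x" "\<And>i. x i \<in> free d n"
  using assms by (auto simp: form_seqs_def)

lemma null_in_form_null:
  assumes "\<And>i. x i \<in> free d n" "null_in (lat d n N) x"
  shows "x \<in> form_null d n"
proof -
  have c: "cauchy_in (lat d n N) x" using lat_subspace assms(2) by (rule null_in_cauchy)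
  have "form_lim d n (\<lambda>_. 0) x"
    unfolding form_lim_def using c assms(2)
    by (intro exI[of _ N]) (simp add: null_in_def)
  then show ?thesis
    by (rule closed_subspaceD[OF form_null_closed form_seqsI[OF assms(1) c] form_null_0])
qed

lemma rel_form_null: "(\<And>i. x i \<in> rel d n) \<Longrightarrow> x \<in> form_null d n"
  by (rule null_in_form_null[of _ _ _ 0]) (use rel_free lat_rel_pi in \<open>auto simp: null_in_def\<close>)

lemma form_seqs_map:
  assumes T: "lin_on (free d n) T" "\<And>f. f \<in> free d n \<Longrightarrow> T f \<in> free d' n'"
    and lat: "\<And>N. \<exists>N'. \<forall>f\<in>lat d n N. T f \<in> lat d' n' N'"
    and x: "x \<in> form_seqs d n"
  shows "(\<lambda>i. T (x i)) \<in> form_seqs d' n'"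
proof -
  obtain N where N: "cauchy_in (lat d n N) x" "\<And>i. x i \<in> free d n" using form_seqsE[OF x] by blast
  obtain N' where N': "\<And>f. f \<in> lat d n N \<Longrightarrow> T f \<in> lat d' n' N'" using lat by blast
  show ?thesis
    by (rule form_seqsI[OF T(2)[OF N(2)] cauchy_in_map[OF T(1) N' N]])
qed

text \<open>The preimage of the null forms under a bounded linear map is a closed subspace, so it
  contains the least one.\<close>

lemma form_null_map:
  assumes T: "lin_on (free d n) T" "\<And>f. f \<in> free d n \<Longrightarrow> T f \<in> free d' n'"
    and lat: "\<And>N. \<exists>N'. \<forall>f\<in>lat d n N. T f \<in> lat d' n' N'"
    and "x \<in> form_null d n"
  shows "(\<lambda>i. T (x i)) \<in> form_null d' n'"
proof -
  let ?Q = "{x \<in> form_seqs d n. (\<lambda>i. T (x i)) \<in> form_null d' n'}"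
  have free: "x i \<in> free d n" if "x \<in> form_seqs d n" for x i
    using form_seqsE[OF that] by blast
  have "closed_subspace d n ?Q"
    unfolding closed_subspace_def
  proof (intro conjI allI ballI impI)
    show "seq_scale.subspace ?Q"
      unfolding seq_scale.subspace_def
    proof (intro conjI ballI allI)
      have "T 0 = 0" using lin_on_pscale[OF T(1) pscale.subspace_0[OF free_subspace], of 0] by simp
      then show "0 \<in> ?Q" using form_null_0[of d' n'] form_seqs_0
        by (simp add: zero_fun_def)
    next
      fix x y
      assume *: "x \<in> ?Q" "y \<in> ?Q"
      then have "(\<lambda>i. T ((x + y) i)) = (\<lambda>i. T (x i)) + (\<lambda>i. T (y i))"
        by (auto simp: fun_eq_iff fun_apply lin_on_add[OF T(1) free free])
      with * show "x + y \<in> ?Q" by (simp add: form_null_add form_seqs_add)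
    next
      fix c x
      assume *: "x \<in> ?Q"
      then have "(\<lambda>i. T (pscale c (x i))) = seq_scale c (\<lambda>i. T (x i))"
        by (auto simp: fun_eq_iff lin_on_pscale[OF T(1) free])
      with * show "seq_scale c x \<in> ?Q" using form_null_scale form_seqs_scale by auto
    qed
  next
    fix X x
    assume x: "x \<in> form_seqs d n" and "range X \<subseteq> ?Q \<and> form_lim d n X x"
    then have X: "\<And>j. X j \<in> form_seqs d n" "\<And>j. (\<lambda>i. T (X j i)) \<in> form_null d' n'" and "form_lim d n X x"
      by auto
    then obtain N where N: "\<forall>k. \<exists>J. \<forall>j\<ge>J.
      cauchy_in (lat d n N) (x - X j) \<and> (\<exists>M. \<forall>i\<ge>M. (x - X j) i \<in> pi_mult k (lat d n N))"
      unfolding form_lim_def by blast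
    obtain N' where N': "\<And>f. f \<in> lat d n N \<Longrightarrow> T f \<in> lat d' n' N'" using lat by blast
    have diff: "(\<lambda>i. T (x i)) - (\<lambda>i. T (X j i)) = (\<lambda>i. T ((x - X j) i))" for j
      by (auto simp: fun_eq_iff fun_apply lin_on_diff[OF T(1) free[OF x] free[OF X(1)]])
    have fr: "(x - X j) i \<in> free d n" for i j
      using form_seqs_diff[OF x X(1)] by (rule free)
    have c: "cauchy_in (lat d' n' N') (\<lambda>i. T ((x - X j) i))" if "cauchy_in (lat d n N) (x - X j)" for j
      using T(1) N' that fr by (rule cauchy_in_map)
    have p: "T ((x - X j) i) \<in> pi_mult k (lat d' n' N')" if "(x - X j) i \<in> pi_mult k (lat d n N)" for i j k
      using T(1) N' that fr by (rule pi_mult_map)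
    have "form_lim d' n' (\<lambda>j i. T (X j i)) (\<lambda>i. T (x i))"
      unfolding form_lim_def diff using N c p by (intro exI[of _ N']) meson
    moreover have "(\<lambda>i. T (x i)) \<in> form_seqs d' n'" using T lat x by (rule form_seqs_map)
    ultimately have "(\<lambda>i. T (x i)) \<in> form_null d' n'"
      by (intro closed_subspaceD[OF form_null_closed _ X(2)])
    with x show "x \<in> ?Q" by simp
  qed auto
  then show ?thesis using form_null_subset assms(4) by blast
qed

text \<open>Each coefficient is a bounded functional that kills the relations, so the sequences on
  which it tends to 0 form a closed subspace. This bounds the closure of 0 from above and keeps the
  completion from collapsing.\<close>

lemma form_null_coeff:
  assumes "x \<in> form_null d n"
  shows "null_seq (\<lambda>k. lin_ext (coeff_word tw) (x k) c)"
proof -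
  let ?C = "lin_ext (coeff_word tw)"
  let ?Q = "{x \<in> form_seqs d n. null_seq (\<lambda>k. ?C (x k) c)}"
  have free: "x i \<in> free d n" if "x \<in> form_seqs d n" for x i
    using form_seqsE[OF that] by blast
  have lin: "lin_on (free d n) ?C" using free_subspace free_fin_supp by (rule lin_on_lin_ext)
  have "closed_subspace d n ?Q"
    unfolding closed_subspace_def
  proof (intro conjI allI ballI impI)
    show "seq_scale.subspace ?Q"
      unfolding seq_scale.subspace_def
    proof (intro conjI ballI allI)
      show "0 \<in> ?Q" using form_seqs_0 by (simp add: fun_apply)
    next
      fix x y
      assume *: "x \<in> ?Q" "y \<in> ?Q"
      then have "(\<lambda>k. ?C ((x + y) k) c) = (\<lambda>k. ?C (x k) c + ?C (y k) c)"
        by (auto simp: fun_apply lin_on_add[OF lin free free])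
      with * show "x + y \<in> ?Q" by (simp add: null_seq_add form_seqs_add)
    next
      fix a x
      assume *: "x \<in> ?Q"
      then have "(\<lambda>k. ?C (pscale a (x k)) c) = (\<lambda>k. a * ?C (x k) c)"
        by (auto simp: fun_apply lin_on_pscale[OF lin free])
      with * show "seq_scale a x \<in> ?Q" using null_seq_scale form_seqs_scale by auto
    qed
  next
    fix X x
    assume x: "x \<in> form_seqs d n" and "range X \<subseteq> ?Q \<and> form_lim d n X x"
    then have X: "\<And>j. X j \<in> form_seqs d n" "\<And>j. null_seq (\<lambda>k. ?C (X j k) c)" and "form_lim d n X x"
      by auto
    then obtain N where N: "\<And>k. \<exists>J. \<forall>j\<ge>J. \<exists>M. \<forall>i\<ge>M. (x - X j) i \<in> pi_mult k (lat d n N)"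
      unfolding form_lim_def by meson
    obtain N' where N': "\<And>f. f \<in> lat d n N \<Longrightarrow> ?C f \<in> chain_lat d N'" using coeff_lat by blast
    have "\<exists>M. \<forall>i\<ge>M. ?C (x i) c \<in> frac_ideal (int k)" for k
    proof -
      \<comment> \<open>The extra \<open>N'\<close> powers compensate for the denominators allowed
        in \<open>chain_lat d N'\<close>.\<close>
      from N[of "k + N'"] obtain j M where M: "\<And>i. i \<ge> M \<Longrightarrow> (x - X j) i \<in> pi_mult (k + N') (lat d n N)"
        by blast
      obtain M' where M': "\<And>i. i \<ge> M' \<Longrightarrow> ?C (X j i) c \<in> frac_ideal (int k)"
        using X(2)[of j] unfolding null_seq_def by blast
      have "?C (x i) c \<in> frac_ideal (int k)" if "i \<ge> max M M'" for i
      proof -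
        have fr: "(x - X j) i \<in> free d n"
          using form_seqs_diff[OF x X(1)] by (rule free)
        have "?C ((x - X j) i) \<in> pi_mult (k + N') (chain_lat d N')"
          by (rule pi_mult_map[OF lin N' M fr]) (use that in auto)
        then have "pscale (unif_fract powi (- int (k + N'))) (?C ((x - X j) i)) c \<in> growth d N' (cell_len c)"
          unfolding pi_mult_iff chain_lat_def by blast
        then have "?C ((x - X j) i) c * unif_fract powi (- int (k + N')) \<in> frac_ideal (int k + (- int (k + N')))"
          using growth_frac_ideal by (fastforce simp: fun_apply mult.commute)
        then have "?C ((x - X j) i) c \<in> frac_ideal (int k)" unfolding frac_ideal_shift .
        moreover have "?C (X j i) c \<in> frac_ideal (int k)" using M' that by simp
        ultimately have "?C ((x - X j) i) c + ?C (X j i) c \<in> frac_ideal (int k)" by (rule frac_ideal_add)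
        then show ?thesis by (simp add: fun_apply lin_on_diff[OF lin free[OF x] free[OF X(1)]])
      qed
      then show ?thesis by blast
    qed
    with x show "x \<in> ?Q" unfolding null_seq_def by blast
  qed auto
  then show ?thesis using form_null_subset assms by blast
qed

subsection \<open>Sequences of forms and sequences of chains\<close>

abbreviation "iota \<equiv> lin_ext (iota_word tw)"
abbreviation "hb d \<equiv> lin_ext (b_word (alg d))"
abbreviation "cbd \<equiv> linop (bd tw)"

lemma lin_on_iota: "lin_on (nchains n) iota"
  using nchains_subspace nchains_fin_supp by (rule lin_on_lin_ext)

lemma lin_on_b: "lin_on (free d n) (hb d)"
  using free_subspace free_fin_supp by (rule lin_on_lin_ext)

lemma b_free: "f \<in> free d (Suc n) \<Longrightarrow> hb d f \<in> free d n"
proof (induction f rule: form_free_induct)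
  case (add c xs f)
  have "face (Mult (alg d)) i xs \<in> words (carr d) n" for i
    using add(1) Mult_Carrier by (intro face_words[of _ "carr d"]) auto
  then have "b_word (alg d) xs \<in> free d n"
    unfolding b_word_sum[OF add(1)] by (intro free_sum free_mult delta_free)
  with add show ?case
    by (simp add: lin_ext_add lin_ext_pscale free_fin_supp free_plus free_mult)
qed (simp add: pscale.subspace_0[OF free_subspace])

lemma b_null: "y \<in> form_null d (Suc n) \<Longrightarrow> (\<lambda>i. hb d (y i)) \<in> form_null d n"
  by (rule form_null_map[OF lin_on_b b_free b_lat])

lemma iota_seqs:
  assumes "\<And>i. y i \<in> nchains n" "cauchy_in (chain_lat d N) y"
  shows "(\<lambda>i. iota (y i)) \<in> form_seqs d n"
  by (rule form_seqsI[OF iota_free[OF assms(1)] cauchy_in_map[OF lin_on_iota iota_lat assms(2,1)]])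

lemma iota_null:
  assumes "\<And>i. y i \<in> nchains n" "null_in (chain_lat d N) y"
  shows "(\<lambda>i. iota (y i)) \<in> form_null d n"
  by (rule null_in_form_null[OF iota_free[OF assms(1)] null_in_map[OF lin_on_iota iota_lat assms(2,1)]])

text \<open>Upgrades pointwise convergence of coefficients to convergence in a lattice, which the
  homotopy and the coordinates preserve.\<close>

lemma null_of_iota_null:
  assumes "\<And>i. y i \<in> nchains n" "cauchy_in (chain_lat d N) y" "(\<lambda>i. iota (y i)) \<in> form_null d n"
  shows "null_in (chain_lat d N) y"
proof (rule cauchy_null_in_chain_lat[OF assms(2)])
  fix c
  show "null_seq (\<lambda>k. y k c)"
    using form_null_coeff[OF assms(3), of c] by (simp add: coeff_iota[OF tw_nonzero assms(1)])
qed

lemma b_iota_null: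
  assumes "\<And>i. y i \<in> nchains (Suc n)"
  shows "(\<lambda>i. hb d (iota (y i)) - iota (cbd (y i))) \<in> form_null d n"
  by (rule rel_form_null) (rule b_iota[OF assms])

text \<open>Truncating the letters of the \<open>k\<close>th term to the ball of radius \<open>k\<close> changes a Cauchy sequence only by
  a null sequence, because growth conditions force the tails to be small.\<close>

lemma ex_chain_seq:
  assumes x: "x \<in> form_seqs d n"
  shows "\<exists>y N. (\<forall>i. y i \<in> nchains n) \<and> cauchy_in (chain_lat d N) y \<and> (\<lambda>i. x i - iota (y i)) \<in> form_null d n"
proof -
  obtain N where N: "cauchy_in (lat d n N) x" "\<And>i. x i \<in> free d n" using form_seqsE[OF x] by blast
  define y where "y i = approx i (x i)" for i
  have y: "y i \<in> nchains n" for i unfolding y_def using N(2) by (rule approx_nchains)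
  \<comment> \<open>A Cauchy sequence only has its differences in a lattice. Absorbing the single
    term \<open>x i0\<close> puts a fixed multiple of the whole tail into one lattice, where
    \<open>approx_lat\<close> applies.\<close>
  obtain i0 where i0: "\<And>i. i \<ge> i0 \<Longrightarrow> x i - x i0 \<in> pi_mult 0 (lat d n N)"
    using N(1) unfolding cauchy_in_def by blast
  obtain M r where M: "pscale (unif_fract ^ r) (x i0) \<in> lat d n M" using free_absorbed[OF N(2)] by blast
  define M' where "M' = max N M"
  have abs: "pscale (unif_fract ^ r) (x i) \<in> lat d n M'" if "i \<ge> i0" for i
  proof -
    have "x i - x i0 \<in> lat d n N" using i0[OF that] by (simp add: pi_mult_iff)
    then have "pscale (unif_fract ^ r) (x i - x i0) \<in> lat d n N"
      using lat_mult[of "x i - x i0" d n N "unif ^ r"] by (simp add: to_fract_power)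
    then have "pscale (unif_fract ^ r) (x i - x i0) + pscale (unif_fract ^ r) (x i0) \<in> lat d n M'"
      using M lat_mono[of N M' d n] lat_mono[of M M' d n] by (intro lat_plus) (auto simp: M'_def)
    then show ?thesis by (simp add: pscale.scale_right_diff_distrib)
  qed
  obtain N' where N': "\<And>k. \<exists>J. \<forall>m\<ge>J. \<forall>f\<in>lat d n M'. f - iota (approx m f) \<in> pi_mult k (lat d n N')"
    using approx_lat[of d n M'] by blast
  have null: "null_in (lat d n N') (\<lambda>i. x i - iota (y i))"
    unfolding null_in_def
  proof
    fix k
    obtain J where J: "\<And>m f. m \<ge> J \<Longrightarrow> f \<in> lat d n M' \<Longrightarrow> f - iota (approx m f) \<in> pi_mult (k + r) (lat d n N')"
      using N'[of "k + r"] by blast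
    have "x i - iota (y i) \<in> pi_mult k (lat d n N')" if "i \<ge> max i0 J" for i
    proof -
      have "pscale (unif_fract ^ r) (x i) - iota (approx i (pscale (unif_fract ^ r) (x i))) \<in> pi_mult (k + r) (lat d n N')"
        using that by (intro J abs) auto
      then have "pscale (unif_fract powi (- int r)) (pscale (unif_fract ^ r) (x i - iota (y i))) \<in> pi_mult k (lat d n N')"
        using N(2)[of i] nchains_fin_supp[OF y[of i]]
        by (intro pi_mult_pscale[OF lat_subspace unif_fract_powi_in])
          (simp add: approx_pscale[of _ d n] y_def[symmetric] lin_ext_pscale pscale.scale_right_diff_distrib)
      then show ?thesis by (simp add: power_int_minus)
    qed
    then show "\<exists>M. \<forall>i\<ge>M. x i - iota (y i) \<in> pi_mult k (lat d n N')" by blast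
  qed
  have fr: "x i - iota (y i) \<in> free d n" for i
    by (intro free_minus N(2) iota_free y)
  have nf: "(\<lambda>i. x i - iota (y i)) \<in> form_null d n" using fr null by (rule null_in_form_null)
  \<comment> \<open>Subtracting a null sequence keeps the sequence Cauchy, and reading off
    coefficients transfers this to \<open>y\<close>.\<close>
  then have "x - (\<lambda>i. x i - iota (y i)) \<in> form_seqs d n"
    using form_null_seqs by (intro form_seqs_diff x) blast
  also have "x - (\<lambda>i. x i - iota (y i)) = (\<lambda>i. iota (y i))" by (auto simp: fun_eq_iff fun_apply)
  finally obtain L where L: "cauchy_in (lat d n L) (\<lambda>i. iota (y i))" by (auto elim: form_seqsE)
  obtain L' where L': "\<And>f. f \<in> lat d n L \<Longrightarrow> lin_ext (coeff_word tw) f \<in> chain_lat d L'" using coeff_lat by blast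
  have "cauchy_in (chain_lat d L') (\<lambda>i. lin_ext (coeff_word tw) (iota (y i)))"
    by (rule cauchy_in_map[OF lin_on_lin_ext[OF free_subspace free_fin_supp] L' L iota_free[OF y]])
  then have "cauchy_in (chain_lat d L') y" by (simp add: coeff_iota[OF tw_nonzero y])
  with y nf show ?thesis by blast
qed

end

section \<open>Homology classes and their coordinates\<close>

locale torus_twist = unit_twist l for l :: "'v::complete_dvr" +
  assumes nonroot: "\<forall>k>0. l ^ k \<noteq> 1"
    and residue: "CHAR('v) \<noteq> 0 \<longrightarrow> (\<forall>k>0. val (l ^ k - 1) = 0)"
begin

abbreviation "Z d n \<equiv> hochschild_cycles (alg d) n"
abbreviation "B d n \<equiv> hochschild_boundaries (alg d) n"

definition const_cycle :: "nat \<Rightarrow> (nat \<Rightarrow> 'v fract) \<Rightarrow> nat \<Rightarrow> 'v form" where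
  "const_cycle n v = (\<lambda>_. iota (from_coords n v))"

lemma tw_nonroot: "k \<noteq> 0 \<Longrightarrow> tw powi k \<noteq> 1"
proof -
  have *: "tw ^ j \<noteq> 1" if "j > 0" for j
    using nonroot that by (metis to_fract_power to_fract_1 to_fract_eq_iff)
  assume "k \<noteq> 0"
  then show ?thesis using *[of "nat k"] *[of "nat (- k)"]
    by (cases "k > 0") (auto simp: power_int_def field_simps)
qed

lemma boundaries_iff:
  "x \<in> B d n \<longleftrightarrow> x \<in> form_seqs d n \<and> (\<exists>y\<in>form_seqs d (Suc n). x - (\<lambda>i. hb d (y i)) \<in> form_null d n)"
  by (simp add: hochschild_boundaries_def numer_Omega form_null_def hochschild_b_def)

lemma cycles_iff:
  "x \<in> Z d n \<longleftrightarrow> x \<in> form_seqs d n \<and> (n = 0 \<or> (\<lambda>i. hb d (x i)) \<in> form_null d (n - 1))"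
  by (simp add: hochschild_cycles_def numer_Omega form_null_def hochschild_b_def)

lemma free_of_seq: "x \<in> form_seqs d n \<Longrightarrow> x i \<in> free d n"
  by (auto elim: form_seqsE)

lemma boundaries_subspace: "seq_scale.subspace (B d n)"
  unfolding seq_scale.subspace_def
proof (intro conjI ballI allI)
  show "0 \<in> B d n"
    unfolding boundaries_iff using form_null_0[of d n]
    by (intro conjI bexI[of _ 0] form_seqs_0) (simp add: fun_apply zero_fun_def[symmetric])
next
  fix x x'
  assume "x \<in> B d n" "x' \<in> B d n"
  then obtain y y' where *: "x \<in> form_seqs d n" "x' \<in> form_seqs d n" "y \<in> form_seqs d (Suc n)" "y' \<in> form_seqs d (Suc n)"
    "x - (\<lambda>i. hb d (y i)) \<in> form_null d n" "x' - (\<lambda>i. hb d (y' i)) \<in> form_null d n"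
    unfolding boundaries_iff by blast
  have eq: "x + x' - (\<lambda>i. hb d ((y + y') i)) = (x - (\<lambda>i. hb d (y i))) + (x' - (\<lambda>i. hb d (y' i)))"
    by (auto simp: fun_eq_iff fun_apply lin_on_add[OF lin_on_b free_of_seq[OF *(3)] free_of_seq[OF *(4)]])
  show "x + x' \<in> B d n"
    unfolding boundaries_iff
    by (intro conjI bexI[of _ "y + y'"] form_seqs_add * form_null_add[OF *(5,6), folded eq])
next
  fix c x
  assume "x \<in> B d n"
  then obtain y where *: "x \<in> form_seqs d n" "y \<in> form_seqs d (Suc n)" "x - (\<lambda>i. hb d (y i)) \<in> form_null d n"
    unfolding boundaries_iff by blast
  have eq: "seq_scale c x - (\<lambda>i. hb d (seq_scale c y i)) = seq_scale c (x - (\<lambda>i. hb d (y i)))"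
    by (auto simp: fun_eq_iff fun_apply lin_on_pscale[OF lin_on_b free_of_seq[OF *(2)]] algebra_simps)
  show "seq_scale c x \<in> B d n"
    unfolding boundaries_iff
    by (intro conjI bexI[of _ "seq_scale c y"] form_seqs_scale * form_null_scale[OF *(3), of c, folded eq])
qed

lemma const_cycle_add: "const_cycle n (v + w) = const_cycle n v + const_cycle n w"
  by (auto simp: const_cycle_def fun_eq_iff from_coords_add fun_apply
      lin_on_add[OF lin_on_iota from_coords_nchains from_coords_nchains])

lemma const_cycle_scale: "const_cycle n (pscale c v) = seq_scale c (const_cycle n v)"
  by (auto simp: const_cycle_def fun_eq_iff from_coords_pscale
      lin_on_pscale[OF lin_on_iota from_coords_nchains])

lemma const_cycle_diff: "const_cycle n (v - w) = const_cycle n v - const_cycle n w"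
  using const_cycle_add[of n "v - w" w] by simp

lemma const_cycle_seqs: "const_cycle n v \<in> form_seqs d n"
  by (rule form_seqsI[of _ _ _ 0])
    (auto simp: const_cycle_def cauchy_in_def pi_mult_0[OF lat_subspace] intro: iota_free from_coords_nchains)

lemma const_cycle_cycle: "const_cycle n v \<in> Z d n"
proof (cases n)
  case (Suc m)
  have "(\<lambda>i :: nat. hb d (iota (from_coords n v)) - iota (cbd (from_coords n v))) \<in> form_null d m"
    using b_iota_null[of "\<lambda>_. from_coords n v" m d] from_coords_nchains Suc by blast
  then have "(\<lambda>i. hb d (const_cycle n v i)) \<in> form_null d m" by (simp add: const_cycle_def bd_from_coords)
  then show ?thesis unfolding cycles_iff using const_cycle_seqs Suc by simp
qed (simp add: cycles_iff const_cycle_seqs)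

lemma bd_nchains_0: "f \<in> nchains 0 \<Longrightarrow> cbd f = 0"
proof (induction f rule: nchains_induct)
  case (add c g ws f)
  then have "bd tw g ws = 0" by (simp add: bd_def)
  with add show ?case by (simp add: linop_add linop_pscale nchains_fin_supp)
qed simp

lemma to_coords_boundary: "f \<in> nchains (Suc n) \<Longrightarrow> linop to_coords (cbd f) = 0"
proof (induction f rule: nchains_induct)
  case (add c g ws f)
  have "fin_supp (cbd f)" by (simp add: linop_def split_def)
  with add show ?case by (simp add: linop_add linop_pscale nchains_fin_supp to_coords_bd)
qed simp

lemma bd_chain_seq: "f \<in> nchains (Suc n) \<Longrightarrow> cbd f \<in> nchains n"
  by (erule linop_nchains) (rule nchains_bd)

lemma htp_chain_seq: "f \<in> nchains n \<Longrightarrow> linop (htp tw) f \<in> nchains (Suc n)"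
  by (erule linop_nchains) (metis nchains_htp)

lemma to_coords_vanish: "(f :: cell_index \<Rightarrow> 'v fract) \<in> nchains n \<Longrightarrow> j \<ge> betti n \<Longrightarrow> linop to_coords f j = 0"
proof (induction f rule: nchains_induct)
  case (add c g ws f)
  have "to_coords g ws j = (0 :: 'v fract)"
    using add.hyps(1) add.prems
    by (induction g ws rule: to_coords.induct) (auto simp: fun_apply delta_def)
  moreover have eq: "linop to_coords (pscale c (cell g ws) + f) = pscale c (to_coords g ws) + linop to_coords f"
    using add.hyps(2) by (simp add: linop_add linop_pscale nchains_fin_supp)
  ultimately show ?case unfolding eq using add.IH[OF add.prems] by (simp add: fun_apply)
qed (simp add: fun_apply)

text \<open>The homotopy writes the chains \<open>y i\<close> behind \<open>x\<close> as a boundary,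
  plus the homotopy of their boundary, plus a combination of representative cycles. The second
  summand is null, and the third converges together with its coordinates.\<close>

lemma cycle_homologous_const:
  assumes x: "x \<in> Z d n"
  shows "\<exists>v. (\<forall>i\<ge>betti n. v i = 0) \<and> x - const_cycle n v \<in> B d n"
proof -
  have xs: "x \<in> form_seqs d n" using x by (simp add: cycles_iff)
  obtain y N where y: "\<And>i. y i \<in> nchains n" "cauchy_in (chain_lat d N) y" "(\<lambda>i. x i - iota (y i)) \<in> form_null d n"
    using ex_chain_seq[OF xs] by blast
  \<comment> \<open>The chains \<open>cbd (y i)\<close> form a null sequence because
    \<open>x\<close> is a cycle, and the homotopy preserves null sequences; for \<open>n = 0\<close>
    they vanish.\<close>
  have htp_null: "\<exists>M. null_in (chain_lat d M) (\<lambda>i. linop (htp tw) (cbd (y i)))"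
  proof (cases n)
    case 0
    then have "cbd (y i) = 0" for i using y(1) bd_nchains_0 by simp
    then show ?thesis by (auto simp: null_in_def pi_mult_0[OF chain_lat_subspace])
  next
    case (Suc m)
    have y': "y i \<in> nchains (Suc m)" for i using y(1) Suc by simp
    obtain N1 where N1: "\<And>f. f \<in> chain_lat d N \<Longrightarrow> cbd f \<in> chain_lat d N1"
      using linop_bd_chain_lat[OF unit] by blast
    have c: "cauchy_in (chain_lat d N1) (\<lambda>i. cbd (y i))"
      by (rule cauchy_in_map[OF lin_on_linop N1 y(2,1)])
    have bx: "(\<lambda>i. hb d (x i)) \<in> form_null d m" using x Suc by (simp add: cycles_iff)
    have bxy: "(\<lambda>i. hb d (x i - iota (y i))) \<in> form_null d m" using b_null y(3) Suc by blast
    have "(\<lambda>i. hb d (x i)) - (\<lambda>i. hb d (x i - iota (y i))) - (\<lambda>i. hb d (iota (y i)) - iota (cbd (y i))) \<in> form_null d m"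
      by (intro form_null_diff bx bxy b_iota_null y')
    also have "(\<lambda>i. hb d (x i)) - (\<lambda>i. hb d (x i - iota (y i))) - (\<lambda>i. hb d (iota (y i)) - iota (cbd (y i))) = (\<lambda>i. iota (cbd (y i)))"
      by (auto simp: fun_eq_iff fun_apply lin_on_diff[OF lin_on_b free_of_seq[OF xs] iota_free[OF y(1)]])
    finally have "null_in (chain_lat d N1) (\<lambda>i. cbd (y i))"
      by (rule null_of_iota_null[OF bd_chain_seq[OF y'] c])
    moreover obtain N2 where N2: "\<And>f. f \<in> chain_lat d N1 \<Longrightarrow> linop (htp tw) f \<in> chain_lat d N2"
      using linop_htp_chain_lat[OF unit nonroot residue] by blast
    ultimately have "null_in (chain_lat d N2) (\<lambda>i. linop (htp tw) (cbd (y i)))"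
      by (intro null_in_map[OF lin_on_linop N2 _ bd_chain_seq[OF y']])
    then show ?thesis ..
  qed
  have htp_nchains: "linop (htp tw) (cbd (y i)) \<in> nchains n" for i
  proof (cases n)
    case 0
    then show ?thesis using bd_nchains_0 y(1)[of i] by simp
  next
    case (Suc m)
    then show ?thesis using htp_chain_seq bd_chain_seq y(1)[of i] by blast
  qed
  obtain N3 where N3: "\<And>f. f \<in> chain_lat d N \<Longrightarrow> linop (htp tw) f \<in> chain_lat d N3"
    using linop_htp_chain_lat[OF unit nonroot residue] by blast
  define h where "h i = linop (htp tw) (y i)" for i
  have h: "h i \<in> nchains (Suc n)" for i unfolding h_def using y(1) by (rule htp_chain_seq)
  have hs: "(\<lambda>i. iota (h i)) \<in> form_seqs d (Suc n)"
    using h cauchy_in_map[OF lin_on_linop N3 y(2,1)] unfolding h_def by (rule iota_seqs)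
  have "cauchy_in (coord_lat N) (\<lambda>i. linop to_coords (y i))"
    by (rule cauchy_in_map[OF lin_on_linop _ y(2,1)])
      (simp add: coord_lat_def linop_to_coords_frac_ideal)
  \<comment> \<open>The coordinates of \<open>y i\<close> vary with \<open>i\<close>; by
    completeness they have a limit, and replacing them by it changes the cycle by a null sequence
    only.\<close>
  from cauchy_coord_lat_limit[OF this] obtain v where v: "null_in (coord_lat N) (\<lambda>i. linop to_coords (y i) - v)" ..
  have v0: "v i = 0" if "i \<ge> betti n" for i
  proof -
    have "null_seq (\<lambda>k. linop to_coords (y k) i - v i)"
      unfolding null_seq_def
    proof
      fix k
      obtain M where "\<And>j. j \<ge> M \<Longrightarrow> linop to_coords (y j) - v \<in> pi_mult (k + N) (coord_lat N)"
        using v unfolding null_in_def by blast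
      then show "\<exists>M. \<forall>j\<ge>M. linop to_coords (y j) i - v i \<in> frac_ideal (int k)"
        unfolding pi_mult_coord_lat by (auto simp: fun_apply)
    qed
    then have "null_seq (\<lambda>k. - v i)" by (simp add: to_coords_vanish[OF y(1) that])
    then show ?thesis by (simp add: null_seq_const)
  qed
  have "null_in (chain_lat d (N + 2)) (\<lambda>i. from_coords n (linop to_coords (y i) - v))"
    by (rule null_in_map[OF lin_on_from_coords _ v])
      (rule from_coords_chain_lat, simp add: coord_lat_def, rule UNIV_I)
  then have cn: "(\<lambda>i. iota (from_coords n (linop to_coords (y i) - v))) \<in> form_null d n"
    by (rule iota_null[OF from_coords_nchains])
  have hn: "(\<lambda>i. iota (linop (htp tw) (cbd (y i)))) \<in> form_null d n"
  proof -
    from htp_null obtain M where "null_in (chain_lat d M) (\<lambda>i. linop (htp tw) (cbd (y i)))" ..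
    then show ?thesis by (rule iota_null[OF htp_nchains])
  qed
  have bh: "(\<lambda>i. hb d (iota (h i)) - iota (cbd (h i))) \<in> form_null d n" by (rule b_iota_null[OF h])
  have split: "iota (y i) = iota (cbd (h i)) + iota (linop (htp tw) (cbd (y i)))
      + iota (from_coords n (linop to_coords (y i) - v)) + iota (from_coords n v)" for i
  proof -
    have "y i = (cbd (h i) + linop (htp tw) (cbd (y i))) + (from_coords n (linop to_coords (y i) - v) + from_coords n v)"
      using htp_homotopy[OF tw_nonzero tw_nonroot y(1)[of i]] unfolding h_def from_coords_diff by simp
    then have "iota (y i) = iota ((cbd (h i) + linop (htp tw) (cbd (y i))) + (from_coords n (linop to_coords (y i) - v) + from_coords n v))"
      by simp
    also have "\<dots> = iota (cbd (h i)) + iota (linop (htp tw) (cbd (y i)))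
      + iota (from_coords n (linop to_coords (y i) - v)) + iota (from_coords n v)"
      using bd_chain_seq[OF h[of i]] htp_nchains[of i]
      by (simp add: lin_ext_add nchains_fin_supp[OF from_coords_nchains] nchains_fin_supp[of _ n] nchains_add)
    finally show ?thesis .
  qed
  have "(\<lambda>i. x i - iota (y i)) + (\<lambda>i. iota (linop (htp tw) (cbd (y i)))) + (\<lambda>i. iota (from_coords n (linop to_coords (y i) - v)))
      - (\<lambda>i. hb d (iota (h i)) - iota (cbd (h i))) \<in> form_null d n"
    by (intro form_null_diff form_null_add y(3) hn cn bh)
  also have "(\<lambda>i. x i - iota (y i)) + (\<lambda>i. iota (linop (htp tw) (cbd (y i)))) + (\<lambda>i. iota (from_coords n (linop to_coords (y i) - v)))
      - (\<lambda>i. hb d (iota (h i)) - iota (cbd (h i))) = (x - const_cycle n v) - (\<lambda>i. hb d (iota (h i)))"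
    unfolding split by (rule ext) (simp add: fun_apply(1,3) const_cycle_def algebra_simps)
  finally have "x - const_cycle n v - (\<lambda>i. hb d (iota (h i))) \<in> form_null d n" .
  then have "x - const_cycle n v \<in> B d n"
    unfolding boundaries_iff by (intro conjI bexI[OF _ hs] form_seqs_diff[OF xs const_cycle_seqs])
  with v0 show ?thesis by blast
qed

text \<open>The coordinates kill boundaries and are a bounded left inverse of
  \<open>from_coords\<close>; on a null sequence of chains whose coordinates are constantly
  \<open>v\<close> they force \<open>v = 0\<close>.\<close>

lemma const_cycle_boundary:
  assumes v: "\<forall>i\<ge>betti n. v i = 0" and B: "const_cycle n v \<in> B d n"
  shows "v = 0"
proof -
  from B obtain y' where y': "y' \<in> form_seqs d (Suc n)" "const_cycle n v - (\<lambda>i. hb d (y' i)) \<in> form_null d n"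
    unfolding boundaries_iff by blast
  obtain y N where y: "\<And>i. y i \<in> nchains (Suc n)" "cauchy_in (chain_lat d N) y"
    "(\<lambda>i. y' i - iota (y i)) \<in> form_null d (Suc n)"
    using ex_chain_seq[OF y'(1)] by blast
  obtain N1 where N1: "\<And>f. f \<in> chain_lat d N \<Longrightarrow> cbd f \<in> chain_lat d N1"
    using linop_bd_chain_lat[OF unit] by blast
  define z where "z i = from_coords n v - cbd (y i)" for i
  have z: "z i \<in> nchains n" for i
    unfolding z_def using bd_chain_seq[OF y(1)] by (intro nchains_diff from_coords_nchains)
  have "cauchy_in (chain_lat d N1) (\<lambda>i. cbd (y i))"
    by (rule cauchy_in_map[OF lin_on_linop N1 y(2,1)])
  \<comment> \<open>The constant summand of \<open>z\<close> cancels in differences, so only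
    \<open>- cbd (y i)\<close> has to be Cauchy.\<close>
  from cauchy_in_scale[OF chain_lat_subspace this, of "-1"] have c: "cauchy_in (chain_lat d N1) z"
    unfolding cauchy_in_def z_def by simp
  have "(const_cycle n v - (\<lambda>i. hb d (y' i))) + (\<lambda>i. hb d (y' i - iota (y i))) + (\<lambda>i. hb d (iota (y i)) - iota (cbd (y i))) \<in> form_null d n"
    by (intro form_null_add y'(2) b_null[OF y(3)] b_iota_null y(1))
  also have "(const_cycle n v - (\<lambda>i. hb d (y' i))) + (\<lambda>i. hb d (y' i - iota (y i))) + (\<lambda>i. hb d (iota (y i)) - iota (cbd (y i))) = (\<lambda>i. iota (z i))"
    by (rule ext) (simp add: fun_apply(1,3) const_cycle_def z_def
        lin_on_diff[OF lin_on_b free_of_seq[OF y'(1)] iota_free[OF y(1)]]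
        lin_on_diff[OF lin_on_iota from_coords_nchains bd_chain_seq[OF y(1)]])
  finally have null: "null_in (chain_lat d N1) z" using z c by (intro null_of_iota_null)
  have "null_in (coord_lat N1) (\<lambda>i. linop to_coords (z i))"
    by (rule null_in_map[OF lin_on_linop _ null z])
      (simp add: coord_lat_def linop_to_coords_frac_ideal)
  moreover have "linop to_coords (z i) = v" for i
    unfolding z_def lin_on_diff[OF lin_on_linop from_coords_nchains bd_chain_seq[OF y(1)]]
    by (simp add: to_coords_boundary[OF y(1)] to_coords_from_coords[OF v])
  ultimately have "null_in (coord_lat N1) (\<lambda>i. v)" by simp
  then have "v j \<in> frac_ideal (int k - int N1)" for j k
    unfolding null_in_def pi_mult_coord_lat by blast
  from this[of _ "_ + N1"] have "v j \<in> frac_ideal (int k)" for j k by simp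
  then show ?thesis by (auto simp: fun_eq_iff fun_apply intro: frac_ideal_all)
qed

subsection \<open>The isomorphisms\<close>

definition coset :: "bool \<Rightarrow> nat \<Rightarrow> (nat \<Rightarrow> 'v form) \<Rightarrow>
    (nat \<Rightarrow> 'v form) set" where
  "coset d n z = {z + b | b. b \<in> B d n}"

lemmas B_0 = seq_scale.subspace_0[OF boundaries_subspace]
  and B_add = seq_scale.subspace_add[OF boundaries_subspace]
  and B_diff = seq_scale.subspace_diff[OF boundaries_subspace]
  and B_scale = seq_scale.subspace_scale[OF boundaries_subspace]

lemma coset_eq_iff: "coset d n z = coset d n z' \<longleftrightarrow> z - z' \<in> B d n"
proof
  assume "coset d n z = coset d n z'"
  moreover have "z + 0 \<in> coset d n z" unfolding coset_def using B_0 by blast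
  ultimately have "z \<in> coset d n z'" by simp
  then show "z - z' \<in> B d n" by (auto simp: coset_def)
next
  assume *: "z - z' \<in> B d n"
  have "z + b = z' + ((z - z') + b)" "z' + b = z + (b - (z - z'))" for b by simp_all
  then show "coset d n z = coset d n z'"
    unfolding coset_def using B_add[OF *] B_diff[OF _ *] by (auto, metis, metis)
qed

text \<open>Injectivity rests on \<open>const_cycle_boundary\<close>, surjectivity on
  \<open>cycle_homologous_const\<close>.\<close>

lemma HH_iso_coords:
  "vect_iso (\<lambda>v. coset d n (const_cycle n v)) (coord_space (betti n)) (HH n (alg d))"
  unfolding vect_iso_def
proof (intro conjI ballI allI)
  let ?\<theta> = "\<lambda>v. coset d n (const_cycle n v)"
  show "bij_betw ?\<theta> (vcarrier (coord_space (betti n))) (vcarrier (HH n (alg d)))"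
  proof (rule bij_betw_imageI)
    show "inj_on ?\<theta> (vcarrier (coord_space (betti n)))"
    proof (rule inj_onI)
      fix v w
      assume *: "v \<in> vcarrier (coord_space (betti n))" "w \<in> vcarrier (coord_space (betti n))" "?\<theta> v = ?\<theta> w"
      then have "const_cycle n (v - w) \<in> B d n" by (simp add: coset_eq_iff const_cycle_diff)
      moreover have "\<forall>i\<ge>betti n. (v - w) i = 0" using * by (simp add: coord_space_def fun_apply)
      ultimately have "v - w = 0" by (rule const_cycle_boundary[rotated])
      then show "v = w" by simp
    qed
    have HH: "vcarrier (HH n (alg d)) = coset d n ` Z d n"
      by (auto simp: HH_def quotient_space_def coset_def)
    show "?\<theta> ` vcarrier (coord_space (betti n)) = vcarrier (HH n (alg d))"
      unfolding HH
    proof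
      show "?\<theta> ` vcarrier (coord_space (betti n)) \<subseteq> coset d n ` Z d n"
        using const_cycle_cycle by blast
      show "coset d n ` Z d n \<subseteq> ?\<theta> ` vcarrier (coord_space (betti n))"
      proof
        fix X
        assume "X \<in> coset d n ` Z d n"
        then obtain x where x: "x \<in> Z d n" "X = coset d n x" by blast
        from cycle_homologous_const[OF x(1)] obtain v where
          v: "\<forall>i\<ge>betti n. v i = 0" "x - const_cycle n v \<in> B d n" by blast
        then have "X = ?\<theta> v" by (simp add: x(2) coset_eq_iff)
        with v(1) show "X \<in> ?\<theta> ` vcarrier (coord_space (betti n))" by (auto simp: coord_space_def)
      qed
    qed
  qed
next
  fix v w :: "nat \<Rightarrow> 'v fract"
  have "vadd (HH n (alg d)) (coset d n z) (coset d n z') = coset d n (z + z')" for z z'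
  proof -
    have "{x + y | x y. x \<in> coset d n z \<and> y \<in> coset d n z'} = coset d n (z + z')"
    proof safe
      fix x y
      assume "x \<in> coset d n z" "y \<in> coset d n z'"
      then obtain b b' where "x = z + b" "y = z' + b'" "b \<in> B d n" "b' \<in> B d n" unfolding coset_def by blast
      then show "x + y \<in> coset d n (z + z')"
        unfolding coset_def by (intro CollectI exI[of _ "b + b'"]) (auto simp: B_add algebra_simps)
    next
      fix x
      assume "x \<in> coset d n (z + z')"
      then obtain b where "x = (z + 0) + (z' + b)" "b \<in> B d n" unfolding coset_def by (auto simp: add.assoc)
      then show "\<exists>xa y. x = xa + y \<and> xa \<in> coset d n z \<and> y \<in> coset d n z'"
        unfolding coset_def using B_0 by blast
    qed
    then show ?thesis by (simp add: HH_def quotient_space_def)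
  qed
  then show "coset d n (const_cycle n (vadd (coord_space (betti n)) v w)) =
      vadd (HH n (alg d)) (coset d n (const_cycle n v)) (coset d n (const_cycle n w))"
    by (simp add: coord_space_def const_cycle_add)
next
  fix c and v :: "nat \<Rightarrow> 'v fract"
  have "vscale (HH n (alg d)) c (coset d n z) = coset d n (seq_scale c z)" for z
  proof -
    have "{seq_scale c x + b | x b. x \<in> coset d n z \<and> b \<in> B d n} = coset d n (seq_scale c z)"
    proof safe
      fix x b
      assume "x \<in> coset d n z" and b: "b \<in> B d n"
      then obtain b' where b': "x = z + b'" "b' \<in> B d n" unfolding coset_def by blast
      have "seq_scale c x + b = seq_scale c z + (seq_scale c b' + b)"
        by (auto simp: b' fun_eq_iff fun_apply algebra_simps)
      moreover have "seq_scale c b' + b \<in> B d n" using b b' B_scale B_add by blast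
      ultimately show "seq_scale c x + b \<in> coset d n (seq_scale c z)" unfolding coset_def by blast
    next
      fix x
      assume "x \<in> coset d n (seq_scale c z)"
      then obtain b where "x = seq_scale c z + b" "b \<in> B d n" unfolding coset_def by blast
      moreover have "z + 0 \<in> coset d n z" unfolding coset_def using B_0 by blast
      ultimately show "\<exists>xa b. x = seq_scale c xa + b \<and> xa \<in> coset d n z \<and> b \<in> B d n" by auto
    qed
    then show ?thesis by (simp add: HH_def quotient_space_def)
  qed
  then show "coset d n (const_cycle n (vscale (coord_space (betti n)) c v)) =
      vscale (HH n (alg d)) c (coset d n (const_cycle n v))"
    by (simp add: coord_space_def const_cycle_scale)
qed

section \<open>Comparison of the torus with its dagger completion\<close>

lemma rel_False_True: "rel False n \<subseteq> rel True n"
proof (rule rel_subset[OF rel_subspace])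
  have *: "set us \<subseteq> carr True" if "set us \<subseteq> carr False" for us using that Carrier_False_True by blast
  have C: "a \<in> carr True" if "a \<in> carr False" for a using that Carrier_False_True by blast
  fix us vs :: "(int \<times> int \<Rightarrow> 'v fract) list" and a a' c
  assume **: "length us + length vs = n" "set us \<subseteq> carr False" "set vs \<subseteq> carr False"
  show "delta (us @ (a + a') # vs) - delta (us @ a # vs) - delta (us @ a' # vs) \<in> rel True n"
    if "a \<in> carr False" "a' \<in> carr False"
    by (intro rel_add **(1) *[OF **(2)] *[OF **(3)] C that)
  show "delta (us @ pscale c a # vs) - pscale c (delta (us @ a # vs)) \<in> rel True n"
    if "a \<in> carr False"
    by (intro rel_scale **(1) *[OF **(2)] *[OF **(3)] C that)
  show "delta (us @ delta 0 # vs) \<in> rel True n" if "us \<noteq> []"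
    by (intro rel_One **(1) *[OF **(2)] *[OF **(3)] that)
qed

lemma lat_False_True: "lat False n N \<subseteq> lat True n N"
proof (rule lat_subset[OF lat_subspace])
  have "bset False N \<subseteq> (bset True N :: (int \<times> int \<Rightarrow> 'v fract) set)" by (blast intro: bset_False_True)
  then show "delta xs \<in> lat True n N" if "xs \<in> words (bset False N) n" for xs :: "(int \<times> int \<Rightarrow> 'v fract) list"
    using that by (intro lat_word) (auto simp: words_def)
  show "rel False n \<subseteq> lat True n N" using rel_False_True by (blast intro: lat_rel)
qed

lemma free_False_True: "free False n \<subseteq> free True n"
  using Carrier_False_True by (force simp: form_free_def words_def)

lemma seqs_False_True: "form_seqs False n \<subseteq> form_seqs True n"
  unfolding form_seqs_def using free_False_True cauchy_in_mono[OF lat_False_True] by blast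

lemma null_False_True: "form_null False n \<subseteq> form_null True n"
proof
  fix x
  assume x: "x \<in> form_null False n"
  have lin: "lin_on (free False n) (\<lambda>f. f)" by (simp add: lin_on_def free_subspace)
  have "\<exists>N'. \<forall>f\<in>lat False n N. f \<in> lat True n N'" for N using lat_False_True by blast
  from form_null_map[OF lin _ this x] show "x \<in> form_null True n"
    using free_False_True by blast
qed

lemma b_False_True:
  assumes "f \<in> free False (Suc n)"
  shows "hb True f = hb False f"
  unfolding lin_ext_def
proof (rule sum.cong)
  fix xs
  assume "xs \<in> {xs. f xs \<noteq> 0}"
  then have xs: "xs \<in> words (carr False) (Suc n)" using assms by (auto simp: form_free_def)
  have "face (Mult (alg True)) i xs = face (Mult (alg False)) i xs" for i
  proof (cases "Suc i < length xs")
    case True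
    then have "xs ! i \<in> carr False" "xs ! Suc i \<in> carr False" using xs by (auto simp: words_def)
    then show ?thesis using True by (simp add: face_def mrg_def Mult_False_True)
  next
    case False
    have "last xs \<in> carr False" "hd xs \<in> carr False" using xs by (cases xs; auto simp: words_def)+
    then show ?thesis using False by (simp add: face_def Mult_False_True)
  qed
  then show "pscale (f xs) (b_word (alg True) xs) = pscale (f xs) (b_word (alg False) xs)"
    by (simp only: b_word_sum[OF xs])
qed simp

lemma boundaries_False_True: "B False n \<subseteq> B True n"
proof
  fix x
  assume "x \<in> B False n"
  then obtain y where *: "x \<in> form_seqs False n" "y \<in> form_seqs False (Suc n)"
    "x - (\<lambda>i. hb False (y i)) \<in> form_null False n" unfolding boundaries_iff by blast
  have "(\<lambda>i. hb False (y i)) = (\<lambda>i. hb True (y i))"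
    by (simp add: b_False_True[OF free_of_seq[OF *(2)]])
  with * show "x \<in> B True n"
    unfolding boundaries_iff using seqs_False_True null_False_True by fastforce
qed

text \<open>The inclusion acts as the identity on representatives, the constant cycles are the same
  for both algebras, and boundaries for the torus are boundaries for the dagger completion.\<close>

lemma HH_map_coset:
  "HH_map n (\<lambda>x. x) (alg True) (coset False n (const_cycle n v)) = coset True n (const_cycle n v)"
proof -
  have id: "(\<lambda>i. lin_ext (\<lambda>xs. delta (map (\<lambda>x. x) xs)) (x i)) = x" if "x \<in> coset False n (const_cycle n v)" for x
  proof -
    from that have "x \<in> form_seqs False n"
      unfolding coset_def boundaries_iff by (auto intro: form_seqs_add const_cycle_seqs)
    then have "fin_supp (x i)" for i using free_fin_supp free_of_seq by blast
    then show ?thesis by (simp add: lin_ext_of_delta)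
  qed
  have "HH_map n (\<lambda>x. x) (alg True) (coset False n (const_cycle n v)) =
      {x + b | x b. x \<in> coset False n (const_cycle n v) \<and> b \<in> B True n}"
    unfolding HH_map_def using id by (intro Collect_cong ex_cong1) auto
  also have "\<dots> = coset True n (const_cycle n v)"
  proof safe
    fix x b
    assume "x \<in> coset False n (const_cycle n v)" and b: "b \<in> B True n"
    then obtain b' where b': "x = const_cycle n v + b'" "b' \<in> B False n" unfolding coset_def by blast
    have "x + b = const_cycle n v + (b' + b)" by (simp add: b')
    moreover have "b' + b \<in> B True n" using b b' boundaries_False_True B_add by blast
    ultimately show "x + b \<in> coset True n (const_cycle n v)" unfolding coset_def by blast
  next
    fix x
    assume "x \<in> coset True n (const_cycle n v)"
    then obtain b where "x = const_cycle n v + b" "b \<in> B True n" unfolding coset_def by blast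
    moreover have "const_cycle n v + 0 \<in> coset False n (const_cycle n v)" unfolding coset_def using B_0 by blast
    ultimately show "\<exists>xa b. x = xa + b \<and> xa \<in> coset False n (const_cycle n v) \<and> b \<in> B True n" by auto
  qed
  finally show ?thesis .
qed

end

text \<open>On \<open>vcarrier X\<close> the map \<open>f\<close> is the composite of
  \<open>\<theta>'\<close> with the inverse of \<open>\<theta>\<close>, hence an
  isomorphism.\<close>

lemma vect_iso_factor:
  assumes \<theta>: "vect_iso \<theta> (coord_space m) X" and \<theta>': "vect_iso \<theta>' (coord_space m) Y"
    and f: "\<And>v. f (\<theta> v) = \<theta>' v"
  shows "vect_iso f X Y"
proof -
  let ?C = "vcarrier (coord_space m) :: (nat \<Rightarrow> 'a) set"
  have X: "vcarrier X = \<theta> ` ?C" and inj: "inj_on \<theta> ?C" and Y: "bij_betw \<theta>' ?C (vcarrier Y)"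
    using \<theta> \<theta>' by (auto simp: vect_iso_def bij_betw_def)
  have "bij_betw (f \<circ> \<theta>) ?C (vcarrier Y)" using Y by (simp add: comp_def f)
  then have "bij_betw f (vcarrier X) (vcarrier Y)"
    using bij_betw_comp_iff[of \<theta> ?C "vcarrier X" f] \<theta> by (simp add: vect_iso_def)
  moreover have "f (vadd X x y) = vadd Y (f x) (f y)" if "x \<in> vcarrier X" "y \<in> vcarrier X" for x y
  proof -
    from that obtain v w where v: "v \<in> ?C" "w \<in> ?C" "x = \<theta> v" "y = \<theta> w" unfolding X by blast
    have "vadd X x y = \<theta> (vadd (coord_space m) v w)" "vadd Y (\<theta>' v) (\<theta>' w) = \<theta>' (vadd (coord_space m) v w)"
      using \<theta> \<theta>' v unfolding vect_iso_def by simp_all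
    then show ?thesis by (simp add: v f)
  qed
  moreover have "f (vscale X c x) = vscale Y c (f x)" if "x \<in> vcarrier X" for c x
  proof -
    from that obtain v where v: "v \<in> ?C" "x = \<theta> v" unfolding X by blast
    have "vscale X c x = \<theta> (vscale (coord_space m) c v)" "vscale Y c (\<theta>' v) = \<theta>' (vscale (coord_space m) c v)"
      using \<theta> \<theta>' v unfolding vect_iso_def by simp_all
    then show ?thesis by (simp add: v f)
  qed
  ultimately show ?thesis by (simp add: vect_iso_def)
qed

lemma vect_iso_coords_sym:
  assumes \<theta>: "vect_iso \<theta> (coord_space m :: ('k::field, nat \<Rightarrow> 'k) vect) X"
  shows "vect_isomorphic X (coord_space m :: ('k::field, nat \<Rightarrow> 'k) vect)"
proof -
  let ?C = "vcarrier (coord_space m) :: (nat \<Rightarrow> 'k) set"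
  define g where "g = inv_into ?C \<theta>"
  have bij: "bij_betw \<theta> ?C (vcarrier X)" using \<theta> by (simp add: vect_iso_def)
  then have g: "g (\<theta> v) = v" if "v \<in> ?C" for v
    using that by (simp add: g_def bij_betw_def inv_into_f_f)
  have X: "vcarrier X = \<theta> ` ?C" using bij by (simp add: bij_betw_def)
  have cl: "vadd (coord_space m) v w \<in> ?C" "vscale (coord_space m) c v \<in> ?C" if "v \<in> ?C" "w \<in> ?C" for v w c
    using that by (auto simp: coord_space_def fun_apply)
  have "vect_iso g X (coord_space m)"
    unfolding vect_iso_def
  proof (intro conjI ballI allI)
    show "bij_betw g (vcarrier X) ?C" unfolding g_def using bij by (rule bij_betw_inv_into)
  next
    fix x y
    assume "x \<in> vcarrier X" "y \<in> vcarrier X"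
    then obtain v w where v: "v \<in> ?C" "w \<in> ?C" "x = \<theta> v" "y = \<theta> w" unfolding X by blast
    then have "vadd X x y = \<theta> (vadd (coord_space m) v w)" using \<theta> unfolding vect_iso_def by simp
    then show "g (vadd X x y) = vadd (coord_space m) (g x) (g y)" using v cl by (simp add: g)
  next
    fix c x
    assume "x \<in> vcarrier X"
    then obtain v where v: "v \<in> ?C" "x = \<theta> v" unfolding X by blast
    then have "vscale X c x = \<theta> (vscale (coord_space m) c v)" using \<theta> unfolding vect_iso_def by simp
    then show "g (vscale X c x) = vscale (coord_space m) c (g x)" using v cl by (simp add: g)
  qed
  then show ?thesis unfolding vect_isomorphic_def by blast
qed

theorem theorem4p5:
  fixes l :: "'v::complete_dvr"
    and n :: nat
  assumes "val l = 0"
    and "\<forall>k>0. l ^ k \<noteq> 1"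
    and "CHAR('v) \<noteq> 0 \<longrightarrow> (\<forall>k>0. val (l ^ k - 1) = 0)"
  shows "vect_iso (HH_map n (\<lambda>x. x) (base_change (torus_dagger l)))
           (HH n (base_change (torus l))) (HH n (base_change (torus_dagger l)))
       \<and> vect_isomorphic (HH n (base_change (torus_dagger l)))
           (coord_space (if n = 0 then 1 else if n = 1 then 2 else if n = 2 then 1 else 0)
             :: ('v fract, nat \<Rightarrow> 'v fract) vect)"
proof -
  interpret torus_twist l
    by unfold_locales (use assms in \<open>auto simp: val_eq_0_iff\<close>)
  have alg: "alg True = base_change (torus_dagger l)" "alg False = base_change (torus l)"
    by (simp_all add: torus_alg_def)
  have "vect_iso (HH_map n (\<lambda>x. x) (alg True)) (HH n (alg False)) (HH n (alg True))"
    using HH_iso_coords HH_iso_coords HH_map_coset by (rule vect_iso_factor)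
  moreover have "vect_isomorphic (HH n (alg True)) (coord_space (betti n) :: ('v fract, nat \<Rightarrow> 'v fract) vect)"
    using HH_iso_coords by (rule vect_iso_coords_sym)
  ultimately show ?thesis unfolding alg betti_def by blast
qed

end
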